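(* Let $A$ and $B$ be two $n\times n$ Hermitian matrices, and let $b_1$ and $b_n$ denote the smallest and the largest eigenvalues of $B$, respectively. Define $$f(t)=\mathrm{Tr}\, e^{A-tB},\qquad t\in\mathbf{R}.$$ Then there exists a non-negative (Borel) measure $\mu$ on the closed interval $[b_1,b_n]$ such that $$f(t)=\int_{[b_1,b_n]} e^{-st}\,d\mu(s)\qquad\text{for all } t\in\mathbf{R}.$$
   Context: $\mathrm{Tr}$ is the matrix trace and $e^{M}$ is the matrix exponential. Hermitian matrices have complex entries. *)

theory Defs
  imports "HOL-Analysis.Analysis" "Jordan_Normal_Form.Schur_Decomposition"
begin

definition hermitian_mat :: "complex mat \<Rightarrow> bool" where
  "hermitian_mat M \<longleftrightarrow> mat_adjoint M = M"

definition mat_trace :: "complex mat \<Rightarrow> complex" where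
  "mat_trace M = (\<Sum>i<dim_row M. M $$ (i, i))"

(* The type of matrices carries no topology, so the exponential series is summed
   entrywise, which is the same as convergence in any norm on the n x n matrices.
   It is meant for square M only. *)
definition mat_exp :: "complex mat \<Rightarrow> complex mat" where
  "mat_exp M = mat (dim_row M) (dim_row M) (\<lambda>(i, j). \<Sum>k. (M ^\<^sub>m k) $$ (i, j) / fact k)"

end

theory Submission
  imports Defs "HOL-Complex_Analysis.Complex_Analysis" "HOL-Probability.Probability"
    "Jordan_Normal_Form.Spectral_Radius"
begin

text \<open>
  Idea. Schur triangularization writes Tr exp X as the sum of exp l over the roots l of the
  characteristic polynomial. Fix v = \<theta> + i \<delta> with \<delta> > 0 and let
  D(s,y) = det (s - A - y (v - B)). By Rayleigh quotients every zero of D has the form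
  s = a + y (v - b) with a and b real and bounded.

  The kernel k(y) = y / (1 - i \<epsilon> y)^2 has non-negative imaginary part on the upper half-plane, so
  by residues the integral N(s) of k times the y-derivative of log D over real y is 2 pi i times the
  sum of k over the roots y of D(s,y) in the upper half-plane: Re N(s) is at most 0 for real s, and
  N(s) = 0 for large s. Integrate N(s) / (s - \<zeta>)^3 over s instead, by Fubini: for Im \<zeta> > 0
  the part y > 0 vanishes, and on y < 0 Cauchy's formula, integration by parts and a
  rotation of the half-line to the imaginary axis leave the integral of k'(ir) times the second
  s-derivative of log D at (\<zeta>, ir) over r > 0; a reflection covers Im \<zeta> < 0. An inverse Laplace
  transform in \<zeta>, followed by \<epsilon> tending to 0, yields that the integral over r > 0 of
  exp (i r \<theta> - \<delta> r) Tr exp (A - i r B) has non-negative real part.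

  Averaging this over \<theta> against a Gaussian and letting \<delta> tend to 0 gives non-negative densities;
  by a contour shift their exponential moments at t are exp (\<sigma>^2 t^2 / 2) Tr exp (A + t B). Helly's
  selection theorem for \<sigma> tending to 0 gives the measure, and the growth of Tr exp (A + t B) confines
  it to the interval spanned by the spectrum of B.
\<close>

section \<open>Contour integrals in the upper half-plane\<close>

text \<open>The half-line integral is dictated by the sought measure: if Tr exp (A + z B) is the
  integral of exp (z x) over a measure M, then it equals the integral of 1 / (\<delta> - i (\<theta>
  - x)), whose real part is a Poisson kernel. Its positivity thus says that the Poisson extension of
  M is non-negative. If A and B commuted, M would be a sum of point masses. In general single
  eigenvalues of A - i r B give no positivity, and only symmetric functions of them, through log D,
  are used. Since \<delta> > 0, a real s and a real y satisfy D(s,y) = 0 only for y = 0. There the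
  y-derivative of log D can grow like 1/|y|; the factor y of k absorbs this, and \<epsilon> > 0
  supplies the decay at infinity that k(y) = y lacks. The exponent 3 fits the second s-derivative of
  log D, a sum of terms -1 / (s - l)^2: the inverse Laplace transform in \<zeta> turns these into
  multiples of exp l and (s - \<zeta>)^(-3) into a multiple of exp s, so the sign of Re N(s)
  survives under a positive weight.\<close>

lemma integrable_inverse_1_plus_square_lborel: "integrable lborel (\<lambda>x::real. 1 / (1 + x\<^sup>2))"
proof -
  have "einterval (-\<infinity>) \<infinity> = UNIV" by (auto simp: einterval_def)
  with integrable_inverse_1_plus_square show ?thesis
    by (simp add: set_integrable_def inverse_eq_divide)
qed

lemma integrable_AE_bound_inverse_square:
  fixes f :: "real \<Rightarrow> 'a :: {banach, second_countable_topology}"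
  assumes [measurable]: "f \<in> borel_measurable borel"
    and "AE x in lborel. norm (f x) \<le> K / (1 + x\<^sup>2)"
  shows "integrable lborel f"
proof (rule Bochner_Integration.integrable_bound)
  show "integrable lborel (\<lambda>x. K * (1 / (1 + x\<^sup>2)) :: real)"
    using integrable_inverse_1_plus_square_lborel by (rule integrable_mult_right)
  show "AE x in lborel. norm (f x) \<le> norm (K * (1 / (1 + x\<^sup>2)))"
    using assms(2)
  proof eventually_elim
    case (elim x)
    moreover have "K / (1 + x\<^sup>2) \<le> norm (K * (1 / (1 + x\<^sup>2)))"
      using abs_ge_self[of K] by (simp add: abs_mult divide_right_mono)
    ultimately show ?case by linarith
  qed
qed simp

lemma integrable_decay_square:
  fixes f :: "real \<Rightarrow> complex"
  assumes cont: "continuous_on UNIV f" and R: "R0 > 0"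
    and bd: "\<And>x. \<bar>x\<bar> \<ge> R0 \<Longrightarrow> norm (f x) \<le> K / x\<^sup>2"
  shows "integrable lborel f"
proof -
  have "continuous_on {-R0..R0} f" using cont continuous_on_subset by blast
  then have "compact (f ` {-R0..R0})" by (intro compact_continuous_image) auto
  from compact_imp_bounded[OF this, unfolded bounded_iff]
  obtain L where L': "\<forall>y\<in>f ` {-R0..R0}. norm y \<le> L" ..
  have L: "norm (f x) \<le> L" if "\<bar>x\<bar> \<le> R0" for x
  proof -
    have "x \<in> {-R0..R0}" using that by (simp add: abs_le_iff)
    then show ?thesis using L' by simp
  qed
  have L0: "L \<ge> 0" using L[of 0] R norm_ge_zero[of "f 0"] by linarith
  have K0: "K \<ge> 0"
  proof -
    have "0 \<le> K / R0\<^sup>2" using bd[of R0] R norm_ge_zero[of "f R0"] by linarith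
    then show ?thesis using R by (simp add: zero_le_divide_iff)
  qed
  \<comment> \<open>The first summand dominates on the compact part, where \<open>f\<close> is only
    known to be continuous, the second on the tails. Both are non-negative, so each may be enlarged
    to the sum.\<close>
  define K' where "K' = L * (1 + R0\<^sup>2) + K * (1 + 1 / R0\<^sup>2)"
  have "norm (f x) \<le> K' / (1 + x\<^sup>2)" for x
  proof (cases "\<bar>x\<bar> \<le> R0")
    case True
    then have "x\<^sup>2 \<le> R0\<^sup>2" by (metis abs_le_square_iff abs_of_pos R)
    then have "norm (f x) * (1 + x\<^sup>2) \<le> L * (1 + R0\<^sup>2)"
      using L[OF True] L0 by (intro mult_mono) auto
    also have "\<dots> \<le> K'" unfolding K'_def using K0 by simp
    finally show ?thesis by (simp add: pos_le_divide_eq add_pos_nonneg)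
  next
    case False
    then have x: "\<bar>x\<bar> \<ge> R0" "x \<noteq> 0" "R0\<^sup>2 \<le> x\<^sup>2" using R by (auto simp: abs_le_square_iff[symmetric])
    have "norm (f x) * (1 + x\<^sup>2) \<le> K / x\<^sup>2 * (1 + x\<^sup>2)" using bd[OF x(1)] by (intro mult_right_mono) auto
    also have "\<dots> = K * (1 + 1 / x\<^sup>2)" using x by (simp add: field_simps)
    also have "\<dots> \<le> K * (1 + 1 / R0\<^sup>2)" using x K0 R by (intro mult_left_mono add_left_mono divide_left_mono) auto
    also have "\<dots> \<le> K'" unfolding K'_def using L0 by simp
    finally show ?thesis by (simp add: pos_le_divide_eq add_pos_nonneg)
  qed
  moreover have "f \<in> borel_measurable borel" using cont by (rule borel_measurable_continuous_onI)
  ultimately show ?thesis by (intro integrable_AE_bound_inverse_square[where K = K']) auto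
qed

text \<open>Bridge between Lebesgue integrals over the line, to which Fubini applies, and gauge
  integrals over compact intervals, which contour integration and the fundamental theorem of
  calculus deliver.\<close>

lemma integral_lborel_limit_symmetric:
  fixes f :: "real \<Rightarrow> 'a::euclidean_space"
  assumes f: "integrable lborel f"
  shows "(\<lambda>n::nat. integral {-real n..real n} f) \<longlonglongrightarrow> (LBINT x. f x)"
proof -
  have "(\<lambda>n::nat. LBINT x. indicator {-real n..real n} x *\<^sub>R f x) \<longlonglongrightarrow> (LBINT x. f x)"
  proof (rule integral_dominated_convergence[where w = "\<lambda>x. norm (f x)"])
    show "AE x in lborel. (\<lambda>n. indicator {-real n..real n} x *\<^sub>R f x) \<longlonglongrightarrow> f x"
    proof (rule AE_I2, rule tendsto_eventually)
      fix x :: real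
      obtain N :: nat where N: "\<bar>x\<bar> \<le> real N" using real_arch_simple by blast
      show "\<forall>\<^sub>F n in sequentially. indicator {-real n..real n} x *\<^sub>R f x = f x"
        using N by (intro eventually_sequentiallyI[of N]) (auto simp: indicator_def)
    qed
  qed (use f in \<open>auto simp: indicator_def\<close>)
  moreover have "(LBINT x. indicator {-real n..real n} x *\<^sub>R f x) = integral {-real n..real n} f" for n :: nat
  proof -
    have "set_integrable lborel {-real n..real n} f"
      unfolding set_integrable_def using f by (intro integrable_mult_indicator) auto
    from set_borel_integral_eq_integral(2)[OF this] show ?thesis
      by (simp add: set_lebesgue_integral_def)
  qed
  ultimately show ?thesis by simp
qed

text \<open>Contours are closed by triangles instead of arcs. On the slanted sides |Re z| + |Im z|
  equals r, hence one of the two is at least r / 2.\<close>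

lemma closed_segment_to_imaginary:
  assumes z: "z \<in> closed_segment (complex_of_real s) (\<i> * complex_of_real r)" and s: "\<bar>s\<bar> = r" and r: "r \<ge> 0"
  shows "r / 2 \<le> norm z" "0 \<le> Im z"
proof -
  from z obtain u where u: "0 \<le> u" "u \<le> 1"
    and zu: "z = (1 - u) *\<^sub>R complex_of_real s + u *\<^sub>R (\<i> * complex_of_real r)"
    unfolding in_segment by blast
  have re: "Re z = (1-u) * s" and im: "Im z = u * r" by (simp_all add: zu)
  then show "Im z \<ge> 0" using u r by simp
  have "r = \<bar>Re z\<bar> + \<bar>Im z\<bar>" using s u r unfolding re im abs_mult by (simp add: algebra_simps)
  then show "r / 2 \<le> norm z" using abs_Re_le_cmod[of z] abs_Im_le_cmod[of z] by linarith
qed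

text \<open>Cauchy's theorem on the triangle with corners -r, r and i r: the two upper sides have
  length at most 2 r, and f is O(1/r^2) on them. The margin \<open>e\<close> below the real axis
  makes f continuous and holomorphic on the closed triangle.\<close>

lemma upper_halfplane_integral_eq_0:
  fixes f :: "complex \<Rightarrow> complex" and e K R0 :: real
  assumes e: "e > 0" and holo: "f holomorphic_on {z. Im z > -e}" and R: "R0 > 0"
    and bd: "\<And>z. Im z \<ge> 0 \<Longrightarrow> norm z \<ge> R0 \<Longrightarrow> norm (f z) \<le> K / (norm z)\<^sup>2"
  shows "integrable lborel (\<lambda>x. f (of_real x))" "(LBINT x. f (of_real x)) = 0"
proof -
  have cont: "continuous_on UNIV (\<lambda>x::real. f (of_real x))"
    by (rule continuous_on_compose2[OF holomorphic_on_imp_continuous_on[OF holo]])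
      (use e in \<open>auto intro!: continuous_intros\<close>)
  show int: "integrable lborel (\<lambda>x. f (of_real x))"
  proof (rule integrable_decay_square[OF cont R])
    show "norm (f (of_real x)) \<le> K / x\<^sup>2" if "\<bar>x\<bar> \<ge> R0" for x :: real
      using bd[of "of_real x"] that by simp
  qed
  have K0: "K \<ge> 0"
  proof -
    have "norm (f (of_real R0)) \<le> K / (norm (complex_of_real R0))\<^sup>2"
      using R by (intro bd) auto
    from order_trans[OF norm_ge_zero this] have "0 \<le> K / (norm (complex_of_real R0))\<^sup>2" .
    then show ?thesis using R by (simp add: zero_le_divide_iff)
  qed
  \<comment> \<open>The slanted sides keep distance at least r / 2 from 0, so r \<ge> 2
    \<open>R0\<close> puts them where the decay bound applies.\<close>
  have bound: "norm (integral {-r..r} (\<lambda>x. f (of_real x))) \<le> 16 * K / r" if r: "r \<ge> 2 * R0" for r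
  proof -
    have r0: "r > 0" using r R by linarith
    let ?a = "complex_of_real (-r)" and ?b = "complex_of_real r" and ?c = "\<i> * complex_of_real r"
    have conv: "convex {z. Im z > -e}" by (simp add: convex_halfspace_Im_gt)
    have hull: "convex hull {?a, ?b, ?c} \<subseteq> {z. Im z > -e}"
    proof (rule hull_minimal[where S = convex])
      show "{?a, ?b, ?c} \<subseteq> {z. Im z > -e}" using e r0 by simp
    qed (rule conv)
    have "(f has_contour_integral 0) (linepath ?a ?b +++ linepath ?b ?c +++ linepath ?c ?a)"
      by (rule Cauchy_theorem_triangle) (use holo hull holomorphic_on_subset in blast)
    then have sum: "contour_integral (linepath ?a ?b) f + contour_integral (linepath ?b ?c) f
        + contour_integral (linepath ?c ?a) f = 0"
      using has_chain_integral_chain_integral3 by blast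
    have cf: "continuous_on (closed_segment u v) f" if "u \<in> {?a,?b,?c}" "v \<in> {?a,?b,?c}" for u v
    proof -
      have "closed_segment u v \<subseteq> convex hull {?a, ?b, ?c}"
        by (rule closed_segment_subset_convex_hull[OF hull_inc[OF that(1)] hull_inc[OF that(2)]])
      with hull have "closed_segment u v \<subseteq> {z. Im z > -e}" by blast
      then show ?thesis using holomorphic_on_imp_continuous_on[OF holomorphic_on_subset[OF holo]] by simp
    qed
    have low: "norm z \<ge> r / 2" "Im z \<ge> 0" if "z \<in> closed_segment (of_real s) ?c" "\<bar>s\<bar> = r" for z s
      using closed_segment_to_imaginary[OF that(1) that(2) order_less_imp_le[OF r0]] by blast+
    have fb: "norm (f z) \<le> 4 * K / r\<^sup>2" if "z \<in> closed_segment (of_real s) ?c" "\<bar>s\<bar> = r" for z s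
    proof -
      have "norm (f z) \<le> K / (norm z)\<^sup>2" using low[OF that] r by (intro bd) auto
      also have "\<dots> \<le> K / (r/2)\<^sup>2"
      proof (rule divide_left_mono)
        show "(r/2)\<^sup>2 \<le> (norm z)\<^sup>2" using low(1)[OF that] r0 by (intro power_mono) simp_all
        then have "(norm z)\<^sup>2 > 0" using r0 by (smt (verit) zero_less_power half_gt_zero)
        then show "0 < (norm z)\<^sup>2 * (r/2)\<^sup>2" using r0 by simp
      qed (rule K0)
      also have "K / (r/2)\<^sup>2 = 4 * K / r\<^sup>2" by (simp add: power_divide)
      finally show ?thesis .
    qed
    have len: "norm (?c - of_real s) \<le> 2 * r" "norm (of_real s - ?c) \<le> 2 * r" if "\<bar>s\<bar> = r" for s
    proof -
      have "norm ?c = r" "norm (complex_of_real s) = r" using that r0 by (simp_all add: norm_mult)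
      then show "norm (?c - of_real s) \<le> 2 * r" "norm (of_real s - ?c) \<le> 2 * r"
        using norm_triangle_ineq4[of ?c "of_real s"] norm_triangle_ineq4[of "of_real s" ?c] by linarith+
    qed
    have "norm (contour_integral (linepath ?b ?c) f) \<le> 4 * K / r\<^sup>2 * norm (?c - ?b)"
    proof (rule contour_integral_bound_linepath)
      show "f contour_integrable_on linepath ?b ?c" by (intro contour_integrable_continuous_linepath cf) auto
      show "norm (f z) \<le> 4 * K / r\<^sup>2" if "z \<in> closed_segment ?b ?c" for z using fb[OF that] r0 by simp
    qed (use K0 in simp)
    also have "\<dots> \<le> 4 * K / r\<^sup>2 * (2 * r)" using len(1)[of r] r0 K0 by (intro mult_left_mono) auto
    finally have 1: "norm (contour_integral (linepath ?b ?c) f) \<le> 4 * K / r\<^sup>2 * (2 * r)" .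
    have "norm (contour_integral (linepath ?c ?a) f) \<le> 4 * K / r\<^sup>2 * norm (?a - ?c)"
    proof (rule contour_integral_bound_linepath)
      show "f contour_integrable_on linepath ?c ?a" by (intro contour_integrable_continuous_linepath cf) auto
      show "norm (f z) \<le> 4 * K / r\<^sup>2" if "z \<in> closed_segment ?c ?a" for z
        using fb[of z "-r"] that r0 by (simp add: closed_segment_commute)
    qed (use K0 in simp)
    also have "\<dots> \<le> 4 * K / r\<^sup>2 * (2 * r)" using len(2)[of "-r"] r0 K0 by (intro mult_left_mono) auto
    finally have 2: "norm (contour_integral (linepath ?c ?a) f) \<le> 4 * K / r\<^sup>2 * (2 * r)" .
    have "integral {-r..r} (\<lambda>x. f (of_real x)) = contour_integral (linepath ?a ?b) f"
      using contour_integral_linepath_Reals_eq[of ?a ?b f] r0 by simp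
    also have "\<dots> = - contour_integral (linepath ?b ?c) f - contour_integral (linepath ?c ?a) f"
      using sum by (simp add: algebra_simps eq_neg_iff_add_eq_0)
    finally have "norm (integral {-r..r} (\<lambda>x. f (of_real x))) \<le> 4 * K / r\<^sup>2 * (2 * r) + 4 * K / r\<^sup>2 * (2 * r)"
      using 1 2 norm_triangle_ineq4[of "- contour_integral (linepath ?b ?c) f" "contour_integral (linepath ?c ?a) f"]
      by simp
    then show ?thesis using r0 by (simp add: power2_eq_square)
  qed
  have "(\<lambda>n::nat. integral {-real n..real n} (\<lambda>x. f (of_real x))) \<longlonglongrightarrow> 0"
  proof (rule Lim_null_comparison)
    obtain N :: nat where N: "2 * R0 \<le> real N" using real_arch_simple by blast
    show "\<forall>\<^sub>F n in sequentially. norm (integral {-real n..real n} (\<lambda>x. f (of_real x))) \<le> 16 * K / real n"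
      using N by (intro eventually_sequentiallyI[of N] bound) auto
    show "(\<lambda>n. 16 * K / real n) \<longlonglongrightarrow> 0" by (rule lim_const_over_n)
  qed
  then show "(LBINT x. f (of_real x)) = 0"
    using LIMSEQ_unique integral_lborel_limit_symmetric[OF int] by blast
qed

section \<open>Cauchy's formula and its derivatives on the real line\<close>

lemma integral_inverse_1_plus_square_lborel: "(LBINT x::real. 1 / (1 + x\<^sup>2)) = pi"
proof -
  have "einterval (-\<infinity>) \<infinity> = UNIV" by (auto simp: einterval_def)
  with LBINT_inverse_1_plus_square show ?thesis
    by (simp add: interval_lebesgue_integral_def set_lebesgue_integral_def inverse_eq_divide)
qed

lemma norm_diff_ge_half:
  fixes z w :: complex
  assumes "norm z \<ge> 2 * norm w" 
  shows "norm (z - w) \<ge> norm z / 2"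
  using norm_triangle_ineq2[of z w] assms by linarith

text \<open>A single Cauchy kernel is not absolutely integrable. Subtracting the kernel at the
  conjugate point leaves 2 i Im \<zeta> / |x - \<zeta>|^2, an affine image of the density 1 / (1 +
  x^2), and adds no pole in the upper half-plane.\<close>

lemma cauchy_kernel_difference:
  assumes "Im \<zeta> > 0"
  shows "integrable lborel (\<lambda>x. 1 / (complex_of_real x - \<zeta>) - 1 / (complex_of_real x - cnj \<zeta>))" (is ?A)
    and "(LBINT x. 1 / (complex_of_real x - \<zeta>) - 1 / (complex_of_real x - cnj \<zeta>)) = 2 * pi * \<i>" (is ?B)
proof -
  define b where "b = Im \<zeta>"
  have b: "b > 0" "b \<noteq> 0" using assms by (simp_all add: b_def)
  let ?k = "\<lambda>x. 1 / (complex_of_real x - \<zeta>) - 1 / (complex_of_real x - cnj \<zeta>)"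
  have eq: "?k (Re \<zeta> + b * x) = (2 * \<i> / b) * of_real (1 / (1 + x\<^sup>2))" for x
  proof -
    have 1: "complex_of_real (Re \<zeta> + b * x) - \<zeta> = b * (x - \<i>)"
      and 2: "complex_of_real (Re \<zeta> + b * x) - cnj \<zeta> = b * (x + \<i>)"
      by (simp_all add: b_def complex_eq_iff algebra_simps)
    have ne: "complex_of_real x - \<i> \<noteq> 0" "complex_of_real x + \<i> \<noteq> 0"
      by (simp_all add: complex_eq_iff)
    have p: "(complex_of_real x - \<i>) * (complex_of_real x + \<i>) = 1 + (of_real x)\<^sup>2"
      by (simp add: algebra_simps power2_eq_square)
    have "?k (Re \<zeta> + b * x) = (1 / b) * (1 / (x - \<i>) - 1 / (x + \<i>))"
      unfolding 1 2 using ne b by (simp add: diff_divide_distrib right_diff_distrib)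
    also have "1 / (x - \<i>) - 1 / (x + \<i>) = 2 * \<i> / ((complex_of_real x - \<i>) * (complex_of_real x + \<i>))"
      using ne by (simp add: field_simps)
    finally show ?thesis unfolding p by simp
  qed
  have int: "integrable lborel (\<lambda>x. (2 * \<i> / b) * complex_of_real (1 / (1 + x\<^sup>2)))"
    by (intro integrable_mult_right integrable_of_real integrable_inverse_1_plus_square_lborel)
  show ?A
    using int unfolding eq[symmetric] lborel_integrable_real_affine_iff[OF b(2), of ?k "Re \<zeta>"] .
  have "(LBINT x. ?k x) = \<bar>b\<bar> *\<^sub>R (LBINT x. ?k (Re \<zeta> + b * x))"
    by (rule lborel_integral_real_affine[OF b(2)])
  also have "\<dots> = \<bar>b\<bar> *\<^sub>R ((2 * \<i> / b) * of_real (LBINT x. (1 / (1 + x\<^sup>2))))"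
    unfolding eq integral_mult_right_zero integral_complex_of_real ..
  also have "\<dots> = 2 * pi * \<i>"
    unfolding integral_inverse_1_plus_square_lborel using b by (simp add: scaleR_conv_of_real)
  finally show ?B .
qed

text \<open>The quotient has no singularity in the closed upper half-plane; as f is merely bounded,
  the power m \<ge> 2 must supply the quadratic decay.\<close>

lemma upper_halfplane_integral_pole_below:
  assumes e: "e > 0" and holo: "f holomorphic_on {z. Im z > -e}"
    and bd: "\<And>z. Im z \<ge> 0 \<Longrightarrow> norm (f z) \<le> K" and w: "Im w < 0" and m: "m \<ge> 2"
  shows "integrable lborel (\<lambda>x. f (of_real x) / (of_real x - w) ^ m)"
    and "(LBINT x. f (of_real x) / (of_real x - w) ^ m) = 0"
proof -
  let ?g = "\<lambda>z. f z / (z - w) ^ m"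
  define R where "R = 2 * norm w + 2"
  have R: "R > 0" by (simp add: R_def add_nonneg_pos)
  have K: "K \<ge> 0" using bd[of 0] norm_ge_zero[of "f 0"] by (simp add: order_trans[OF norm_ge_zero])
  have holo': "?g holomorphic_on {z. Im z > - min e (- Im w)}"
    by (intro holomorphic_intros holomorphic_on_subset[OF holo]) (use w in auto)
  have bd': "norm (?g z) \<le> (K * 4) / (norm z)\<^sup>2" if "Im z \<ge> 0" "norm z \<ge> R" for z
  proof -
    have z: "norm z \<ge> 2 * norm w" "norm z / 2 \<ge> 1" "norm z > 0"
      using that(2) norm_ge_zero[of w] unfolding R_def by linarith+
    have zw: "norm z / 2 \<le> norm (z - w)" by (rule norm_diff_ge_half[OF z(1)])
    have "(norm z / 2)\<^sup>2 \<le> (norm z / 2) ^ m" using z m by (intro power_increasing) auto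
    also have "\<dots> \<le> norm (z - w) ^ m" using zw by (intro power_mono) auto
    finally have p: "(norm z / 2)\<^sup>2 \<le> norm (z - w) ^ m" .
    have "norm (?g z) = norm (f z) / norm (z - w) ^ m" by (simp add: norm_divide norm_power)
    also have "\<dots> \<le> K / (norm z / 2)\<^sup>2"
      using bd[OF that(1)] p K z(3) by (intro frac_le) auto
    also have "\<dots> = (K * 4) / (norm z)\<^sup>2" by (simp add: power_divide)
    finally show ?thesis .
  qed
  have e': "min e (- Im w) > 0" using e w by simp
  show "integrable lborel (\<lambda>x. f (of_real x) / (of_real x - w) ^ m)"
    using upper_halfplane_integral_eq_0(1)[OF e' holo' R bd'] by simp
  show "(LBINT x. f (of_real x) / (of_real x - w) ^ m) = 0"
    using upper_halfplane_integral_eq_0(2)[OF e' holo' R bd'] by simp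
qed

text \<open>Conjugation moves the pole to the lower half-plane, where the previous lemma applies
  with the constant function 1.\<close>

lemma integral_inverse_power_line:
  assumes w: "Im w > 0" and m: "m \<ge> 2"
  shows "integrable lborel (\<lambda>x. 1 / (complex_of_real x - w) ^ m)"
    and "(LBINT x. 1 / (complex_of_real x - w) ^ m) = 0"
proof -
  have *: "Im (cnj w) < 0" using w by simp
  have a: "(\<lambda>_. 1) holomorphic_on {z. - 1 < Im z}" by simp
  note L = upper_halfplane_integral_pole_below[of 1 "\<lambda>_. 1" 1, OF _ a _ * m]
  have eq: "(\<lambda>x. 1 / (complex_of_real x - w) ^ m) = (\<lambda>x. cnj (1 / (complex_of_real x - cnj w) ^ m))" by simp
  show "integrable lborel (\<lambda>x. 1 / (complex_of_real x - w) ^ m)"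
    unfolding eq complex_integrable_cnj using L(1) by simp
  show "(LBINT x. 1 / (complex_of_real x - w) ^ m) = 0"
    unfolding eq Bochner_Integration.integral_cnj using L(2) by simp
qed

text \<open>The value at \<open>a\<close> is the continuous extension, so the quotient stays
  holomorphic across \<open>a\<close>. Splitting off f a in this way replaces residue computations:
  each use lowers the order of the pole by one.\<close>

definition diff_quotient :: "(complex \<Rightarrow> complex) \<Rightarrow> complex \<Rightarrow> complex \<Rightarrow> complex" where
  "diff_quotient f a z = (if z = a then deriv f a else (f z - f a) / (z - a))"

lemma diff_quotient_holomorphic:
  "f holomorphic_on S \<Longrightarrow> open S \<Longrightarrow> diff_quotient f a holomorphic_on S"
  using pole_lemma_open[of f S a] unfolding diff_quotient_def .

lemma diff_quotient_eq: "f z = f a + (z - a) * diff_quotient f a z"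
  by (simp add: diff_quotient_def)

lemma open_halfplane: "open {z. Im z > (c::real)}"
  by (rule open_halfspace_Im_gt)

text \<open>With decay only O(1/|z|) neither half of the usual splitting of f / (z - \<zeta>) is
  integrable by itself. Adding f \<zeta> / (z - cnj \<zeta>) to one half and subtracting it from the
  other repairs both: one becomes holomorphic above with quadratic decay, the other is the kernel
  difference.\<close>

lemma upper_halfplane_cauchy_formula:
  assumes e: "e > 0" and holo: "f holomorphic_on {z. Im z > -e}" and R: "R0 > 0"
    and bd: "\<And>z. Im z \<ge> 0 \<Longrightarrow> norm z \<ge> R0 \<Longrightarrow> norm (f z) \<le> K / norm z" and \<zeta>: "Im \<zeta> > 0"
  shows "integrable lborel (\<lambda>x. f (of_real x) / (of_real x - \<zeta>))"
    and "(LBINT x. f (of_real x) / (of_real x - \<zeta>)) = 2 * pi * \<i> * f \<zeta>"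
proof -
  define g where "g z = diff_quotient f \<zeta> z + f \<zeta> / (z - cnj \<zeta>)" for z
  define R where "R = max R0 (2 * norm \<zeta> + 2)"
  have R': "R > 0" using R by (simp add: R_def)
  have e': "min e (Im \<zeta>) > 0" using e \<zeta> by simp
  have holo': "g holomorphic_on {z. Im z > - min e (Im \<zeta>)}"
    unfolding g_def
  proof (intro holomorphic_intros)
    show "diff_quotient f \<zeta> holomorphic_on {z. - min e (Im \<zeta>) < Im z}"
      by (rule holomorphic_on_subset[OF diff_quotient_holomorphic[OF holo open_halfplane]]) auto
  qed auto
  have bd': "norm (g z) \<le> (2 * K + norm (f \<zeta>) * norm (\<zeta> - cnj \<zeta>) * 4) / (norm z)\<^sup>2"
    if "Im z \<ge> 0" "norm z \<ge> R" for z
  proof -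
    have z: "norm z \<ge> R0" "norm z \<ge> 2 * norm \<zeta>" "norm z > 0" using that(2) R' by (auto simp: R_def)
    have z2: "norm z \<ge> 2 * norm (cnj \<zeta>)" using z by simp
    have n1: "norm z / 2 \<le> norm (z - \<zeta>)" by (rule norm_diff_ge_half[OF z(2)])
    have n2: "norm z / 2 \<le> norm (z - cnj \<zeta>)" by (rule norm_diff_ge_half[OF z2])
    have ne: "z - \<zeta> \<noteq> 0" "z - cnj \<zeta> \<noteq> 0" using n1 n2 z(3) by (metis half_gt_zero norm_zero not_le)+
    have K: "0 \<le> K / norm z" using bd[OF that(1) z(1)] order_trans[OF norm_ge_zero] by blast
    have geq: "g z = f z / (z - \<zeta>) - f \<zeta> * (\<zeta> - cnj \<zeta>) / ((z - \<zeta>) * (z - cnj \<zeta>))"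
    proof -
      have *: "(F - c) / p + c / q = F / p - c * (q - p) / (p * q)" if "p \<noteq> 0" "q \<noteq> 0" for F c p q :: complex
        using that by (simp add: field_simps)
      have "\<zeta> - cnj \<zeta> = (z - cnj \<zeta>) - (z - \<zeta>)" by simp
      then show ?thesis using *[OF ne, of "f z" "f \<zeta>"] ne(1) unfolding g_def diff_quotient_def by simp
    qed
    have "norm (f z / (z - \<zeta>)) \<le> (K / norm z) / (norm z / 2)"
      unfolding norm_divide using bd[OF that(1) z(1)] n1 z(3) K by (intro frac_le) auto
    also have "\<dots> = 2 * K / (norm z)\<^sup>2" by (simp add: power2_eq_square)
    finally have t1: "norm (f z / (z - \<zeta>)) \<le> 2 * K / (norm z)\<^sup>2" .
    have "(norm z / 2) * (norm z / 2) \<le> norm (z - \<zeta>) * norm (z - cnj \<zeta>)"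
      using n1 n2 z(3) by (intro mult_mono) auto
    then have "norm (f \<zeta> * (\<zeta> - cnj \<zeta>) / ((z - \<zeta>) * (z - cnj \<zeta>)))
        \<le> norm (f \<zeta> * (\<zeta> - cnj \<zeta>)) / ((norm z / 2) * (norm z / 2))"
      unfolding norm_divide norm_mult[of "z - \<zeta>"] using z(3) by (intro frac_le) auto
    also have "\<dots> = norm (f \<zeta>) * norm (\<zeta> - cnj \<zeta>) * 4 / (norm z)\<^sup>2"
      by (simp add: power2_eq_square norm_mult)
    finally have t2: "norm (f \<zeta> * (\<zeta> - cnj \<zeta>) / ((z - \<zeta>) * (z - cnj \<zeta>))) 
        \<le> norm (f \<zeta>) * norm (\<zeta> - cnj \<zeta>) * 4 / (norm z)\<^sup>2" .
    show ?thesis unfolding geq add_divide_distrib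
      using norm_triangle_ineq4 t1 t2 by (rule order_trans[OF _ add_mono])
  qed
  have g0: "integrable lborel (\<lambda>x. g (of_real x))" "(LBINT x. g (of_real x)) = 0"
    by (rule upper_halfplane_integral_eq_0(1)[OF e' holo' R'], erule (1) bd')
      (rule upper_halfplane_integral_eq_0(2)[OF e' holo' R'], erule (1) bd')
  let ?k = "\<lambda>x. 1 / (complex_of_real x - \<zeta>) - 1 / (complex_of_real x - cnj \<zeta>)"
  have feq: "f (of_real x) / (of_real x - \<zeta>) = g (of_real x) + f \<zeta> * ?k x" for x :: real
  proof -
    have "of_real x - \<zeta> \<noteq> 0" using \<zeta> by (auto simp: complex_eq_iff)
    moreover then have "of_real x \<noteq> \<zeta>" by auto
    ultimately show ?thesis
      unfolding g_def diff_quotient_def by (simp add: diff_divide_distrib right_diff_distrib)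
  qed
  note k = cauchy_kernel_difference[OF \<zeta>]
  show "integrable lborel (\<lambda>x. f (of_real x) / (of_real x - \<zeta>))"
    unfolding feq by (intro Bochner_Integration.integrable_add g0(1) integrable_mult_right k(1))
  have "(LBINT x. f (of_real x) / (of_real x - \<zeta>)) = (LBINT x. g (of_real x)) + (LBINT x. f \<zeta> * ?k x)"
    unfolding feq by (intro Bochner_Integration.integral_add g0(1) integrable_mult_right k(1))
  also have "\<dots> = 2 * pi * \<i> * f \<zeta>" unfolding g0(2) integral_mult_right_zero k(2) by simp
  finally show "(LBINT x. f (of_real x) / (of_real x - \<zeta>)) = 2 * pi * \<i> * f \<zeta>" .
qed

lemma diff_quotient_decay:
  assumes bd: "\<And>z. Im z \<ge> 0 \<Longrightarrow> norm (f z) \<le> K" and \<zeta>: "Im \<zeta> > 0"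
    and z: "Im z \<ge> 0" "norm z \<ge> 2 * norm \<zeta> + 2"
  shows "norm (diff_quotient f \<zeta> z) \<le> 4 * K / norm z"
proof -
  have K: "K \<ge> 0" using bd[of 0] order_trans[OF norm_ge_zero] by auto
  have z': "norm z \<ge> 2 * norm \<zeta>" "norm z > 0" using z(2) norm_ge_zero[of \<zeta>] by linarith+
  have n1: "norm z / 2 \<le> norm (z - \<zeta>)" by (rule norm_diff_ge_half[OF z'(1)])
  have ne: "z \<noteq> \<zeta>" using n1 z'(2) by auto
  have "norm (f z - f \<zeta>) \<le> 2 * K"
    using norm_triangle_ineq4[of "f z" "f \<zeta>"] bd[OF z(1)] bd[of \<zeta>] \<zeta> by simp
  then have "norm ((f z - f \<zeta>) / (z - \<zeta>)) \<le> (2 * K) / (norm z / 2)"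
    unfolding norm_divide using n1 z'(2) K by (intro frac_le) auto
  then show ?thesis using ne by (simp add: diff_quotient_def)
qed

text \<open>For bounded f the difference quotient decays like 1/|z| and takes the value f'(\<zeta>)
  at \<zeta>, so the previous formula applies to it; the remaining term f \<zeta> / (x - \<zeta>)^2
  integrates to 0.\<close>

lemma upper_halfplane_cauchy_formula_deriv:
  assumes e: "e > 0" and holo: "f holomorphic_on {z. Im z > -e}"
    and bd: "\<And>z. Im z \<ge> 0 \<Longrightarrow> norm (f z) \<le> K" and \<zeta>: "Im \<zeta> > 0"
  shows "integrable lborel (\<lambda>x. f (of_real x) / (of_real x - \<zeta>)\<^sup>2)"
    and "(LBINT x. f (of_real x) / (of_real x - \<zeta>)\<^sup>2) = 2 * pi * \<i> * deriv f \<zeta>"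
proof -
  have R: "2 * norm \<zeta> + 2 > 0" by (simp add: add_nonneg_pos)
  have dec: "norm (diff_quotient f \<zeta> z) \<le> 4 * K / norm z" if "Im z \<ge> 0" "norm z \<ge> 2 * norm \<zeta> + 2" for z
    using diff_quotient_decay[OF bd \<zeta> that] by simp
  have holq: "diff_quotient f \<zeta> holomorphic_on {z. Im z > -e}"
    by (rule diff_quotient_holomorphic[OF holo open_halfplane])
  have c: "integrable lborel (\<lambda>x. diff_quotient f \<zeta> (of_real x) / (of_real x - \<zeta>))"
    "(LBINT x. diff_quotient f \<zeta> (of_real x) / (of_real x - \<zeta>)) = 2 * pi * \<i> * diff_quotient f \<zeta> \<zeta>"
    by (rule upper_halfplane_cauchy_formula(1)[OF e holq R _ \<zeta>], erule (1) dec)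
      (rule upper_halfplane_cauchy_formula(2)[OF e holq R _ \<zeta>], erule (1) dec)
  have two: "(2::nat) \<le> 2" by simp
  note p = integral_inverse_power_line[OF \<zeta> two]
  have eq: "f (of_real x) / (of_real x - \<zeta>)\<^sup>2
      = diff_quotient f \<zeta> (of_real x) / (of_real x - \<zeta>) + f \<zeta> * (1 / (of_real x - \<zeta>)\<^sup>2)" for x :: real
  proof -
    have "of_real x - \<zeta> \<noteq> 0" using \<zeta> by (auto simp: complex_eq_iff)
    then show ?thesis
      by (subst diff_quotient_eq[of f "of_real x" \<zeta>]) (simp add: add_divide_distrib power2_eq_square)
  qed
  show "integrable lborel (\<lambda>x. f (of_real x) / (of_real x - \<zeta>)\<^sup>2)"
    unfolding eq by (intro Bochner_Integration.integrable_add integrable_mult_right c(1) p(1))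
  have "(LBINT x. f (of_real x) / (of_real x - \<zeta>)\<^sup>2)
      = (LBINT x. diff_quotient f \<zeta> (of_real x) / (of_real x - \<zeta>)) + (LBINT x. f \<zeta> * (1 / (of_real x - \<zeta>)\<^sup>2))"
    unfolding eq by (intro Bochner_Integration.integral_add integrable_mult_right c(1) p(1))
  also have "\<dots> = 2 * pi * \<i> * deriv f \<zeta>"
    unfolding c(2) integral_mult_right_zero p(2) by (simp add: diff_quotient_def)
  finally show "(LBINT x. f (of_real x) / (of_real x - \<zeta>)\<^sup>2) = 2 * pi * \<i> * deriv f \<zeta>" .
qed

text \<open>The same reduction once more. Now the difference quotient need only be bounded, and its
  derivative at \<zeta> is half of the second derivative of f.\<close>

lemma upper_halfplane_cauchy_formula_deriv2:
  assumes e: "e > 0" and holo: "f holomorphic_on {z. Im z > -e}"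
    and bd: "\<And>z. Im z \<ge> 0 \<Longrightarrow> norm (f z) \<le> K" and \<zeta>: "Im \<zeta> > 0"
  shows "integrable lborel (\<lambda>x. f (of_real x) / (of_real x - \<zeta>) ^ 3)"
    and "(LBINT x. f (of_real x) / (of_real x - \<zeta>) ^ 3) = pi * \<i> * deriv (deriv f) \<zeta>"
proof -
  let ?S = "{z. Im z > -e}"
  let ?q = "diff_quotient f \<zeta>"
  define R where "R = 2 * norm \<zeta> + 2"
  have R: "R \<ge> 2" by (simp add: R_def)
  have holq: "?q holomorphic_on ?S" by (rule diff_quotient_holomorphic[OF holo open_halfplane])
  have K: "K \<ge> 0" using bd[of 0] order_trans[OF norm_ge_zero] by auto
  \<comment> \<open>The decay estimate for the quotient holds only away from \<zeta>; on the
    remaining half disc compactness bounds it.\<close>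
  have "compact ({z. Im z \<ge> 0} \<inter> cball 0 R)"
    by (intro closed_Int_compact closed_halfspace_Im_ge compact_cball)
  moreover have "continuous_on ({z. Im z \<ge> 0} \<inter> cball 0 R) ?q"
    by (rule continuous_on_subset[OF holomorphic_on_imp_continuous_on[OF holq]]) (use e in auto)
  ultimately have "bounded (?q ` ({z. Im z \<ge> 0} \<inter> cball 0 R))"
    by (intro compact_imp_bounded compact_continuous_image)
  then obtain L where L0: "\<forall>x\<in>?q ` ({z. Im z \<ge> 0} \<inter> cball 0 R). norm x \<le> L"
    unfolding bounded_iff by blast
  have L: "norm (?q z) \<le> L" if "Im z \<ge> 0" "norm z \<le> R" for z
    using L0 that by (simp add: dist_norm)
  have bdq: "norm (?q z) \<le> max L (4 * K)" if "Im z \<ge> 0" for z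
  proof (cases "norm z \<le> R")
    case True
    then show ?thesis using L[OF that True] by simp
  next
    case False
    then have "norm (?q z) \<le> 4 * K / norm z" by (intro diff_quotient_decay[OF bd \<zeta> that]) (auto simp: R_def)
    also have "\<dots> \<le> 4 * K / 1" using False R K by (intro divide_left_mono) auto
    finally show ?thesis by simp
  qed
  have c: "integrable lborel (\<lambda>x. ?q (of_real x) / (of_real x - \<zeta>)\<^sup>2)"
    "(LBINT x. ?q (of_real x) / (of_real x - \<zeta>)\<^sup>2) = 2 * pi * \<i> * deriv ?q \<zeta>"
    by (rule upper_halfplane_cauchy_formula_deriv(1)[OF e holq _ \<zeta>], erule bdq)
      (rule upper_halfplane_cauchy_formula_deriv(2)[OF e holq _ \<zeta>], erule bdq)
  have three: "(2::nat) \<le> 3" by simp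
  note p = integral_inverse_power_line[OF \<zeta> three]
  have eq: "f (of_real x) / (of_real x - \<zeta>) ^ 3
      = ?q (of_real x) / (of_real x - \<zeta>)\<^sup>2 + f \<zeta> * (1 / (of_real x - \<zeta>) ^ 3)" for x :: real
  proof -
    have "of_real x - \<zeta> \<noteq> 0" using \<zeta> by (auto simp: complex_eq_iff)
    then show ?thesis
      by (subst diff_quotient_eq[of f "of_real x" \<zeta>]) (simp add: add_divide_distrib power2_eq_square power3_eq_cube)
  qed
  \<comment> \<open>Obtained by differentiating f = f \<zeta> + (z - \<zeta>) q twice at \<zeta>;
    the factor 2 turns 2 pi i into pi i.\<close>
  have "deriv (deriv f) \<zeta> = 2 * deriv ?q \<zeta>"
  proof -
    have S: "\<zeta> \<in> ?S" using \<zeta> e by simp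
    have d: "deriv f z = ?q z + (z - \<zeta>) * deriv ?q z" if "z \<in> ?S" for z
    proof -
      have D: "(?q has_field_derivative deriv ?q z) (at z)"
        by (rule holomorphic_derivI[OF holq open_halfplane that])
      have "((\<lambda>z. f \<zeta> + (z - \<zeta>) * ?q z) has_field_derivative ?q z + (z - \<zeta>) * deriv ?q z) (at z)"
        by (rule derivative_eq_intros D refl | simp)+
      then have "(f has_field_derivative ?q z + (z - \<zeta>) * deriv ?q z) (at z)"
        unfolding diff_quotient_eq[symmetric] .
      then show ?thesis by (rule DERIV_imp_deriv)
    qed
    have D1: "(?q has_field_derivative deriv ?q \<zeta>) (at \<zeta>)"
      by (rule holomorphic_derivI[OF holq open_halfplane S])
    have D2: "(deriv ?q has_field_derivative deriv (deriv ?q) \<zeta>) (at \<zeta>)"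
      by (rule holomorphic_derivI[OF holomorphic_deriv[OF holq open_halfplane] open_halfplane S])
    have "((\<lambda>z. ?q z + (z - \<zeta>) * deriv ?q z) has_field_derivative 2 * deriv ?q \<zeta>) (at \<zeta>)"
      by (rule derivative_eq_intros D1 D2 refl | simp)+
    then have "(deriv f has_field_derivative 2 * deriv ?q \<zeta>) (at \<zeta>)"
      by (rule has_field_derivative_transform_within_open[OF _ open_halfplane S]) (simp add: d)
    then show ?thesis by (rule DERIV_imp_deriv)
  qed
  then have dd: "2 * pi * \<i> * deriv ?q \<zeta> = pi * \<i> * deriv (deriv f) \<zeta>" by simp
  show "integrable lborel (\<lambda>x. f (of_real x) / (of_real x - \<zeta>) ^ 3)"
    unfolding eq by (intro Bochner_Integration.integrable_add integrable_mult_right c(1) p(1))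
  have "(LBINT x. f (of_real x) / (of_real x - \<zeta>) ^ 3)
      = (LBINT x. ?q (of_real x) / (of_real x - \<zeta>)\<^sup>2) + (LBINT x. f \<zeta> * (1 / (of_real x - \<zeta>) ^ 3))"
    unfolding eq by (intro Bochner_Integration.integral_add integrable_mult_right c(1) p(1))
  also have "\<dots> = pi * \<i> * deriv (deriv f) \<zeta>"
    unfolding c(2) integral_mult_right_zero p(2) dd by simp
  finally show "(LBINT x. f (of_real x) / (of_real x - \<zeta>) ^ 3) = pi * \<i> * deriv (deriv f) \<zeta>" .
qed

section \<open>The regularizing kernel and inverse Laplace transforms\<close>

text \<open>Its only pole is the double one at -i / \<epsilon>, in the lower half-plane. The simple
  zero at 0 compensates the growth 1/|y| of logarithmic derivatives there, and for \<epsilon>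
  tending to 0 the kernel tends to y, so that \<open>kern'\<close> tends to 1.\<close>

definition kern :: "real \<Rightarrow> complex \<Rightarrow> complex" where
  "kern \<epsilon> y = y / (1 - \<i> * \<epsilon> * y)\<^sup>2"

definition kern' :: "real \<Rightarrow> complex \<Rightarrow> complex" where
  "kern' \<epsilon> y = (1 + \<i> * \<epsilon> * y) / (1 - \<i> * \<epsilon> * y) ^ 3"

lemma kern_denominator:
  assumes "\<epsilon> > 0" "Im y \<ge> 0"
  shows "1 + \<epsilon>\<^sup>2 * (norm y)\<^sup>2 \<le> (norm (1 - \<i> * \<epsilon> * y))\<^sup>2" "1 - \<i> * \<epsilon> * y \<noteq> 0"
proof -
  have "(norm (1 - \<i> * \<epsilon> * y))\<^sup>2 = (1 + \<epsilon> * Im y)\<^sup>2 + (\<epsilon> * Re y)\<^sup>2"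
    unfolding cmod_power2 by simp
  also have "\<dots> = 1 + 2 * \<epsilon> * Im y + \<epsilon>\<^sup>2 * (norm y)\<^sup>2"
    unfolding cmod_power2 by (simp add: power2_eq_square algebra_simps)
  finally have "(norm (1 - \<i> * \<epsilon> * y))\<^sup>2 = 1 + 2 * \<epsilon> * Im y + \<epsilon>\<^sup>2 * (norm y)\<^sup>2" .
  then show le: "1 + \<epsilon>\<^sup>2 * (norm y)\<^sup>2 \<le> (norm (1 - \<i> * \<epsilon> * y))\<^sup>2" using assms by simp
  have "0 < 1 + \<epsilon>\<^sup>2 * (norm y)\<^sup>2" by (simp add: add_pos_nonneg)
  with le have "0 < (norm (1 - \<i> * \<epsilon> * y))\<^sup>2" by linarith
  then show "1 - \<i> * \<epsilon> * y \<noteq> 0" by auto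
qed

lemma norm_kern_le:
  assumes "\<epsilon> > 0" "Im y \<ge> 0"
  shows "norm (kern \<epsilon> y) \<le> norm y / (1 + \<epsilon>\<^sup>2 * (norm y)\<^sup>2)"
  unfolding kern_def norm_divide norm_power
proof (rule divide_left_mono[OF kern_denominator(1)[OF assms] norm_ge_zero])
  have "0 < norm (1 - \<i> * \<epsilon> * y)" using kern_denominator(2)[OF assms] by simp
  moreover have "0 < 1 + \<epsilon>\<^sup>2 * (norm y)\<^sup>2" by (simp add: add_pos_nonneg)
  ultimately show "0 < (norm (1 - \<i> * \<epsilon> * y))\<^sup>2 * (1 + \<epsilon>\<^sup>2 * (norm y)\<^sup>2)" by simp
qed

lemma norm_kern'_le:
  assumes "\<epsilon> > 0" "Im y \<ge> 0"
  shows "norm (kern' \<epsilon> y) \<le> 2 / (1 + \<epsilon>\<^sup>2 * (norm y)\<^sup>2)"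
proof -
  define q where "q = norm (1 - \<i> * \<epsilon> * y)"
  have q2: "1 + \<epsilon>\<^sup>2 * (norm y)\<^sup>2 \<le> q\<^sup>2" unfolding q_def by (rule kern_denominator(1)[OF assms])
  then have "1 \<le> q\<^sup>2" by (smt (verit) zero_le_mult_iff zero_le_power2)
  moreover have q0: "0 \<le> q" by (simp add: q_def)
  ultimately have q1: "1 \<le> q" by (metis one_power2 power2_le_imp_le)
  have "(\<epsilon> * norm y)\<^sup>2 \<le> q\<^sup>2" using q2 by (simp add: power_mult_distrib)
  then have e: "\<epsilon> * norm y \<le> q" using q0 power2_le_imp_le by blast
  have "norm (1 + \<i> * \<epsilon> * y) \<le> 1 + \<epsilon> * norm y"
    using norm_triangle_ineq[of 1 "\<i> * \<epsilon> * y"] assms(1) by (simp add: norm_mult)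
  then have n: "norm (1 + \<i> * \<epsilon> * y) \<le> 2 * q" using e q1 by linarith
  have "norm (kern' \<epsilon> y) = norm (1 + \<i> * \<epsilon> * y) / q ^ 3"
    by (simp add: kern'_def norm_divide norm_power q_def)
  also have "\<dots> \<le> 2 * q / q ^ 3" using n q1 by (intro divide_right_mono) auto
  also have "\<dots> = 2 / q\<^sup>2" using q1 by (simp add: power2_eq_square power3_eq_cube)
  also have "\<dots> \<le> 2 / (1 + \<epsilon>\<^sup>2 * (norm y)\<^sup>2)"
    using q2 q1 by (intro divide_left_mono) (auto simp: add_pos_nonneg)
  finally show ?thesis .
qed

text \<open>The reciprocal of the kernel is 1 / y - 2 i \<epsilon> - \<epsilon>^2 y, a sum of terms
  with non-positive imaginary part. The proof clears denominators with the squared conjugate of 1 -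
  i \<epsilon> y.\<close>

lemma Im_kern_nonneg:
  assumes "\<epsilon> > 0" "Im y > 0"
  shows "Im (kern \<epsilon> y) \<ge> 0"
proof -
  let ?q = "1 - \<i> * \<epsilon> * y"
  have q: "?q \<noteq> 0" using kern_denominator(2) assms by simp
  have n: "complex_of_real (((norm ?q)\<^sup>2)\<^sup>2) = (?q * cnj ?q)\<^sup>2"
    using complex_norm_square[of ?q] by (metis of_real_power)
  have "kern \<epsilon> y * of_real (((norm ?q)\<^sup>2)\<^sup>2) = (y / ?q\<^sup>2) * (?q\<^sup>2 * (cnj ?q)\<^sup>2)"
    unfolding n kern_def power_mult_distrib ..
  also have "\<dots> = y * (cnj ?q)\<^sup>2" using q by simp
  finally have eq: "kern \<epsilon> y * of_real (((norm ?q)\<^sup>2)\<^sup>2) = y * (cnj ?q)\<^sup>2" .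
  have "y * (cnj ?q)\<^sup>2 = y + 2 * \<i> * \<epsilon> * (y * cnj y) - \<epsilon>\<^sup>2 * cnj y * (y * cnj y)"
    by (simp add: power2_eq_square algebra_simps)
  also have "Im \<dots> = Im y + 2 * \<epsilon> * (norm y)\<^sup>2 + \<epsilon>\<^sup>2 * Im y * (norm y)\<^sup>2"
    unfolding complex_mult_cnj cmod_power2 by (simp add: power2_eq_square algebra_simps)
  finally have "Im (y * (cnj ?q)\<^sup>2) = Im y + 2 * \<epsilon> * (norm y)\<^sup>2 + \<epsilon>\<^sup>2 * Im y * (norm y)\<^sup>2" .
  then have "Im (y * (cnj ?q)\<^sup>2) \<ge> 0" using assms by simp
  then have "Im (kern \<epsilon> y) * ((norm ?q)\<^sup>2)\<^sup>2 \<ge> 0" unfolding eq[symmetric] by simp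
  moreover have "((norm ?q)\<^sup>2)\<^sup>2 > 0" using q by simp
  ultimately show ?thesis by (simp add: zero_le_mult_iff)
qed

lemma kern_has_field_derivative:
  assumes "1 - \<i> * \<epsilon> * y \<noteq> 0"
  shows "(kern \<epsilon> has_field_derivative kern' \<epsilon> y) (at y)"
proof -
  let ?q = "1 - \<i> * \<epsilon> * y"
  have "((\<lambda>y. y / (1 - \<i> * \<epsilon> * y)\<^sup>2) has_field_derivative
     (1 * ?q\<^sup>2 - y * (2 * ?q * (- \<i> * \<epsilon>))) / (?q\<^sup>2 * ?q\<^sup>2)) (at y)"
    using assms by (auto intro!: derivative_eq_intros simp: power2_eq_square)
  also have "(1 * ?q\<^sup>2 - y * (2 * ?q * (- \<i> * \<epsilon>))) / (?q\<^sup>2 * ?q\<^sup>2) = (?q * (?q + 2 * \<i> * \<epsilon> * y)) / (?q * ?q ^ 3)"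
    by (simp add: power2_eq_square power3_eq_cube algebra_simps)
  also have "\<dots> = (?q + 2 * \<i> * \<epsilon> * y) / ?q ^ 3" using assms by (rule nonzero_mult_divide_mult_cancel_left)
  also have "\<dots> = kern' \<epsilon> y" by (simp add: kern'_def algebra_simps)
  finally show ?thesis unfolding kern_def[abs_def] .
qed

lemma kern_reflect: "kern \<epsilon> (- of_real y) = - cnj (kern \<epsilon> (of_real y))"
  by (simp add: kern_def)

text \<open>Realness on this axis makes the factor invariant under the conjugation that treats Im
  \<zeta> < 0, and the explicit value gives the bound by 1 used when \<epsilon> tends to 0.\<close>

lemma kern'_imaginary_axis: "kern' \<epsilon> (\<i> * of_real r) = of_real ((1 - \<epsilon> * r) / (1 + \<epsilon> * r) ^ 3)"
proof -
  have "1 + \<i> * \<epsilon> * (\<i> * of_real r) = of_real (1 - \<epsilon> * r)" "1 - \<i> * \<epsilon> * (\<i> * of_real r) = of_real (1 + \<epsilon> * r)"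
    by (simp_all add: complex_eq_iff)
  then show ?thesis unfolding kern'_def by simp
qed

lemma integrable_inverse_1_plus_scaled_square:
  assumes "\<epsilon> > 0"
  shows "integrable lborel (\<lambda>y::real. 1 / (1 + \<epsilon>\<^sup>2 * y\<^sup>2))"
proof -
  have "integrable lborel (\<lambda>x::real. 1 / (1 + (0 + \<epsilon> * x)\<^sup>2))"
    using lborel_integrable_real_affine[OF integrable_inverse_1_plus_square_lborel, of \<epsilon> 0] assms by simp
  then show ?thesis by (simp add: power_mult_distrib)
qed

lemma logarithmic_derivative_prod_list:
  fixes f :: "complex \<Rightarrow> complex"
  assumes f: "\<And>y. f y = c * prod_list (map (\<lambda>r. y - r) ls)" and D: "(f has_field_derivative f') (at y)" and nz: "f y \<noteq> 0"
  shows "f' / f y = sum_list (map (\<lambda>r. 1 / (y - r)) ls)"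
proof -
  have "((\<lambda>y. c * prod_list (map (\<lambda>r. y - r) ls)) has_field_derivative
      c * prod_list (map (\<lambda>r. y - r) ls) * sum_list (map (\<lambda>r. 1 / (y - r)) ls)) (at y)"
    if "c * prod_list (map (\<lambda>r. y - r) ls) \<noteq> 0" using that
  proof (induction ls arbitrary: c)
    case Nil
    then show ?case by simp
  next
    case (Cons a ls)
    let ?P = "\<lambda>y. prod_list (map (\<lambda>r. y - r) ls)"
    have ya: "y - a \<noteq> 0" and P: "?P y \<noteq> 0" "1 * ?P y \<noteq> 0" using Cons.prems by auto
    have IH: "(?P has_field_derivative ?P y * sum_list (map (\<lambda>r. 1 / (y - r)) ls)) (at y)"
      using Cons.IH[OF P(2)] by simp
    have "((\<lambda>y. c * ((y - a) * ?P y)) has_field_derivative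
        c * (1 * ?P y + (?P y * sum_list (map (\<lambda>r. 1 / (y - r)) ls)) * (y - a))) (at y)"
      by (rule derivative_eq_intros IH refl | simp)+
    also have "c * (1 * ?P y + (?P y * sum_list (map (\<lambda>r. 1 / (y - r)) ls)) * (y - a))
       = c * ((y - a) * ?P y) * (1 / (y - a) + sum_list (map (\<lambda>r. 1 / (y - r)) ls))"
      using ya by (simp add: field_simps)
    finally show ?case by simp
  qed
  note * = this[folded f, OF nz]
  have "f' = f y * sum_list (map (\<lambda>r. 1 / (y - r)) ls)"
    by (rule DERIV_unique[OF D *])
  then show ?thesis using nz by simp
qed

lemma integrable_pair_product_bound:
  fixes f :: "real \<times> real \<Rightarrow> complex"
  assumes [measurable]: "f \<in> borel_measurable (borel \<Otimes>\<^sub>M borel)"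
    and g: "integrable lborel g" and h: "integrable lborel h"
    and bd: "\<And>x y. norm (f (x, y)) \<le> g x * h y"
  shows "integrable (lborel \<Otimes>\<^sub>M lborel) f"
proof (rule Bochner_Integration.integrable_bound)
  have [measurable]: "g \<in> borel_measurable borel" "h \<in> borel_measurable borel" using g h by auto
  show "integrable (lborel \<Otimes>\<^sub>M lborel) (\<lambda>z. g (fst z) * h (snd z))"
  proof (rule lborel_pair.Fubini_integrable)
    show "integrable lborel (\<lambda>x. LBINT y. norm (g (fst (x, y)) * h (snd (x, y))))"
    proof -
      have "(\<lambda>x. LBINT y. norm (g (fst (x, y)) * h (snd (x, y)))) = (\<lambda>x. norm (g x) * (LBINT y. norm (h y)))"
        by (simp add: abs_mult)
      then show ?thesis using g by auto
    qed
    show "AE x in lborel. integrable lborel (\<lambda>y. g (fst (x, y)) * h (snd (x, y)))"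
      using h by auto
  qed measurable
  show "AE z in lborel \<Otimes>\<^sub>M lborel. norm (f z) \<le> norm (g (fst z) * h (snd z))"
  proof (rule AE_I2)
    fix z :: "real \<times> real"
    show "norm (f z) \<le> norm (g (fst z) * h (snd z))"
      using bd[of "fst z" "snd z"] abs_ge_self[of "g (fst z) * h (snd z)"] by simp
  qed
qed measurable

section \<open>Rotation of a half-line and inverse Laplace transforms\<close>

lemma set_integral_lborel_limit_atLeast:
  fixes f :: "real \<Rightarrow> complex"
  assumes f: "set_integrable lborel {0..} f"
  shows "(\<lambda>n::nat. integral {0..real n} f) \<longlonglongrightarrow> (LINT x:{0..}|lborel. f x)"
proof -
  let ?g = "\<lambda>x. indicator {0..} x *\<^sub>R f x"
  have "(\<lambda>n::nat. integral {-real n..real n} ?g) \<longlonglongrightarrow> (LBINT x. ?g x)"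
    using f unfolding set_integrable_def by (rule integral_lborel_limit_symmetric)
  moreover have "integral {-real n..real n} ?g = integral {0..real n} f" for n :: nat
  proof -
    have "integral {-real n..real n} ?g = integral {-real n..real n} (\<lambda>x. if x \<in> {0..real n} then f x else 0)"
      by (rule integral_cong) (auto simp: indicator_def)
    also have "\<dots> = integral {0..real n} f" 
    proof -
      have "{0..real n} \<inter> {-real n..real n} = {0..real n}" by auto
      then show ?thesis using integral_restrict_Int[of "{-real n..real n}" "{0..real n}" f] by metis
    qed
    finally show ?thesis .
  qed
  ultimately show ?thesis by (simp add: set_lebesgue_integral_def)
qed

text \<open>Cauchy's theorem on the triangle 0, i r, -r inside the second quadrant. Its hypotenuse
  has length at most 2 r and stays at distance r / 2 from 0, so it contributes O(1/r). The factor -i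
  is the direction of the imaginary axis together with the orientation of the negative
  half-line.\<close>

lemma integral_quadrant_rotation:
  fixes f :: "complex \<Rightarrow> complex"
  assumes holo: "f holomorphic_on {z. Re z \<le> 0 \<and> Im z \<ge> 0}" and c: "c > 0"
    and bd: "\<And>z. Re z \<le> 0 \<Longrightarrow> Im z \<ge> 0 \<Longrightarrow> norm (f z) \<le> K / (1 + c\<^sup>2 * (norm z)\<^sup>2)"
  shows "set_integrable lborel {0..} (\<lambda>r. f (- of_real r))"
    and "set_integrable lborel {0..} (\<lambda>r. f (\<i> * of_real r))"
    and "(LINT r:{0..}|lborel. f (- of_real r)) = - \<i> * (LINT r:{0..}|lborel. f (\<i> * of_real r))"
proof -
  let ?Q = "{z. Re z \<le> 0 \<and> Im z \<ge> 0}"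
  have K: "K \<ge> 0" using bd[of 0] order_trans[OF norm_ge_zero[of "f 0"]] by simp
  have contf: "continuous_on ?Q f" by (rule holomorphic_on_imp_continuous_on[OF holo])
  have si: "set_integrable lborel {0..} (\<lambda>r. f (w * of_real r))"
    if w: "norm w = 1" "Re w \<le> 0" "Im w \<ge> 0" for w
  proof -
    have Q: "w * of_real r \<in> ?Q" if "r \<ge> 0" for r :: real
      using mult_nonpos_nonneg[OF w(2) that] mult_nonneg_nonneg[OF w(3) that] by simp
    have "continuous_on {0..} (\<lambda>r::real. f (w * of_real r))"
    proof (rule continuous_on_compose2[OF contf])
      show "(\<lambda>r::real. w * of_real r) ` {0..} \<subseteq> ?Q" using Q by blast
    qed (intro continuous_intros)
    then have m: "(\<lambda>r. indicator {0..} r *\<^sub>R f (w * of_real r)) \<in> borel_measurable borel"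
      by (intro borel_measurable_continuous_on_indicator) auto
    show ?thesis unfolding set_integrable_def
    proof (rule Bochner_Integration.integrable_bound)
      show "integrable lborel (\<lambda>y::real. K * (1 / (1 + c\<^sup>2 * y\<^sup>2)))"
        by (intro integrable_mult_right integrable_inverse_1_plus_scaled_square c)
      show "AE r in lborel. norm (indicator {0..} r *\<^sub>R f (w * of_real r)) \<le> norm (K * (1 / (1 + c\<^sup>2 * r\<^sup>2)))"
      proof (rule AE_I2)
        fix r :: real
        show "norm (indicator {0..} r *\<^sub>R f (w * of_real r)) \<le> norm (K * (1 / (1 + c\<^sup>2 * r\<^sup>2)))"
        proof (cases "r \<ge> 0")
          case True
          have "norm (f (w * of_real r)) \<le> K / (1 + c\<^sup>2 * (norm (w * of_real r))\<^sup>2)"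
            using Q[OF True] bd by blast
          also have "\<dots> = K * (1 / (1 + c\<^sup>2 * r\<^sup>2))" using w(1) by (simp add: norm_mult)
          also have "\<dots> \<le> norm (K * (1 / (1 + c\<^sup>2 * r\<^sup>2)))"
            unfolding real_norm_def by (rule abs_ge_self)
          finally show ?thesis using True by simp
        qed simp
      qed
    qed (use m in simp)
  qed
  show i1: "set_integrable lborel {0..} (\<lambda>r. f (- of_real r))" using si[of "-1"] by simp
  show i2: "set_integrable lborel {0..} (\<lambda>r. f (\<i> * of_real r))" using si[of \<i>] by simp
  have fin: "norm (integral {0..r} (\<lambda>x. f (- of_real x)) + \<i> * integral {0..r} (\<lambda>x. f (\<i> * of_real x))) \<le> 8 * K / c\<^sup>2 / r"
    if r: "r > 0" for r
  proof -
    let ?b = "\<i> * complex_of_real r" and ?a = "complex_of_real (-r)"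
    have convQ: "convex ?Q"
    proof -
      have "?Q = {z. Re z \<le> 0} \<inter> {z. Im z \<ge> 0}" by auto
      then show ?thesis by (simp add: convex_Int convex_halfspace_Re_le convex_halfspace_Im_ge)
    qed
    have hull: "convex hull {0, ?b, ?a} \<subseteq> ?Q"
    proof (rule hull_minimal[where S = convex])
      show "{0, ?b, ?a} \<subseteq> ?Q" using r by simp
    qed (rule convQ)
    have "(f has_contour_integral 0) (linepath 0 ?b +++ linepath ?b ?a +++ linepath ?a 0)"
      by (rule Cauchy_theorem_triangle) (rule holomorphic_on_subset[OF holo hull])
    then have sum: "contour_integral (linepath 0 ?b) f + contour_integral (linepath ?b ?a) f
        + contour_integral (linepath ?a 0) f = 0"
      using has_chain_integral_chain_integral3 by blast
    have cf: "continuous_on (closed_segment u w) f" if "u \<in> {0,?b,?a}" "w \<in> {0,?b,?a}" for u w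
    proof -
      have "closed_segment u w \<subseteq> convex hull {0, ?b, ?a}"
        by (rule closed_segment_subset_convex_hull[OF hull_inc[OF that(1)] hull_inc[OF that(2)]])
      with hull have "closed_segment u w \<subseteq> ?Q" by blast
      then show ?thesis using continuous_on_subset[OF contf] by simp
    qed
    have arc: "norm (contour_integral (linepath ?b ?a) f) \<le> K / (c\<^sup>2 * (r/2)\<^sup>2) * norm (?a - ?b)"
    proof (rule contour_integral_bound_linepath)
      show "f contour_integrable_on linepath ?b ?a" by (intro contour_integrable_continuous_linepath cf) auto
      show "0 \<le> K / (c\<^sup>2 * (r/2)\<^sup>2)" using K by simp
      show "norm (f z) \<le> K / (c\<^sup>2 * (r/2)\<^sup>2)" if z: "z \<in> closed_segment ?b ?a" for z
      proof -
        have z1: "z \<in> closed_segment (complex_of_real (-r)) (\<i> * complex_of_real r)" using z by (simp add: closed_segment_commute)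
        have n: "r / 2 \<le> norm z" by (rule closed_segment_to_imaginary(1)[OF z1]) (use r in auto)
        have "z \<in> convex hull {0, ?b, ?a}"
          using z closed_segment_subset_convex_hull[of ?b "{0,?b,?a}" ?a] hull_inc[of ?b "{0,?b,?a}"] hull_inc[of ?a "{0,?b,?a}"]
          by blast
        with hull have Q: "Re z \<le> 0" "Im z \<ge> 0" by blast+
        have "norm (f z) \<le> K / (1 + c\<^sup>2 * (norm z)\<^sup>2)" by (rule bd[OF Q])
        also have "\<dots> \<le> K / (c\<^sup>2 * (r/2)\<^sup>2)"
        proof (rule divide_left_mono[OF _ K])
          have "(r/2)\<^sup>2 \<le> (norm z)\<^sup>2" using n r by (intro power_mono) auto
          then have "c\<^sup>2 * (r/2)\<^sup>2 \<le> c\<^sup>2 * (norm z)\<^sup>2" by (intro mult_left_mono) auto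
          then show "c\<^sup>2 * (r/2)\<^sup>2 \<le> 1 + c\<^sup>2 * (norm z)\<^sup>2" by linarith
          have "0 < 1 + c\<^sup>2 * (norm z)\<^sup>2" by (simp add: add_pos_nonneg)
          moreover have "0 < c\<^sup>2 * (r/2)\<^sup>2" using c r by simp
          ultimately show "0 < (1 + c\<^sup>2 * (norm z)\<^sup>2) * (c\<^sup>2 * (r/2)\<^sup>2)" by (rule mult_pos_pos)
        qed
        finally show ?thesis .
      qed
    qed
    also have "\<dots> \<le> K / (c\<^sup>2 * (r/2)\<^sup>2) * (2 * r)"
    proof (rule mult_left_mono)
      have "norm ?a = r" "norm ?b = r" using r by (simp_all add: norm_mult)
      then show "norm (?a - ?b) \<le> 2 * r" using norm_triangle_ineq4[of ?a ?b] by linarith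
    qed (use K in simp)
    also have "\<dots> = 8 * K / c\<^sup>2 / r" using r by (simp add: power2_eq_square)
    finally have arc: "norm (contour_integral (linepath ?b ?a) f) \<le> 8 * K / c\<^sup>2 / r" .
    have e1: "contour_integral (linepath ?a 0) f = integral {0..r} (\<lambda>x. f (- of_real x))"
    proof -
      have "contour_integral (linepath ?a 0) f = integral {-r..0} (\<lambda>x. f (of_real x))"
        using contour_integral_linepath_Reals_eq[of ?a 0 f] r by simp
      also have "\<dots> = integral {0..r} (\<lambda>x. f (- of_real x))"
        using Henstock_Kurzweil_Integration.integral_reflect_real[of r 0 "\<lambda>x. f (- of_real x)"] by simp
      finally show ?thesis .
    qed
    have e2: "contour_integral (linepath 0 ?b) f = \<i> * integral {0..r} (\<lambda>x. f (\<i> * of_real x))"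
    proof -
      have "contour_integral (linepath 0 ?b) f = integral {0..1} (\<lambda>x. f (\<i> * of_real (r * x)) * ?b)"
        by (simp add: contour_integral_integral linepath_def mult_ac scaleR_conv_of_real)
      also have "\<dots> = \<i> * (r * integral {0..1} (\<lambda>x. f (\<i> * of_real (r * x))))" by simp
      also have "r * integral {0..1} (\<lambda>x. f (\<i> * of_real (r * x))) = integral {0..r} (\<lambda>x. f (\<i> * of_real x))"
      proof -
        have "continuous_on {0..r} (\<lambda>x. f (\<i> * complex_of_real x))"
        proof (rule continuous_on_compose2[OF contf])
          show "(\<lambda>x. \<i> * complex_of_real x) ` {0..r} \<subseteq> ?Q" by auto
        qed (intro continuous_intros)
        then have "(\<lambda>x. f (\<i> * complex_of_real x)) integrable_on {0..r}" by (rule integrable_continuous_real)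
        then have "((\<lambda>x. f (\<i> * complex_of_real x)) has_integral integral {0..r} (\<lambda>x. f (\<i> * of_real x))) {0..r}"
          by (rule integrable_integral)
        from has_integral_stretch_real[of _ _ 0 r r, OF this] r
        have "((\<lambda>x. f (\<i> * of_real (r * x))) has_integral (1 / r) *\<^sub>R integral {0..r} (\<lambda>x. f (\<i> * of_real x))) {0..1}"
          by simp
        then show ?thesis using r by (simp add: integral_unique scaleR_conv_of_real)
      qed
      finally show ?thesis .
    qed
    have "integral {0..r} (\<lambda>x. f (- of_real x)) + \<i> * integral {0..r} (\<lambda>x. f (\<i> * of_real x))
        = - contour_integral (linepath ?b ?a) f"
      using sum unfolding e1 e2 by (simp add: algebra_simps eq_neg_iff_add_eq_0)
    then show ?thesis using arc by simp
  qed
  have "(\<lambda>n::nat. integral {0..real n} (\<lambda>x. f (- of_real x)) + \<i> * integral {0..real n} (\<lambda>x. f (\<i> * of_real x))) \<longlonglongrightarrow> 0"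
  proof (rule Lim_null_comparison)
    show "\<forall>\<^sub>F n in sequentially. norm (integral {0..real n} (\<lambda>x. f (- of_real x)) + \<i> * integral {0..real n} (\<lambda>x. f (\<i> * of_real x))) \<le> 8 * K / c\<^sup>2 / real n"
      by (intro eventually_sequentiallyI[of 1] fin) auto
    show "(\<lambda>n. 8 * K / c\<^sup>2 / real n) \<longlonglongrightarrow> 0" by (rule lim_const_over_n)
  qed
  moreover have "(\<lambda>n::nat. integral {0..real n} (\<lambda>x. f (- of_real x)) + \<i> * integral {0..real n} (\<lambda>x. f (\<i> * of_real x)))
      \<longlonglongrightarrow> (LINT r:{0..}|lborel. f (- of_real r)) + \<i> * (LINT r:{0..}|lborel. f (\<i> * of_real r))"
    by (intro tendsto_intros set_integral_lborel_limit_atLeast i1 i2)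
  ultimately have "(LINT r:{0..}|lborel. f (- of_real r)) + \<i> * (LINT r:{0..}|lborel. f (\<i> * of_real r)) = 0"
    using LIMSEQ_unique by blast
  then show "(LINT r:{0..}|lborel. f (- of_real r)) = - \<i> * (LINT r:{0..}|lborel. f (\<i> * of_real r))"
    by (simp add: eq_neg_iff_add_eq_0)
qed

text \<open>Since z + i \<omega> = i (\<omega> - i z), this is Cauchy's formula for the first
  derivative of exp (i w) at w = i z. That function has modulus at most 1 on the upper half-plane,
  and Re z > 0 places the point there.\<close>

lemma inverse_laplace_square:
  fixes z :: complex
  assumes z: "Re z > 0"
  shows "integrable lborel (\<lambda>\<omega>. exp (\<i> * of_real \<omega>) / (z + \<i> * of_real \<omega>)\<^sup>2)"
    and "(LBINT \<omega>. exp (\<i> * of_real \<omega>) / (z + \<i> * of_real \<omega>)\<^sup>2) = 2 * pi * exp (- z)"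
proof -
  have k: "Im (\<i> * z) > 0" using z by simp
  have h: "(\<lambda>z. exp (\<i> * z)) holomorphic_on {w. - 1 < Im w}" by (intro holomorphic_intros)
  have c: "integrable lborel (\<lambda>x. exp (\<i> * complex_of_real x) / (of_real x - \<i> * z)\<^sup>2)"
    "(LBINT x. exp (\<i> * complex_of_real x) / (of_real x - \<i> * z)\<^sup>2) = 2 * pi * \<i> * deriv (\<lambda>z. exp (\<i> * z)) (\<i> * z)"
    by (rule upper_halfplane_cauchy_formula_deriv(1)[where e = 1 and K = 1, OF _ h _ k]; simp)
      (rule upper_halfplane_cauchy_formula_deriv(2)[where e = 1 and K = 1, OF _ h _ k]; simp)
  have d: "deriv (\<lambda>z. exp (\<i> * z)) w = \<i> * exp (\<i> * w)" for w
    by (rule DERIV_imp_deriv) (auto intro!: derivative_eq_intros)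
  have eq: "exp (\<i> * of_real \<omega>) / (z + \<i> * of_real \<omega>)\<^sup>2
      = - 1 * (exp (\<i> * of_real \<omega>) / (of_real \<omega> - \<i> * z)\<^sup>2)" for \<omega> :: real
  proof -
    have "(z + \<i> * of_real \<omega>)\<^sup>2 = - (of_real \<omega> - \<i> * z)\<^sup>2"
      by (simp add: power2_eq_square algebra_simps)
    then show ?thesis by simp
  qed
  show "integrable lborel (\<lambda>\<omega>. exp (\<i> * of_real \<omega>) / (z + \<i> * of_real \<omega>)\<^sup>2)"
    unfolding eq by (intro integrable_mult_right c(1))
  show "(LBINT \<omega>. exp (\<i> * of_real \<omega>) / (z + \<i> * of_real \<omega>)\<^sup>2) = 2 * pi * exp (- z)"
    unfolding eq integral_mult_right_zero c(2) d by (simp add: mult.assoc[symmetric])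
qed

lemma inverse_laplace_cube:
  fixes z :: complex
  assumes z: "Re z > 0"
  shows "integrable lborel (\<lambda>\<omega>. exp (\<i> * of_real \<omega>) / (z + \<i> * of_real \<omega>) ^ 3)"
    and "(LBINT \<omega>. exp (\<i> * of_real \<omega>) / (z + \<i> * of_real \<omega>) ^ 3) = pi * exp (- z)"
proof -
  have k: "Im (\<i> * z) > 0" using z by simp
  have h: "(\<lambda>z. exp (\<i> * z)) holomorphic_on {w. - 1 < Im w}" by (intro holomorphic_intros)
  have c: "integrable lborel (\<lambda>x. exp (\<i> * complex_of_real x) / (of_real x - \<i> * z) ^ 3)"
    "(LBINT x. exp (\<i> * complex_of_real x) / (of_real x - \<i> * z) ^ 3) = pi * \<i> * deriv (deriv (\<lambda>z. exp (\<i> * z))) (\<i> * z)"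
    by (rule upper_halfplane_cauchy_formula_deriv2(1)[where e = 1 and K = 1, OF _ h _ k]; simp)
      (rule upper_halfplane_cauchy_formula_deriv2(2)[where e = 1 and K = 1, OF _ h _ k]; simp)
  have d: "deriv (\<lambda>z. exp (\<i> * z)) = (\<lambda>w. \<i> * exp (\<i> * w))"
    by (rule ext, rule DERIV_imp_deriv) (auto intro!: derivative_eq_intros)
  have d2: "deriv (\<lambda>w. \<i> * exp (\<i> * w)) w = - exp (\<i> * w)" for w
    by (rule DERIV_imp_deriv) (auto intro!: derivative_eq_intros simp: mult.assoc)
  have eq: "exp (\<i> * of_real \<omega>) / (z + \<i> * of_real \<omega>) ^ 3
      = \<i> * (exp (\<i> * of_real \<omega>) / (of_real \<omega> - \<i> * z) ^ 3)" for \<omega> :: real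
  proof -
    have "z + \<i> * of_real \<omega> = \<i> * (of_real \<omega> - \<i> * z)" by (simp add: algebra_simps)
    then have "exp (\<i> * of_real \<omega>) / (z + \<i> * of_real \<omega>) ^ 3
        = (1 / \<i> ^ 3) * (exp (\<i> * of_real \<omega>) / (of_real \<omega> - \<i> * z) ^ 3)" by (simp add: power_mult_distrib)
    also have "1 / \<i> ^ 3 = \<i>" by (subst nonzero_divide_eq_eq) (simp_all add: power3_eq_cube)
    finally show ?thesis .
  qed
  show "integrable lborel (\<lambda>\<omega>. exp (\<i> * of_real \<omega>) / (z + \<i> * of_real \<omega>) ^ 3)"
    unfolding eq by (intro integrable_mult_right c(1))
  show "(LBINT \<omega>. exp (\<i> * of_real \<omega>) / (z + \<i> * of_real \<omega>) ^ 3) = pi * exp (- z)"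
  proof -
    have "\<i> * (pi * \<i> * - E) = pi * E" for E :: complex by (simp add: complex_eq_iff)
    then show ?thesis unfolding eq integral_mult_right_zero c(2) d d2 by (simp add: mult.assoc[symmetric])
  qed
qed

section \<open>Positivity for a determinantal polynomial\<close>

lemma norm_sum_list_le:
  assumes "\<And>x. x \<in> set ls \<Longrightarrow> norm (f x) \<le> K"
  shows "norm (sum_list (map f ls)) \<le> real (length ls) * K"
  using assms
proof (induction ls)
  case (Cons a ls)
  have "norm (f a + sum_list (map f ls)) \<le> K + real (length ls) * K"
    using Cons by (intro norm_triangle_mono) auto
  then show ?case by (simp add: algebra_simps)
qed simp

lemma DERIV_sum_list:
  assumes "\<And>r. r \<in> set ls \<Longrightarrow> (f r has_field_derivative f' r) (at s)"
  shows "((\<lambda>s. sum_list (map (\<lambda>r. f r s) ls)) has_field_derivative sum_list (map f' ls)) (at s)"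
  using assms by (induction ls) (auto intro!: derivative_intros)

lemma prod_list_diff_eq_0_iff: "prod_list (map (\<lambda>r. y - r) ls) = 0 \<longleftrightarrow> y \<in> set ls" for y :: complex
  by (induction ls) auto

text \<open>The kernel is holomorphic above Im = -1 / \<epsilon> and O(1/|y|), so a root above the
  axis is covered by Cauchy's formula. For a root below, the quotient is holomorphic above and
  decays quadratically.\<close>

lemma kern_root_integral:
  assumes \<epsilon>: "\<epsilon> > 0" and r: "Im r \<noteq> 0"
  shows "integrable lborel (\<lambda>y. kern \<epsilon> (of_real y) / (of_real y - r))"
    and "(LBINT y. kern \<epsilon> (of_real y) / (of_real y - r)) = 2 * pi * \<i> * (if Im r > 0 then kern \<epsilon> r else 0)"
proof -
  have nz: "1 - \<i> * \<epsilon> * y \<noteq> 0" if "Im y > - (1 / \<epsilon>)" for y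
  proof
    assume "1 - \<i> * \<epsilon> * y = 0"
    then have "Re (1 - \<i> * \<epsilon> * y) = 0" by simp
    then have "Im y = - (1 / \<epsilon>)" using \<epsilon> by (simp add: field_simps)
    then show False using that by simp
  qed
  have hol: "kern \<epsilon> holomorphic_on {z. Im z > - (1 / \<epsilon>)}"
    unfolding kern_def[abs_def] by (intro holomorphic_intros) (use nz in simp)
  have e: "1 / \<epsilon> > 0" using \<epsilon> by simp
  have one: "(0::real) < 1" by simp
  have bd: "norm (kern \<epsilon> z) \<le> (1 / \<epsilon>\<^sup>2) / norm z" if "Im z \<ge> 0" "norm z \<ge> 1" for z
  proof -
    have z: "norm z > 0" using that by linarith
    have "norm (kern \<epsilon> z) \<le> norm z / (1 + \<epsilon>\<^sup>2 * (norm z)\<^sup>2)" by (rule norm_kern_le[OF \<epsilon> that(1)])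
    also have "\<dots> \<le> norm z / (\<epsilon>\<^sup>2 * (norm z)\<^sup>2)"
      using \<epsilon> z by (intro divide_left_mono) (auto intro!: mult_pos_pos add_pos_nonneg)
    also have "\<dots> = (1 / \<epsilon>\<^sup>2) / norm z" using z by (simp add: power2_eq_square)
    finally show ?thesis .
  qed
  have both: "integrable lborel (\<lambda>y. kern \<epsilon> (of_real y) / (of_real y - r)) \<and>
    (LBINT y. kern \<epsilon> (of_real y) / (of_real y - r)) = 2 * pi * \<i> * (if Im r > 0 then kern \<epsilon> r else 0)"
  proof (cases "Im r > 0")
    case True
    have "integrable lborel (\<lambda>y. kern \<epsilon> (of_real y) / (of_real y - r))"
      by (rule upper_halfplane_cauchy_formula(1)[OF e hol one _ True], erule (1) bd)
    moreover have "(LBINT y. kern \<epsilon> (of_real y) / (of_real y - r)) = 2 * pi * \<i> * kern \<epsilon> r"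
      by (rule upper_halfplane_cauchy_formula(2)[OF e hol one _ True], erule (1) bd)
    ultimately show ?thesis using True by simp
  next
    case False
    then have r': "Im r < 0" using r by simp
    let ?f = "\<lambda>y. kern \<epsilon> y / (y - r)"
    have e': "min (1 / \<epsilon>) (- Im r) > 0" using e r' by simp
    have hol': "?f holomorphic_on {z. Im z > - min (1 / \<epsilon>) (- Im r)}"
      by (intro holomorphic_intros holomorphic_on_subset[OF hol]) auto
    have R: "2 * norm r + 1 > 0" by (simp add: add_nonneg_pos)
    have bd': "norm (?f z) \<le> (2 / \<epsilon>\<^sup>2) / (norm z)\<^sup>2" if "Im z \<ge> 0" "norm z \<ge> 2 * norm r + 1" for z
    proof -
      have z: "norm z \<ge> 1" "norm z \<ge> 2 * norm r" using that(2) norm_ge_zero[of r] by linarith+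
      have "norm (?f z) \<le> ((1 / \<epsilon>\<^sup>2) / norm z) / (norm z / 2)"
        unfolding norm_divide using bd[OF that(1) z(1)] norm_diff_ge_half[OF z(2)] z \<epsilon>
        by (intro frac_le) auto
      also have "\<dots> = (2 / \<epsilon>\<^sup>2) / (norm z)\<^sup>2" using z by (simp add: power2_eq_square)
      finally show ?thesis .
    qed
    have "integrable lborel (\<lambda>y. ?f (of_real y))"
      by (rule upper_halfplane_integral_eq_0(1)[OF e' hol' R], erule (1) bd')
    moreover have "(LBINT y. ?f (of_real y)) = 0"
      by (rule upper_halfplane_integral_eq_0(2)[OF e' hol' R], erule (1) bd')
    ultimately show ?thesis using False by simp
  qed
  then show "integrable lborel (\<lambda>y. kern \<epsilon> (of_real y) / (of_real y - r))"
    "(LBINT y. kern \<epsilon> (of_real y) / (of_real y - r)) = 2 * pi * \<i> * (if Im r > 0 then kern \<epsilon> r else 0)"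
    by blast+
qed

text \<open>Collects what the argument uses about D(s,y) = det (s - A - y (v - B)), with
  \<open>Ds\<close>, \<open>Dy\<close> and so on its partial derivatives. The abstraction matters
  because the results are applied twice, to D and to its reflection. The same \<open>Dsy\<close>
  occurs as derivative of \<open>Ds\<close> and of \<open>Dy\<close>: mixed derivatives agree. Roots
  come as lists to keep multiplicities; in s the polynomial is monic, in y its leading coefficient
  may depend on s.\<close>

locale pencil =
  fixes n :: nat and D Ds Dy Dss Dsy Dssy :: "complex \<Rightarrow> complex \<Rightarrow> complex"
    and v :: complex and \<alpha> \<beta> :: real
  assumes Im_v: "Im v > 0"
    and roots_s: "\<exists>ls. length ls = n \<and> (\<forall>s. D s y = prod_list (map (\<lambda>r. s - r) ls))"
    and roots_y: "\<exists>c ls. c \<noteq> 0 \<and> length ls = n \<and> (\<forall>y. D s y = c * prod_list (map (\<lambda>r. y - r) ls))"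
    and zeros: "D s y = 0 \<Longrightarrow> \<exists>a b. \<bar>a\<bar> \<le> \<alpha> \<and> \<bar>b\<bar> \<le> \<beta> \<and> s = of_real a + y * (v - of_real b)"
    and D_s: "((\<lambda>s. D s y) has_field_derivative Ds s y) (at s)"
    and D_y: "((\<lambda>y. D s y) has_field_derivative Dy s y) (at y)"
    and Ds_s: "((\<lambda>s. Ds s y) has_field_derivative Dss s y) (at s)"
    and Ds_y: "((\<lambda>y. Ds s y) has_field_derivative Dsy s y) (at y)"
    and Dy_s: "((\<lambda>s. Dy s y) has_field_derivative Dsy s y) (at s)"
    and Dsy_s: "((\<lambda>s. Dsy s y) has_field_derivative Dssy s y) (at s)"
    and Dss_y: "((\<lambda>y. Dss s y) has_field_derivative Dssy s y) (at y)"
    and cont_D: "continuous_on UNIV (\<lambda>p. D (fst p) (snd p))"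
    and cont_Ds: "continuous_on UNIV (\<lambda>p. Ds (fst p) (snd p))"
    and cont_Dy: "continuous_on UNIV (\<lambda>p. Dy (fst p) (snd p))"
    and cont_Dss: "continuous_on UNIV (\<lambda>p. Dss (fst p) (snd p))"
    and cont_Dsy: "continuous_on UNIV (\<lambda>p. Dsy (fst p) (snd p))"
    and cont_Dssy: "continuous_on UNIV (\<lambda>p. Dssy (fst p) (snd p))"
begin

definition "V = norm v + \<bar>\<beta>\<bar>"

text \<open>
  In terms of log D: H is its y-derivative, G1 its second s-derivative, H1 and H2 the first two
  s-derivatives of H. The equality of mixed derivatives makes H2 also the y-derivative of G1.
\<close>

definition H where "H s y = Dy s y / D s y"
definition G1 where "G1 s y = (Dss s y * D s y - (Ds s y)\<^sup>2) / (D s y)\<^sup>2"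
definition H1 where "H1 s y = (Dsy s y * D s y - Dy s y * Ds s y) / (D s y)\<^sup>2"
definition H2 where "H2 s y = (Dssy s y * (D s y)\<^sup>2 - Dy s y * Dss s y * D s y - 2 * Ds s y * Dsy s y * D s y
    + 2 * Dy s y * (Ds s y)\<^sup>2) / (D s y) ^ 3"

lemma V_pos: "V > 0"
proof -
  have "v \<noteq> 0" using Im_v by auto
  then show ?thesis unfolding V_def by (simp add: add_pos_nonneg)
qed

lemma H_s: assumes "D s y \<noteq> 0" shows "((\<lambda>s. H s y) has_field_derivative H1 s y) (at s)"
  unfolding H_def H1_def
  by (rule derivative_eq_intros D_s Dy_s refl assms)+ (simp add: power2_eq_square)

lemma H1_s: assumes nz: "D s y \<noteq> 0" shows "((\<lambda>s. H1 s y) has_field_derivative H2 s y) (at s)"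
proof -
  have "((\<lambda>s. H1 s y) has_field_derivative
     ((Dssy s y * D s y + Ds s y * Dsy s y - (Dsy s y * Ds s y + Dss s y * Dy s y)) * (D s y)\<^sup>2
       - (Dsy s y * D s y - Dy s y * Ds s y) * (2 * D s y * Ds s y)) / ((D s y)\<^sup>2 * (D s y)\<^sup>2)) (at s)"
    unfolding H1_def using nz
    by (auto intro!: derivative_eq_intros D_s Dy_s Ds_s Dsy_s)
  also have "((Dssy s y * D s y + Ds s y * Dsy s y - (Dsy s y * Ds s y + Dss s y * Dy s y)) * (D s y)\<^sup>2
       - (Dsy s y * D s y - Dy s y * Ds s y) * (2 * D s y * Ds s y)) / ((D s y)\<^sup>2 * (D s y)\<^sup>2) = H2 s y"
    unfolding H2_def using nz
    by (subst frac_eq_eq) (simp_all, simp add: algebra_simps power2_eq_square power3_eq_cube power4_eq_xxxx)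
  finally show ?thesis .
qed

lemma G1_y: assumes nz: "D s y \<noteq> 0" shows "((\<lambda>y. G1 s y) has_field_derivative H2 s y) (at y)"
proof -
  have "((\<lambda>y. G1 s y) has_field_derivative
     ((Dssy s y * D s y + Dy s y * Dss s y - 2 * Ds s y * Dsy s y) * (D s y)\<^sup>2
       - (Dss s y * D s y - (Ds s y)\<^sup>2) * (2 * D s y * Dy s y)) / ((D s y)\<^sup>2 * (D s y)\<^sup>2)) (at y)"
    unfolding G1_def using nz
    by (auto intro!: derivative_eq_intros D_y Ds_y Dss_y)
  also have "((Dssy s y * D s y + Dy s y * Dss s y - 2 * Ds s y * Dsy s y) * (D s y)\<^sup>2
       - (Dss s y * D s y - (Ds s y)\<^sup>2) * (2 * D s y * Dy s y)) / ((D s y)\<^sup>2 * (D s y)\<^sup>2) = H2 s y"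
    unfolding H2_def using nz
    by (subst frac_eq_eq) (simp_all, simp add: algebra_simps power2_eq_square power3_eq_cube power4_eq_xxxx)
  finally show ?thesis .
qed

section \<open>Location of the zeros and bounds for the logarithmic derivatives\<close>

lemma Im_zero: "D s (of_real y) = 0 \<Longrightarrow> Im s = y * Im v"
  using zeros[of s "of_real y"] by auto

lemma norm_v_diff_le: "\<bar>b\<bar> \<le> \<beta> \<Longrightarrow> norm (v - of_real b) \<le> V"
  unfolding V_def using norm_triangle_ineq4[of v "of_real b"] by simp

lemma H_eq_sum:
  assumes "\<forall>y. D s y = c * prod_list (map (\<lambda>r. y - r) ls)" "D s y \<noteq> 0"
  shows "H s y = sum_list (map (\<lambda>r. 1 / (y - r)) ls)"
  unfolding H_def by (rule logarithmic_derivative_prod_list[OF _ D_y assms(2)]) (use assms(1) in blast)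

text \<open>For a root r of D(s,.) the number (y - r) (v - b) differs from y v - s by a real number,
  so its imaginary part is y Im v - Im s. Dividing by |v - b| \<le> \<open>V\<close> keeps y away
  from every root, and H is a sum of n reciprocals.\<close>

lemma norm_H_le:
  assumes "Im s \<noteq> y * Im v"
  shows "norm (H s (of_real y)) \<le> real n * (V / \<bar>y * Im v - Im s\<bar>)"
proof -
  obtain c ls where ls: "length ls = n" "\<forall>y. D s y = c * prod_list (map (\<lambda>r. y - r) ls)"
    using roots_y[of s] by blast
  have "D s (of_real y) \<noteq> 0" using Im_zero assms by blast
  note eq = H_eq_sum[OF ls(2) this]
  have "norm (1 / (of_real y - r)) \<le> V / \<bar>y * Im v - Im s\<bar>" if "r \<in> set ls" for r
  proof -
    have "D s r = 0" using ls(2) that prod_list_diff_eq_0_iff[of r ls] by simp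
    then obtain a b where ab: "\<bar>b\<bar> \<le> \<beta>" "s = of_real a + r * (v - of_real b)" using zeros by blast
    have "(of_real y - r) * (v - of_real b) = of_real y * (v - of_real b) - (s - of_real a)"
      unfolding ab(2) by (simp add: algebra_simps)
    then have "Im ((of_real y - r) * (v - of_real b)) = y * Im v - Im s" by simp
    then have "\<bar>y * Im v - Im s\<bar> \<le> norm (of_real y - r) * norm (v - of_real b)"
      using abs_Im_le_cmod[of "(of_real y - r) * (v - of_real b)"] by (simp only: norm_mult)
    also have "\<dots> \<le> norm (of_real y - r) * V" by (intro mult_left_mono norm_v_diff_le ab) simp
    finally have le: "\<bar>y * Im v - Im s\<bar> \<le> norm (of_real y - r) * V" .
    have pos: "0 < \<bar>y * Im v - Im s\<bar>" using assms by simp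
    then have "0 < norm (of_real y - r) * V" using le by linarith
    then have "0 < norm (of_real y - r)" using V_pos zero_less_mult_pos2 by blast
    then show ?thesis using le pos by (simp add: norm_divide divide_simps mult.commute)
  qed
  then have "norm (sum_list (map (\<lambda>r. 1 / (of_real y - r)) ls)) \<le> real (length ls) * (V / \<bar>y * Im v - Im s\<bar>)"
    by (rule norm_sum_list_le)
  then show ?thesis unfolding eq ls(1) .
qed

text \<open>No branch of log D is chosen: \<open>Ds\<close> / D equals the sum of 1 / (s - r) on the
  open set where D is non-zero, hence both have the same derivative in s.\<close>

lemma G1_eq_sum:
  assumes ls: "\<forall>s. D s y = prod_list (map (\<lambda>r. s - r) ls)" and nz: "D s y \<noteq> 0"
  shows "G1 s y = - sum_list (map (\<lambda>r. 1 / (s - r)\<^sup>2) ls)"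
proof -
  have ls': "D s y = 1 * prod_list (map (\<lambda>r. s - r) ls)" for s using ls by simp
  have eq: "Ds s y / D s y = sum_list (map (\<lambda>r. 1 / (s - r)) ls)" if "D s y \<noteq> 0" for s
    by (rule logarithmic_derivative_prod_list[OF ls' D_s that])
  have ne: "s - r \<noteq> 0" if "r \<in> set ls" for r
    using nz ls prod_list_diff_eq_0_iff[of s ls] that by auto
  have "((\<lambda>s. sum_list (map (\<lambda>r. 1 / (s - r)) ls)) has_field_derivative sum_list (map (\<lambda>r. - (1 / (s - r)\<^sup>2)) ls)) (at s)"
    by (rule DERIV_sum_list) (use ne in \<open>auto intro!: derivative_eq_intros simp: power2_eq_square\<close>)
  moreover have "((\<lambda>s. sum_list (map (\<lambda>r. 1 / (s - r)) ls)) has_field_derivative G1 s y) (at s)"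
  proof (rule has_field_derivative_transform_within_open)
    show "((\<lambda>s. Ds s y / D s y) has_field_derivative G1 s y) (at s)"
      unfolding G1_def by (rule derivative_eq_intros D_s Ds_s refl nz)+ (simp add: power2_eq_square)
    have "continuous_on UNIV (\<lambda>s. D s y)"
      by (intro continuous_at_imp_continuous_on ballI DERIV_isCont[OF D_s])
    then show "open {s. D s y \<noteq> 0}" by (intro open_Collect_neq) auto
    show "s \<in> {s. D s y \<noteq> 0}" using nz by simp
  qed (use eq in simp)
  ultimately have "G1 s y = sum_list (map (\<lambda>r. - (1 / (s - r)\<^sup>2)) ls)" using DERIV_unique by blast
  also have "sum_list (map (\<lambda>r. - (1 / (s - r)\<^sup>2)) ls) = - sum_list (map (\<lambda>r. 1 / (s - r)\<^sup>2) ls)"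
    by (induction ls) auto
  finally show ?thesis .
qed

lemma norm_G1_le:
  assumes K: "K > 0" and "\<And>r. D r y = 0 \<Longrightarrow> norm (s - r) \<ge> K"
  shows "norm (G1 s y) \<le> real n / K\<^sup>2"
proof -
  obtain ls where ls: "length ls = n" "\<forall>s. D s y = prod_list (map (\<lambda>r. s - r) ls)" using roots_s by blast
  have nz: "D s y \<noteq> 0" using assms(2)[of s] K by auto
  have "norm (1 / (s - r)\<^sup>2) \<le> 1 / K\<^sup>2" if "r \<in> set ls" for r
  proof -
    have "D r y = 0" using ls(2) that prod_list_diff_eq_0_iff[of r ls] by simp
    then have "K \<le> norm (s - r)" by (rule assms(2))
    then have "K\<^sup>2 \<le> (norm (s - r))\<^sup>2" using K by (intro power_mono) auto
    then show ?thesis using K by (simp add: norm_divide norm_power frac_le)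
  qed
  then have "norm (sum_list (map (\<lambda>r. 1 / (s - r)\<^sup>2) ls)) \<le> real (length ls) * (1 / K\<^sup>2)"
    by (rule norm_sum_list_le)
  then show ?thesis unfolding G1_eq_sum[OF ls(2) nz] ls(1) by simp
qed

text \<open>For y in the closed second quadrant either the real part of the zero is at most \<alpha>
  or its imaginary part is at most 0, according to the sign of Re v - b. So a point \<zeta> with Re
  \<zeta> > \<alpha> and Im \<zeta> > 0 stays clear of all zeros while y rotates through the
  quadrant.\<close>

lemma zero_distance_quadrant:
  assumes "D r y = 0" "Re y \<le> 0" "Im y \<ge> 0"
  shows "norm (\<zeta> - r) \<ge> min (Re \<zeta> - \<alpha>) (Im \<zeta>)"
proof -
  obtain a b where ab: "\<bar>a\<bar> \<le> \<alpha>" "r = of_real a + y * (v - of_real b)" using zeros[OF assms(1)] by blast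
  show ?thesis
  proof (cases "Re v \<ge> b")
    case True
    have "Re r = a + Re y * (Re v - b) - Im y * Im v" unfolding ab(2) by simp
    moreover have "Re y * (Re v - b) \<le> 0" using True assms by (intro mult_nonpos_nonneg) auto
    moreover have "0 \<le> Im y * Im v" using assms Im_v by simp
    ultimately have "Re \<zeta> - \<alpha> \<le> Re (\<zeta> - r)" using ab(1) by simp
    then show ?thesis using complex_Re_le_cmod[of "\<zeta> - r"] by linarith
  next
    case False
    have "Im r = Re y * Im v + Im y * (Re v - b)" unfolding ab(2) by simp
    moreover have "Im y * (Re v - b) \<le> 0" using False assms by (intro mult_nonneg_nonpos) auto
    moreover have "Re y * Im v \<le> 0" using assms Im_v by (intro mult_nonpos_nonneg) auto
    ultimately have "Im \<zeta> \<le> Im (\<zeta> - r)" by simp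
    then show ?thesis using abs_Im_le_cmod[of "\<zeta> - r"] by linarith
  qed
qed

text \<open>The numerator y of the kernel cancels the factor 1 / |y| from \<open>norm_H_le\<close>
  at real s, which leaves a bound that is uniform in s and integrable in y.\<close>

lemma norm_kern_H_le:
  assumes \<epsilon>: "\<epsilon> > 0"
  shows "norm (kern \<epsilon> (of_real y) * H (of_real s) (of_real y)) \<le> (real n * V / Im v) * (1 / (1 + \<epsilon>\<^sup>2 * y\<^sup>2))"
proof (cases "y = 0")
  case True
  then show ?thesis using V_pos Im_v by (simp add: kern_def)
next
  case False
  have k: "norm (kern \<epsilon> (of_real y)) \<le> \<bar>y\<bar> / (1 + \<epsilon>\<^sup>2 * y\<^sup>2)" using norm_kern_le[OF \<epsilon>, of "of_real y"] by simp
  have h: "norm (H (of_real s) (of_real y)) \<le> real n * (V / (\<bar>y\<bar> * Im v))"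
    using norm_H_le[of "of_real s" y] False Im_v by (simp add: abs_mult)
  have "norm (kern \<epsilon> (of_real y) * H (of_real s) (of_real y)) \<le> (\<bar>y\<bar> / (1 + \<epsilon>\<^sup>2 * y\<^sup>2)) * (real n * (V / (\<bar>y\<bar> * Im v)))"
    unfolding norm_mult by (rule mult_mono[OF k h]) (auto simp: add_nonneg_nonneg)
  also have "\<dots> = (real n * V / Im v) * (1 / (1 + \<epsilon>\<^sup>2 * y\<^sup>2))" using False by simp
  finally show ?thesis .
qed

section \<open>Residues: the sign and the support of N(s)\<close>

definition NI where "NI \<epsilon> s = (LBINT y. kern \<epsilon> (of_real y) * H (of_real s) (of_real y))"

text \<open>A real root r in y would give r Im v = 0, hence r = 0, which is excluded. By partial
  fractions only roots with Im r > 0 contribute, each 2 pi i times a value of the kernel with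
  non-negative imaginary part. For s > \<alpha> no such roots are left.\<close>

lemma NI_residues:
  assumes \<epsilon>: "\<epsilon> > 0" and s: "D (of_real s) 0 \<noteq> 0"
  shows "Re (NI \<epsilon> s) \<le> 0" and "s > \<alpha> \<Longrightarrow> NI \<epsilon> s = 0"
proof -
  obtain c ls where ls: "\<forall>y. D (of_real s) y = c * prod_list (map (\<lambda>r. y - r) ls)"
    using roots_y[of "of_real s"] by blast
  have rt: "\<exists>a b. \<bar>a\<bar> \<le> \<alpha> \<and> s = a + Re r * (Re v - b) - Im r * Im v \<and> Re r * Im v + Im r * (Re v - b) = 0 \<and> Im r \<noteq> 0"
    if "r \<in> set ls" for r
  proof -
    have z: "D (of_real s) r = 0" using ls that prod_list_diff_eq_0_iff[of r ls] by simp
    then obtain a b where ab: "\<bar>a\<bar> \<le> \<alpha>" "of_real s = of_real a + r * (v - of_real b)" using zeros by blast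
    have re: "s = a + Re r * (Re v - b) - Im r * Im v" using arg_cong[OF ab(2), of Re] by simp
    have im: "Re r * Im v + Im r * (Re v - b) = 0" using arg_cong[OF ab(2), of Im] by simp
    have "Im r \<noteq> 0"
    proof
      assume "Im r = 0"
      then have "r = 0" using im Im_v by (simp add: complex_eq_iff)
      then show False using z s by simp
    qed
    then show ?thesis using ab(1) re im by blast
  qed
  have nzH: "kern \<epsilon> (of_real y) * H (of_real s) (of_real y) = sum_list (map (\<lambda>r. kern \<epsilon> (of_real y) / (of_real y - r)) ls)" for y :: real
  proof -
    have "D (of_real s) (of_real y) \<noteq> 0"
    proof
      assume z: "D (of_real s) (of_real y) = 0"
      from Im_zero[OF z] Im_v have "y = 0" by simp
      then show False using z s by simp
    qed
    from H_eq_sum[OF ls this] show ?thesis by (simp add: sum_list_const_mult[symmetric])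
  qed
  have "integrable lborel (\<lambda>y. sum_list (map (\<lambda>r. kern \<epsilon> (of_real y) / (of_real y - r)) ls)) \<and>
    (LBINT y. sum_list (map (\<lambda>r. kern \<epsilon> (of_real y) / (of_real y - r)) ls))
     = sum_list (map (\<lambda>r. 2 * pi * \<i> * (if Im r > 0 then kern \<epsilon> r else 0)) ls)"
    if "\<forall>r\<in>set ls. Im r \<noteq> 0" for ls
    using that
  proof (induction ls)
    case (Cons r ls)
    note k = kern_root_integral[OF \<epsilon>, of r]
    have r: "Im r \<noteq> 0" using Cons.prems by simp
    show ?case using k(1)[OF r] k(2)[OF r] Cons by simp
  qed simp
  with rt have val: "NI \<epsilon> s = sum_list (map (\<lambda>r. 2 * pi * \<i> * (if Im r > 0 then kern \<epsilon> r else 0)) ls)"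
    unfolding NI_def nzH by blast
  have "Re (sum_list (map (\<lambda>r. 2 * pi * \<i> * (if Im r > 0 then kern \<epsilon> r else 0)) ls)) \<le> 0" for ls
  proof (induction ls)
    case (Cons r ls)
    have "0 \<le> 2 * pi * Im (kern \<epsilon> r)" if "Im r > 0"
      using Im_kern_nonneg[OF \<epsilon> that] by simp
    then show ?case using Cons by auto
  qed simp
  then show "Re (NI \<epsilon> s) \<le> 0" unfolding val by blast
  assume s\<alpha>: "s > \<alpha>"
  have "Im r < 0" if "r \<in> set ls" for r
  proof -
    obtain a b where ab: "\<bar>a\<bar> \<le> \<alpha>" "s = a + Re r * (Re v - b) - Im r * Im v" "Re r * Im v + Im r * (Re v - b) = 0" "Im r \<noteq> 0"
      using rt[OF \<open>r \<in> set ls\<close>] by blast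
    have sa: "s - a = Re r * (Re v - b) - Im r * Im v" using ab(2) by linarith
    \<comment> \<open>Multiplying by Im v allows Re r to be eliminated through the imaginary part of
      s = a + r (v - b). The result (s - a) Im v = - Im r |v - b|^2 fixes the sign of Im r.\<close>
    have "(s - a) * Im v = Re r * Im v * (Re v - b) - Im r * Im v * Im v"
      unfolding sa by (simp add: algebra_simps)
    also have "Re r * Im v = - Im r * (Re v - b)" using ab(3) by linarith
    finally have "(s - a) * Im v = - Im r * ((Re v - b)\<^sup>2 + (Im v)\<^sup>2)" by (simp add: power2_eq_square algebra_simps)
    moreover have "(s - a) * Im v > 0" using ab(1) s\<alpha> Im_v by (intro mult_pos_pos) auto
    ultimately have "Im r * ((Re v - b)\<^sup>2 + (Im v)\<^sup>2) < 0" by simp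
    then show ?thesis by (smt (verit) mult_nonneg_nonneg zero_le_power2)
  qed
  then have neg: "\<not> Im r > 0" if "r \<in> set ls" for r using that order_less_asym by blast
  have "map (\<lambda>r. 2 * pi * \<i> * (if Im r > 0 then kern \<epsilon> r else 0)) ls = map (\<lambda>r. 0) ls"
    by (intro map_cong refl) (simp add: neg)
  then show "NI \<epsilon> s = 0" unfolding val by (simp only:) (induction ls; simp)
qed

text \<open>The exceptional s are roots of the monic polynomial D(.,0), hence finitely many;
  integration over s does not see them.\<close>

lemma AE_D_0: "AE s in lborel. D (of_real s) 0 \<noteq> 0"
proof -
  obtain ls where ls: "\<forall>s. D s 0 = prod_list (map (\<lambda>r. s - r) ls)" using roots_s[of 0] by blast
  have "{s. D (of_real s) 0 = 0} \<subseteq> Re ` set ls"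
  proof
    fix s :: real
    assume "s \<in> {s. D (of_real s) 0 = 0}"
    then have "complex_of_real s \<in> set ls" using ls prod_list_diff_eq_0_iff[of "of_real s" ls] by simp
    then show "s \<in> Re ` set ls" by force
  qed
  then have "finite {s. D (of_real s) 0 = 0}" by (rule finite_subset) simp
  then have "{s. D (of_real s) 0 = 0} \<in> null_sets lborel" by (rule finite_imp_null_set_lborel)
  from AE_not_in[OF this] show ?thesis by simp
qed

section \<open>The weighted integral of N(s) for Im \<zeta> > 0\<close>

lemma measurable_comp_of_real:
  assumes "continuous_on UNIV (\<lambda>p. F (fst p) (snd p) :: complex)"
  shows "(\<lambda>p. F (complex_of_real (fst p)) (complex_of_real (snd p))) \<in> borel_measurable (borel \<Otimes>\<^sub>M borel)"
proof -
  have "continuous_on UNIV (\<lambda>p :: real \<times> real. (complex_of_real (fst p), complex_of_real (snd p)))"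
    by (intro continuous_intros)
  from continuous_on_compose2[OF assms this]
  have "continuous_on UNIV (\<lambda>p :: real \<times> real. F (complex_of_real (fst p)) (complex_of_real (snd p)))" by simp
  then show ?thesis unfolding borel_prod by (rule borel_measurable_continuous_onI)
qed

lemma measurable_H: "(\<lambda>p. H (complex_of_real (fst p)) (complex_of_real (snd p))) \<in> borel_measurable (borel \<Otimes>\<^sub>M borel)"
  unfolding H_def by (intro borel_measurable_divide measurable_comp_of_real cont_D cont_Dy)

lemma measurable_kern [measurable]: "(\<lambda>y. kern \<epsilon> (complex_of_real y)) \<in> borel_measurable borel"
  unfolding kern_def by measurable

text \<open>The bound for the product of kernel and H depends on y alone, so the weight (s -
  \<zeta>)^(-3) provides the integrability in s and Fubini becomes available.\<close>

lemma integrable_kern_H_weighted: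
  assumes \<epsilon>: "\<epsilon> > 0" and \<zeta>: "Im \<zeta> > 0"
  shows "integrable (lborel \<Otimes>\<^sub>M lborel) (\<lambda>p. kern \<epsilon> (of_real (snd p)) * H (of_real (fst p)) (of_real (snd p)) / (of_real (fst p) - \<zeta>) ^ 3)"
proof (rule integrable_pair_product_bound)
  note [measurable] = measurable_H
  show "(\<lambda>p. kern \<epsilon> (of_real (snd p)) * H (of_real (fst p)) (of_real (snd p)) / (of_real (fst p) - \<zeta>) ^ 3)
     \<in> borel_measurable (borel \<Otimes>\<^sub>M borel)" by measurable
  have three: "(2::nat) \<le> 3" by simp
  show "integrable lborel (\<lambda>s. norm (1 / (complex_of_real s - \<zeta>) ^ 3))"
    by (intro integrable_norm integral_inverse_power_line \<zeta> three)
  show "integrable lborel (\<lambda>y. (real n * V / Im v) * (1 / (1 + \<epsilon>\<^sup>2 * y\<^sup>2)))"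
    by (intro integrable_mult_right integrable_inverse_1_plus_scaled_square \<epsilon>)
  fix s y :: real
  have "norm (kern \<epsilon> (of_real y) * H (of_real s) (of_real y) / (of_real s - \<zeta>) ^ 3)
      = norm (1 / (complex_of_real s - \<zeta>) ^ 3) * norm (kern \<epsilon> (of_real y) * H (of_real s) (of_real y))"
    by (simp add: norm_divide)
  also have "\<dots> \<le> norm (1 / (complex_of_real s - \<zeta>) ^ 3) * ((real n * V / Im v) * (1 / (1 + \<epsilon>\<^sup>2 * y\<^sup>2)))"
    by (rule mult_left_mono[OF norm_kern_H_le[OF \<epsilon>] norm_ge_zero])
  finally show "norm (kern \<epsilon> (of_real (snd (s, y))) * H (of_real (fst (s, y))) (of_real (snd (s, y))) / (of_real (fst (s, y)) - \<zeta>) ^ 3)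
     \<le> norm (1 / (complex_of_real s - \<zeta>) ^ 3) * ((real n * V / Im v) * (1 / (1 + \<epsilon>\<^sup>2 * y\<^sup>2)))" by simp
qed

lemma open_D_nonzero: "open {s. D s y \<noteq> 0}"
proof -
  have "continuous_on UNIV (\<lambda>s. D s y)"
    by (intro continuous_at_imp_continuous_on ballI DERIV_isCont[OF D_s])
  then show ?thesis by (intro open_Collect_neq) auto
qed

lemma H_holomorphic: "(\<lambda>s. H s y) holomorphic_on {s. D s y \<noteq> 0}"
  unfolding holomorphic_on_def field_differentiable_def
  using H_s has_field_derivative_at_within by blast

lemma deriv_deriv_H:
  assumes "D \<zeta> y \<noteq> 0"
  shows "deriv (deriv (\<lambda>s. H s y)) \<zeta> = H2 \<zeta> y"
proof (rule DERIV_imp_deriv)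
  show "(deriv (\<lambda>s. H s y) has_field_derivative H2 \<zeta> y) (at \<zeta>)"
    by (rule has_field_derivative_transform_within_open[OF H1_s[OF assms] open_D_nonzero[of y]])
      (use assms H_s DERIV_imp_deriv in \<open>fastforce+\<close>)
qed

text \<open>By \<open>Im_zero\<close> the poles of H in s lie on the line Im s = y Im v. For y < 0
  they are below the axis and the cubic pole at \<zeta> yields half the second derivative. For y > 0
  they are above, so H is holomorphic and bounded below, where the weight has no pole; the
  substitution s to -s turns this into an upper half-plane.\<close>

lemma integral_H_weighted:
  assumes \<zeta>: "Im \<zeta> > 0" and y: "y \<noteq> 0"
  shows "(LBINT s. H (of_real s) (of_real y) / (of_real s - \<zeta>) ^ 3)
    = (if y < 0 then pi * \<i> * H2 \<zeta> (of_real y) else 0)"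
proof (cases "y < 0")
  case True
  have e: "- (y * Im v) > 0" using True Im_v by (simp add: mult_neg_pos)
  have nz: "D s (of_real y) \<noteq> 0" if "Im s > - (- (y * Im v))" for s using Im_zero[of s y] that by auto
  have hol: "(\<lambda>s. H s (of_real y)) holomorphic_on {s. Im s > - (- (y * Im v))}"
    by (rule holomorphic_on_subset[OF H_holomorphic]) (use nz in auto)
  have bd: "norm (H s (of_real y)) \<le> real n * (V / (- (y * Im v)))" if "Im s \<ge> 0" for s
  proof -
    have "norm (H s (of_real y)) \<le> real n * (V / \<bar>y * Im v - Im s\<bar>)" using e that by (intro norm_H_le) auto
    also have "\<dots> \<le> real n * (V / (- (y * Im v)))"
      using e that V_pos by (intro mult_left_mono divide_left_mono mult_pos_pos) auto
    finally show ?thesis .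
  qed
  have "(LBINT s. H (of_real s) (of_real y) / (of_real s - \<zeta>) ^ 3) = pi * \<i> * deriv (deriv (\<lambda>s. H s (of_real y))) \<zeta>"
    by (rule upper_halfplane_cauchy_formula_deriv2(2)[OF e hol _ \<zeta>], erule bd)
  also have "deriv (deriv (\<lambda>s. H s (of_real y))) \<zeta> = H2 \<zeta> (of_real y)"
    using \<zeta> e by (intro deriv_deriv_H nz) auto
  finally show ?thesis using True by simp
next
  case False
  then have y': "y > 0" using y by simp
  have e: "y * Im v > 0" using y' Im_v by simp
  have nz: "D (- s) (of_real y) \<noteq> 0" if "Im s > - (y * Im v)" for s using Im_zero[of "- s" y] that by auto
  have hol: "(\<lambda>s. H (- s) (of_real y)) holomorphic_on {s. Im s > - (y * Im v)}"
  proof -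
    have "((\<lambda>s. H s (of_real y)) \<circ> uminus) holomorphic_on {s. Im s > - (y * Im v)}"
      by (rule holomorphic_on_compose_gen[OF _ H_holomorphic]) (use nz in \<open>auto intro!: holomorphic_intros\<close>)
    then show ?thesis by (simp add: comp_def)
  qed
  have bd: "norm (H (- s) (of_real y)) \<le> real n * (V / (y * Im v))" if "Im s \<ge> 0" for s
  proof -
    have "norm (H (- s) (of_real y)) \<le> real n * (V / \<bar>y * Im v - Im (- s)\<bar>)" using e that by (intro norm_H_le) auto
    also have "\<dots> \<le> real n * (V / (y * Im v))"
      using e that V_pos y' Im_v add_pos_nonneg[OF e that] by (intro mult_left_mono divide_left_mono mult_pos_pos) auto
    finally show ?thesis .
  qed
  have w: "Im (- \<zeta>) < 0" using \<zeta> by simp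
  have three: "(2::nat) \<le> 3" by simp
  have "(LBINT s. H (- of_real s) (of_real y) / (of_real s - (- \<zeta>)) ^ 3) = 0"
    by (rule upper_halfplane_integral_pole_below(2)[OF e hol _ w three], erule bd)
  \<comment> \<open>The odd exponent produces the sign.\<close>
  moreover have "H (of_real (0 + - 1 * s)) (of_real y) / (of_real (0 + - 1 * s) - \<zeta>) ^ 3
       = - 1 * (H (- of_real s) (of_real y) / (of_real s - (- \<zeta>)) ^ 3)" for s :: real
  proof -
    have "(of_real (0 + - 1 * s) - \<zeta>) ^ 3 = - ((of_real s - (- \<zeta>)) ^ 3)"
      by (simp add: power3_eq_cube algebra_simps)
    then show ?thesis by simp
  qed
  ultimately have "(LBINT s. H (of_real (0 + - 1 * s)) (of_real y) / (of_real (0 + - 1 * s) - \<zeta>) ^ 3) = 0"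
    by (simp only: integral_mult_right_zero mult_zero_right)
  then show ?thesis
    using lborel_integral_real_affine[of "-1" "\<lambda>s. H (of_real s) (of_real y) / (of_real s - \<zeta>) ^ 3" 0] False by simp
qed

text \<open>After Fubini only pi i times the integral of \<open>kern\<close> H2 over y < 0 is left.
  H2 is also the y-derivative of G1, so integration by parts moves the derivative to the kernel, and
  \<open>kern'\<close> G1 is holomorphic in the second quadrant with decay enough for the
  rotation.\<close>

lemma pencil_identity_upper:
  assumes \<epsilon>: "\<epsilon> > 0" and \<zeta>: "Im \<zeta> > 0" "Re \<zeta> > \<alpha>"
  shows "(LBINT s. NI \<epsilon> s / (of_real s - \<zeta>) ^ 3)
    = - pi * (LINT r:{0..}|lborel. kern' \<epsilon> (\<i> * of_real r) * G1 \<zeta> (\<i> * of_real r))"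
proof -
  \<comment> \<open>A common lower bound for the distance of \<zeta> from all zeros belonging to y
    in the quadrant; it makes G1 bounded there.\<close>
  define c0 where "c0 = min (Re \<zeta> - \<alpha>) (Im \<zeta>)"
  have c0: "c0 > 0" using \<zeta> by (simp add: c0_def)
  let ?Q = "{z. Re z \<le> 0 \<and> Im z \<ge> 0}"
  have nz: "D \<zeta> z \<noteq> 0" if "z \<in> ?Q" for z
    using zero_distance_quadrant[of \<zeta> z \<zeta>] that c0 by (auto simp: c0_def)
  have G1_bd: "norm (G1 \<zeta> z) \<le> real n / c0\<^sup>2" if "z \<in> ?Q" for z
    by (rule norm_G1_le[OF c0]) (use zero_distance_quadrant[of _ z \<zeta>] that in \<open>auto simp: c0_def\<close>)
  have kd: "1 - \<i> * \<epsilon> * z \<noteq> 0" if "z \<in> ?Q" for z using kern_denominator(2)[OF \<epsilon>, of z] that by simp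
  define f where "f z = kern' \<epsilon> z * G1 \<zeta> z" for z
  have hol: "f holomorphic_on ?Q"
    unfolding f_def
  proof (rule holomorphic_on_mult)
    show "kern' \<epsilon> holomorphic_on ?Q" unfolding kern'_def[abs_def] using kd by (intro holomorphic_intros) simp
    show "G1 \<zeta> holomorphic_on ?Q"
      unfolding holomorphic_on_def field_differentiable_def using G1_y nz has_field_derivative_at_within by blast
  qed
  have f_bd: "norm (f z) \<le> (2 * (real n / c0\<^sup>2)) / (1 + \<epsilon>\<^sup>2 * (norm z)\<^sup>2)" if "Re z \<le> 0" "Im z \<ge> 0" for z
  proof -
    have "norm (f z) \<le> 2 / (1 + \<epsilon>\<^sup>2 * (norm z)\<^sup>2) * (real n / c0\<^sup>2)"
      unfolding f_def norm_mult using norm_kern'_le[OF \<epsilon> that(2)] G1_bd[of z] that by (intro mult_mono) auto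
    then show ?thesis by (simp add: mult.commute)
  qed
  have rot1: "set_integrable lborel {0..} (\<lambda>r. f (- of_real r))"
    by (rule integral_quadrant_rotation(1)[OF hol \<epsilon>], erule (1) f_bd)
  have rot3: "(LINT r:{0..}|lborel. f (- of_real r)) = - \<i> * (LINT r:{0..}|lborel. f (\<i> * of_real r))"
    by (rule integral_quadrant_rotation(3)[OF hol \<epsilon>], erule (1) f_bd)
  \<comment> \<open>The outcome of the inner s-integration. At y = 0, where the zeros in s are real,
    the vanishing of the kernel settles the value.\<close>
  define k where "k y = (if y < 0 then pi * \<i> * (kern \<epsilon> (of_real y) * H2 \<zeta> (of_real y)) else 0)" for y :: real
  let ?g = "\<lambda>p. kern \<epsilon> (of_real (snd p)) * H (of_real (fst p)) (of_real (snd p)) / (of_real (fst p) - \<zeta>) ^ 3"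
  have "integrable (lborel \<Otimes>\<^sub>M lborel) ?g" by (rule integrable_kern_H_weighted[OF \<epsilon> \<zeta>(1)])
  then have int': "integrable (lborel \<Otimes>\<^sub>M lborel) (\<lambda>(s, y). ?g (s, y))" by (simp add: case_prod_unfold)
  have inner: "(LBINT s. ?g (s, y)) = k y" for y
  proof (cases "y = 0")
    case True
    then show ?thesis by (simp add: kern_def k_def)
  next
    case False
    have "(LBINT s. ?g (s, y)) = (LBINT s. kern \<epsilon> (of_real y) * (H (of_real s) (of_real y) / (of_real s - \<zeta>) ^ 3))"
      by simp
    also have "\<dots> = kern \<epsilon> (of_real y) * (if y < 0 then pi * \<i> * H2 \<zeta> (of_real y) else 0)"
      unfolding integral_mult_right_zero integral_H_weighted[OF \<zeta>(1) False] ..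
    finally show ?thesis by (simp add: k_def)
  qed
  have k_int: "integrable lborel k"
    using lborel_pair.integrable_snd[OF int'] unfolding inner .
  have "(LBINT s. NI \<epsilon> s / (of_real s - \<zeta>) ^ 3) = (LBINT s. LBINT y. ?g (s, y))"
    unfolding NI_def by simp
  also have "\<dots> = (LBINT y. LBINT s. ?g (s, y))"
    using lborel_pair.Fubini_integral[OF int'] by simp
  also have "\<dots> = (LBINT y. k y)" unfolding inner ..
  also have "\<dots> = (LBINT x. k (- x))" using lborel_integral_real_affine[of "-1" k 0] by simp
  also have "\<dots> = (LINT x:{0..}|lborel. pi * \<i> * (kern \<epsilon> (- of_real x) * H2 \<zeta> (- of_real x)))"
    unfolding set_lebesgue_integral_def
    by (rule Bochner_Integration.integral_cong) (auto simp: k_def kern_def indicator_def)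
  also have "\<dots> = pi * \<i> * (LINT x:{0..}|lborel. kern \<epsilon> (- of_real x) * H2 \<zeta> (- of_real x))"
    by (rule set_integral_mult_right)
  finally have step1: "(LBINT s. NI \<epsilon> s / (of_real s - \<zeta>) ^ 3)
     = pi * \<i> * (LINT x:{0..}|lborel. kern \<epsilon> (- of_real x) * H2 \<zeta> (- of_real x))" .
  have kH2: "set_integrable lborel {0..} (\<lambda>x. kern \<epsilon> (- of_real x) * H2 \<zeta> (- of_real x))"
  proof -
    have "integrable lborel (\<lambda>x. k (0 + - 1 * x))" by (rule lborel_integrable_real_affine[OF k_int]) simp
    then have "integrable lborel (\<lambda>x. 1 / (pi * \<i>) * k (- x))" by (intro integrable_mult_right) simp
    moreover have "(\<lambda>x. 1 / (pi * \<i>) * k (- x)) = (\<lambda>x. indicator {0..} x *\<^sub>R (kern \<epsilon> (- of_real x) * H2 \<zeta> (- of_real x)))"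
      by (rule ext) (auto simp: k_def kern_def indicator_def)
    ultimately show ?thesis unfolding set_integrable_def by simp
  qed
  \<comment> \<open>Integration by parts along the negative half-line, parametrized by x = -y, which
    is why \<open>F\<close> has derivative -\<open>F'\<close>. The boundary terms vanish: the kernel
    is 0 at 0 and O(1/x) at infinity while G1 stays bounded.\<close>
  define F where "F x = kern \<epsilon> (- of_real x) * G1 \<zeta> (- of_real x)" for x :: real
  define F' where "F' x = f (- of_real x) + kern \<epsilon> (- of_real x) * H2 \<zeta> (- of_real x)" for x :: real
  have F'_int: "set_integrable lborel {0..} F'"
    unfolding F'_def by (intro set_integral_add rot1 kH2)
  have deriv_F: "(F has_vector_derivative - F' x) (at x)" if "x \<ge> 0" for x
  proof -
    have Q: "- complex_of_real x \<in> ?Q" using that by simp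
    have "((\<lambda>w. kern \<epsilon> w * G1 \<zeta> w) has_field_derivative
        (kern' \<epsilon> (- of_real x) * G1 \<zeta> (- of_real x) + H2 \<zeta> (- of_real x) * kern \<epsilon> (- of_real x))) (at (- of_real x))"
      by (intro DERIV_mult kern_has_field_derivative[OF kd[OF Q]] G1_y[OF nz[OF Q]])
    then have "((\<lambda>w. kern \<epsilon> (- w) * G1 \<zeta> (- w)) has_field_derivative
        (kern' \<epsilon> (- of_real x) * G1 \<zeta> (- of_real x) + H2 \<zeta> (- of_real x) * kern \<epsilon> (- of_real x)) * - 1) (at (of_real x))"
      by (rule DERIV_chain2) (auto intro!: derivative_eq_intros)
    from has_vector_derivative_real_field[OF this] show ?thesis
      unfolding F_def F'_def f_def by (simp add: algebra_simps)
  qed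
  have "integral {0..real m} (\<lambda>x. - F' x) = F (real m) - F 0" for m :: nat
    by (rule integral_unique, rule fundamental_theorem_of_calculus)
      (auto intro!: has_vector_derivative_at_within deriv_F)
  then have FTC: "integral {0..real m} F' = - F (real m)" for m :: nat
    by (simp add: F_def kern_def)
  have "(\<lambda>m. F (real m)) \<longlonglongrightarrow> 0"
  proof (rule Lim_null_comparison)
    show "\<forall>\<^sub>F m in sequentially. norm (F (real m)) \<le> (real n / c0\<^sup>2 / \<epsilon>\<^sup>2) / real m"
    proof (rule eventually_sequentiallyI[of 1])
      fix m :: nat
      assume m: "1 \<le> m"
      have Q: "- complex_of_real (real m) \<in> ?Q" by simp
      have "norm (kern \<epsilon> (- of_real (real m))) \<le> real m / (1 + \<epsilon>\<^sup>2 * (real m)\<^sup>2)"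
        using norm_kern_le[OF \<epsilon>, of "- of_real (real m)"] by simp
      also have "\<dots> \<le> real m / (\<epsilon>\<^sup>2 * (real m)\<^sup>2)"
        using \<epsilon> m by (intro divide_left_mono) (auto intro!: mult_pos_pos add_pos_nonneg)
      also have "\<dots> = 1 / \<epsilon>\<^sup>2 / real m" using m by (simp add: power2_eq_square)
      finally have "norm (kern \<epsilon> (- of_real (real m))) \<le> 1 / \<epsilon>\<^sup>2 / real m" .
      then have "norm (F (real m)) \<le> (1 / \<epsilon>\<^sup>2 / real m) * (real n / c0\<^sup>2)"
        unfolding F_def norm_mult using G1_bd[OF Q] by (intro mult_mono) auto
      then show "norm (F (real m)) \<le> (real n / c0\<^sup>2 / \<epsilon>\<^sup>2) / real m" by (simp add: mult_ac)
    qed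
    show "(\<lambda>m. (real n / c0\<^sup>2 / \<epsilon>\<^sup>2) / real m) \<longlonglongrightarrow> 0" by (rule lim_const_over_n)
  qed
  then have "(\<lambda>m. integral {0..real m} F') \<longlonglongrightarrow> 0" unfolding FTC using tendsto_minus by fastforce
  then have "(LINT x:{0..}|lborel. F' x) = 0"
    using LIMSEQ_unique set_integral_lborel_limit_atLeast[OF F'_int] by blast
  then have "(LINT x:{0..}|lborel. f (- of_real x)) + (LINT x:{0..}|lborel. kern \<epsilon> (- of_real x) * H2 \<zeta> (- of_real x)) = 0"
    unfolding F'_def set_integral_add(2)[OF rot1 kH2] .
  then have "(LINT x:{0..}|lborel. kern \<epsilon> (- of_real x) * H2 \<zeta> (- of_real x)) = \<i> * (LINT r:{0..}|lborel. f (\<i> * of_real r))"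
    unfolding rot3 by (simp add: add_eq_0_iff)
  moreover have "pi * \<i> * (\<i> * X) = - pi * X" for X :: complex by (simp add: complex_eq_iff)
  ultimately show ?thesis unfolding step1 f_def by simp
qed

end

section \<open>Reflection to the lower half-plane\<close>

lemma has_field_derivative_cnj_cnj:
  assumes "(f has_field_derivative f') (at (cnj z))"
  shows "((\<lambda>z. cnj (f (cnj z))) has_field_derivative cnj f') (at z)"
proof -
  have "((\<lambda>w. (f w - f (cnj z)) / (w - cnj z)) \<longlongrightarrow> f') (at (cnj z))"
    using assms unfolding has_field_derivative_iff .
  moreover have "filterlim cnj (at (cnj z)) (at z)"
    unfolding filterlim_at by (auto intro!: tendsto_intros simp: eventually_at_filter)
  ultimately have "((\<lambda>w. (f (cnj w) - f (cnj z)) / (cnj w - cnj z)) \<longlongrightarrow> f') (at z)"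
    by (rule filterlim_compose)
  then have "((\<lambda>w. cnj ((f (cnj w) - f (cnj z)) / (cnj w - cnj z))) \<longlongrightarrow> cnj f') (at z)"
    by (rule tendsto_cnj)
  then show ?thesis unfolding has_field_derivative_iff by simp
qed

lemma integral_inverse_sum_squares:
  assumes x: "x > (0::real)"
  shows "integrable lborel (\<lambda>\<omega>. 1 / (x\<^sup>2 + (\<omega> - t)\<^sup>2))" and "(LBINT \<omega>. 1 / (x\<^sup>2 + (\<omega> - t)\<^sup>2)) = pi / x"
proof -
  let ?f = "\<lambda>\<omega>. 1 / (x\<^sup>2 + (\<omega> - t)\<^sup>2)"
  have eq: "?f (t + x * u) = 1 / x\<^sup>2 * (1 / (1 + u\<^sup>2))" for u
  proof -
    have "x\<^sup>2 + (t + x * u - t)\<^sup>2 = x\<^sup>2 * (1 + u\<^sup>2)" by (simp add: power2_eq_square algebra_simps)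
    then show ?thesis by simp
  qed
  have x0: "x \<noteq> 0" using x by simp
  have "integrable lborel (\<lambda>u. ?f (t + x * u))"
    unfolding eq by (intro integrable_mult_right integrable_inverse_1_plus_square_lborel)
  then show "integrable lborel ?f" using lborel_integrable_real_affine_iff[OF x0, of ?f t] by blast
  have "(LBINT \<omega>. ?f \<omega>) = \<bar>x\<bar> *\<^sub>R (LBINT u. ?f (t + x * u))" by (rule lborel_integral_real_affine[OF x0])
  also have "\<dots> = pi / x"
    unfolding eq integral_mult_right_zero integral_inverse_1_plus_square_lborel
    using x by (simp add: power2_eq_square)
  finally show "(LBINT \<omega>. ?f \<omega>) = pi / x" .
qed

context pencil
begin

text \<open>The map y to -cnj y preserves the upper half-plane and fixes the imaginary axis
  pointwise, while s to cnj s exchanges the half-planes of \<zeta>. Applied to D it replaces v by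
  -cnj v, whose imaginary part is the same, and each b by -b, so a function of the same kind
  results.\<close>

definition reflect :: "(complex \<Rightarrow> complex \<Rightarrow> complex) \<Rightarrow> complex \<Rightarrow> complex \<Rightarrow> complex" where
  "reflect F s y = cnj (F (cnj s) (- cnj y))"

lemma reflect_deriv_s:
  assumes "\<And>s y. ((\<lambda>s. F s y) has_field_derivative F' s y) (at s)"
  shows "((\<lambda>s. reflect F s y) has_field_derivative reflect F' s y) (at s)"
  unfolding reflect_def by (rule has_field_derivative_cnj_cnj) (rule assms)

lemma reflect_deriv_y:
  assumes "\<And>s y. ((\<lambda>y. F s y) has_field_derivative F' s y) (at y)"
  shows "((\<lambda>y. reflect F s y) has_field_derivative - reflect F' s y) (at y)"
proof -
  have "((\<lambda>w. F (cnj s) (- w)) has_field_derivative F' (cnj s) (- cnj y) * - 1) (at (cnj y))"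
    by (rule DERIV_chain2[OF assms]) (auto intro!: derivative_eq_intros)
  from has_field_derivative_cnj_cnj[OF this] show ?thesis unfolding reflect_def by simp
qed

lemma continuous_on_reflect:
  assumes "continuous_on UNIV (\<lambda>p. F (fst p) (snd p))"
  shows "continuous_on UNIV (\<lambda>p. reflect F (fst p) (snd p))"
proof -
  have "continuous_on UNIV (\<lambda>p :: complex \<times> complex. (cnj (fst p), - cnj (snd p)))" by (intro continuous_intros)
  from continuous_on_compose2[OF assms this] 
  have "continuous_on UNIV (\<lambda>p :: complex \<times> complex. F (cnj (fst p)) (- cnj (snd p)))" by simp
  then show ?thesis unfolding reflect_def by (intro continuous_intros)
qed

lemma reflect_roots_s:
  assumes "\<forall>s. D s (- cnj y) = prod_list (map (\<lambda>r. s - r) ls)"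
  shows "reflect D s y = prod_list (map (\<lambda>r. s - r) (map cnj ls))"
proof -
  have "cnj (prod_list (map (\<lambda>r. cnj s - r) ls)) = prod_list (map (\<lambda>r. s - r) (map cnj ls))"
    by (induction ls) auto
  then show ?thesis unfolding reflect_def using assms by simp
qed

text \<open>Every y-derivative changes sign because of y to -cnj y, whence the minus signs at
  \<open>Dy\<close>, \<open>Dsy\<close> and \<open>Dssy\<close>. In the factorization over y the n
  sign changes are absorbed into the leading coefficient.\<close>

lemma pencil_reflect: "pencil n (reflect D) (reflect Ds) (\<lambda>s y. - reflect Dy s y) (reflect Dss) (\<lambda>s y. - reflect Dsy s y)
  (\<lambda>s y. - reflect Dssy s y) (- cnj v) \<alpha> \<beta>"
proof unfold_locales
  show "0 < Im (- cnj v)" using Im_v by simp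
  fix y
  obtain ls where "length ls = n" "\<forall>s. D s (- cnj y) = prod_list (map (\<lambda>r. s - r) ls)" using roots_s by blast
  then show "\<exists>ls. length ls = n \<and> (\<forall>s. reflect D s y = prod_list (map (\<lambda>r. s - r) ls))"
    using reflect_roots_s[of y ls] by (intro exI[of _ "map cnj ls"]) simp
next
  fix s
  obtain c ls where ls: "c \<noteq> 0" "length ls = n" "\<forall>y. D (cnj s) y = c * prod_list (map (\<lambda>r. y - r) ls)" using roots_y by blast
  have *: "cnj (prod_list (map (\<lambda>r. - cnj y - r) ls)) = (-1) ^ length ls * prod_list (map (\<lambda>r. y - r) (map (\<lambda>r. - cnj r) ls))" for y ls
    by (induction ls) (auto simp: algebra_simps)
  have "reflect D s y = (cnj c * (-1) ^ n) * prod_list (map (\<lambda>r. y - r) (map (\<lambda>r. - cnj r) ls))" for y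
    unfolding reflect_def using ls(3) *[of y ls] ls(2) by simp
  moreover have "cnj c * (-1) ^ n \<noteq> 0" using ls(1) by simp
  ultimately show "\<exists>c ls. c \<noteq> 0 \<and> length ls = n \<and> (\<forall>y. reflect D s y = c * prod_list (map (\<lambda>r. y - r) ls))"
    using ls(2) by (metis length_map)
next
  fix s y
  assume "reflect D s y = 0"
  then have "D (cnj s) (- cnj y) = 0" unfolding reflect_def by simp
  then obtain a b where ab: "\<bar>a\<bar> \<le> \<alpha>" "\<bar>b\<bar> \<le> \<beta>" "cnj s = of_real a + (- cnj y) * (v - of_real b)" using zeros by blast
  have "s = of_real a + y * (- cnj v - of_real (- b))"
    using arg_cong[OF ab(3), of cnj] by (simp add: algebra_simps)
  then show "\<exists>a b. \<bar>a\<bar> \<le> \<alpha> \<and> \<bar>b\<bar> \<le> \<beta> \<and> s = of_real a + y * (- cnj v - of_real b)"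
    using ab by (intro exI[of _ a] exI[of _ "- b"]) simp
qed (intro reflect_deriv_s reflect_deriv_y D_s D_y Ds_s Ds_y Dy_s Dsy_s Dss_y DERIV_minus
     continuous_on_reflect continuous_on_minus cont_D cont_Ds cont_Dy cont_Dss cont_Dsy cont_Dssy)+

text \<open>For Im \<zeta> < 0 the identity of the reflected function at cnj \<zeta> is conjugated.
  N(s) of the reflection is the conjugate of N(s), G1 is conjugated likewise on the imaginary axis,
  and \<open>kern'\<close> is real there.\<close>

lemma pencil_identity:
  assumes \<epsilon>: "\<epsilon> > 0" and \<zeta>: "Im \<zeta> \<noteq> 0" "Re \<zeta> > \<alpha>"
  shows "(LBINT s. NI \<epsilon> s / (of_real s - \<zeta>) ^ 3)
    = - pi * (LINT r:{0..}|lborel. kern' \<epsilon> (\<i> * of_real r) * G1 \<zeta> (\<i> * of_real r))"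
proof (cases "Im \<zeta> > 0")
  case True
  then show ?thesis using pencil_identity_upper[OF \<epsilon> _ \<zeta>(2)] by blast
next
  case False
  interpret refl: pencil n "reflect D" "reflect Ds" "\<lambda>s y. - reflect Dy s y" "reflect Dss" "\<lambda>s y. - reflect Dsy s y"
    "\<lambda>s y. - reflect Dssy s y" "- cnj v" \<alpha> \<beta> by (rule pencil_reflect)
  have reflect_NI: "refl.NI \<epsilon> s = cnj (NI \<epsilon> s)" for s
  proof -
    have h: "refl.H (of_real s) (of_real y) = - cnj (H (of_real s) (- of_real y))" for y
      unfolding refl.H_def H_def by (simp add: reflect_def)
    have "refl.NI \<epsilon> s = (LBINT y. kern \<epsilon> (of_real y) * - cnj (H (of_real s) (- of_real y)))"
      unfolding refl.NI_def h ..
    also have "\<dots> = (LBINT y. kern \<epsilon> (- of_real y) * - cnj (H (of_real s) (of_real y)))"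
      using lborel_integral_real_affine[of "-1" "\<lambda>y. kern \<epsilon> (of_real y) * - cnj (H (of_real s) (- of_real y))" 0] by simp
    also have "\<dots> = (LBINT y. cnj (kern \<epsilon> (of_real y) * H (of_real s) (of_real y)))"
      unfolding kern_reflect by simp
    also have "\<dots> = cnj (NI \<epsilon> s)" unfolding NI_def by (rule Bochner_Integration.integral_cnj)
    finally show ?thesis .
  qed
  
  have reflect_G1: "refl.G1 s y = cnj (G1 (cnj s) (- cnj y))" for s y
    unfolding refl.G1_def G1_def by (simp add: reflect_def)
  from False have "Im (cnj \<zeta>) > 0" "Re (cnj \<zeta>) > \<alpha>" using \<zeta> by auto
  from refl.pencil_identity_upper[OF \<epsilon> this]
  have "(LBINT s. cnj (NI \<epsilon> s) / (of_real s - cnj \<zeta>) ^ 3)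
    = - pi * (LINT r:{0..}|lborel. kern' \<epsilon> (\<i> * of_real r) * cnj (G1 \<zeta> (\<i> * of_real r)))"
    unfolding reflect_NI reflect_G1 by simp
  from arg_cong[OF this, of cnj]
  have "(LBINT s. cnj (cnj (NI \<epsilon> s) / (of_real s - cnj \<zeta>) ^ 3))
    = - pi * (LINT r:{0..}|lborel. cnj (kern' \<epsilon> (\<i> * of_real r) * cnj (G1 \<zeta> (\<i> * of_real r))))"
    unfolding set_lebesgue_integral_def Bochner_Integration.integral_cnj[symmetric] complex_cnj_mult
    by simp
  then show ?thesis unfolding kern'_imaginary_axis by simp
qed

section \<open>Inverse Laplace transform of the identity\<close>

lemma measurable_NI [measurable]: "NI \<epsilon> \<in> borel_measurable borel"
proof -
  have [measurable]: "(\<lambda>(s, y). kern \<epsilon> (complex_of_real y) * H (of_real s) (of_real y)) \<in> borel_measurable (borel \<Otimes>\<^sub>M lborel)"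
    using measurable_H measurable_kern[of \<epsilon>] by (simp add: case_prod_unfold) measurable
  have "(\<lambda>s. LBINT y. kern \<epsilon> (complex_of_real y) * H (of_real s) (of_real y)) \<in> borel_measurable borel"
    by measurable
  then show ?thesis unfolding NI_def[abs_def] .
qed

lemma norm_NI_le:
  assumes \<epsilon>: "\<epsilon> > 0"
  shows "norm (NI \<epsilon> s) \<le> (LBINT y. (real n * V / Im v) * (1 / (1 + \<epsilon>\<^sup>2 * y\<^sup>2)))"
  unfolding NI_def
proof (rule Bochner_Integration.integral_norm_bound_integral)
  have [measurable]: "(\<lambda>y. H (of_real s) (complex_of_real y)) \<in> borel_measurable borel"
    using measurable_H measurable_compose[OF measurable_Pair1'[of s borel borel], of "\<lambda>p. H (complex_of_real (fst p)) (complex_of_real (snd p))"] by simp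
  show i: "integrable lborel (\<lambda>y. (real n * V / Im v) * (1 / (1 + \<epsilon>\<^sup>2 * y\<^sup>2)))"
    by (intro integrable_mult_right integrable_inverse_1_plus_scaled_square \<epsilon>)
  show "norm (kern \<epsilon> (of_real y) * H (of_real s) (of_real y)) \<le> (real n * V / Im v) * (1 / (1 + \<epsilon>\<^sup>2 * y\<^sup>2))" for y
    by (rule norm_kern_H_le[OF \<epsilon>])
  show "integrable lborel (\<lambda>y. kern \<epsilon> (of_real y) * H (of_real s) (of_real y))"
  proof (rule Bochner_Integration.integrable_bound[OF i])
    show "AE y in lborel. norm (kern \<epsilon> (of_real y) * H (of_real s) (of_real y)) \<le> norm ((real n * V / Im v) * (1 / (1 + \<epsilon>\<^sup>2 * y\<^sup>2)))"
      by (rule AE_I2, rule order_trans[OF norm_kern_H_le[OF \<epsilon>]], unfold real_norm_def, rule abs_ge_self)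
  qed simp
qed

text \<open>With y = i r the summand y (v - b) has real part -r Im v, independent of b and at most
  0. Hence one vertical line lies to the right of the roots for all r at once.\<close>

lemma Re_zero_imaginary_axis:
  assumes "D l (\<i> * of_real r) = 0" "r \<ge> 0"
  shows "Re l \<le> \<alpha>"
proof -
  obtain a b where ab: "\<bar>a\<bar> \<le> \<alpha>" "l = of_real a + (\<i> * of_real r) * (v - of_real b)" using zeros[OF assms(1)] by blast
  have "Re l = a - r * Im v" unfolding ab(2) by simp
  then show ?thesis using ab(1) assms(2) Im_v by (smt (verit) mult_nonneg_nonneg)
qed

text \<open>On the line Re = \<alpha> + 1 each term -1 / (s - l)^2 of G1 transforms into a multiple
  of exp l. \<open>E\<close> is described through root lists so that no matrix enters. The last
  bound is uniform in r, because the line keeps distance at least 1 from all roots; Fubini in r and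
  \<omega> rests on it.\<close>

lemma G1_imaginary_axis:
  fixes E :: "real \<Rightarrow> complex"
  assumes E: "\<And>ls. (\<forall>s. D s (\<i> * of_real r) = prod_list (map (\<lambda>l. s - l) ls)) \<Longrightarrow> E r = sum_list (map exp ls)"
    and r: "r \<ge> 0" and \<sigma>: "\<sigma> = \<alpha> + 1"
  defines "q \<equiv> \<lambda>\<omega>. exp (of_real \<sigma> + \<i> * of_real \<omega>) * G1 (of_real \<sigma> + \<i> * of_real \<omega>) (\<i> * of_real r)"
  shows "integrable lborel q" "(LBINT \<omega>. q \<omega>) = - 2 * pi * E r"
    "(LBINT \<omega>. norm (q \<omega>)) \<le> exp \<sigma> * real n * pi"
proof -
  obtain ls where ls: "length ls = n" "\<forall>s. D s (\<i> * of_real r) = prod_list (map (\<lambda>l. s - l) ls)" using roots_s by blast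
  have re: "Re l \<le> \<alpha>" if "l \<in> set ls" for l :: complex
    using Re_zero_imaginary_axis[of l r] ls(2) prod_list_diff_eq_0_iff[of l ls] that r by simp
  have nz: "D (of_real \<sigma> + \<i> * of_real \<omega>) (\<i> * of_real r) \<noteq> 0" for \<omega>
    using Re_zero_imaginary_axis[of "of_real \<sigma> + \<i> * of_real \<omega>" r] r by (auto simp: \<sigma>)
  define t where "t l \<omega> = - exp (complex_of_real \<sigma>) * (exp (\<i> * complex_of_real \<omega>) / ((of_real \<sigma> - l) + \<i> * of_real \<omega>)\<^sup>2)" for l :: complex and \<omega> :: real
  have q: "q \<omega> = sum_list (map (\<lambda>l. t l \<omega>) ls)" for \<omega>
  proof -
    have "q \<omega> = exp (of_real \<sigma> + \<i> * of_real \<omega>) * - sum_list (map (\<lambda>l. 1 / (of_real \<sigma> + \<i> * of_real \<omega> - l)\<^sup>2) ls)"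
      unfolding q_def G1_eq_sum[OF ls(2) nz] ..
    also have "\<dots> = sum_list (map (\<lambda>l. t l \<omega>) ls)"
      unfolding t_def by (induction ls) (auto simp: exp_add algebra_simps)
    finally show ?thesis .
  qed
  have t: "integrable lborel (t l)" "(LBINT \<omega>. t l \<omega>) = - 2 * pi * exp l"
    "integrable lborel (\<lambda>\<omega>. norm (t l \<omega>))" "(LBINT \<omega>. norm (t l \<omega>)) \<le> exp \<sigma> * pi" if "l \<in> set ls" for l :: complex
  proof -
    have pos: "Re (of_real \<sigma> - l) > 0" using re[OF that] by (simp add: \<sigma>)
    note il = inverse_laplace_square[OF pos]
    show 1: "integrable lborel (t l)" unfolding t_def by (intro integrable_mult_right il(1))
    then show "integrable lborel (\<lambda>\<omega>. norm (t l \<omega>))" by (rule integrable_norm)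
    have "(LBINT \<omega>. t l \<omega>) = - exp (complex_of_real \<sigma>) * (2 * pi * exp (- (of_real \<sigma> - l)))"
      unfolding t_def integral_mult_right_zero il(2) ..
    also have "\<dots> = - 2 * pi * (exp (complex_of_real \<sigma>) * exp (- (of_real \<sigma> - l)))" by simp
    also have "exp (complex_of_real \<sigma>) * exp (- (of_real \<sigma> - l)) = exp l" unfolding exp_add[symmetric] by simp
    finally show "(LBINT \<omega>. t l \<omega>) = - 2 * pi * exp l" .
    have nt: "norm (t l \<omega>) = exp \<sigma> * (1 / ((\<sigma> - Re l)\<^sup>2 + (\<omega> - Im l)\<^sup>2))" for \<omega>
    proof -
      have "(norm (of_real \<sigma> - l + \<i> * of_real \<omega>))\<^sup>2 = (\<sigma> - Re l)\<^sup>2 + (\<omega> - Im l)\<^sup>2"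
        unfolding cmod_power2 by simp
      moreover have "norm (t l \<omega>) = exp \<sigma> * (1 / (norm (of_real \<sigma> - l + \<i> * of_real \<omega>))\<^sup>2)"
        unfolding t_def norm_mult norm_divide norm_power norm_minus_cancel by simp
      ultimately show ?thesis by metis
    qed
    have pos': "\<sigma> - Re l > 0" using pos by simp
    have "(LBINT \<omega>. norm (t l \<omega>)) = exp \<sigma> * (pi / (\<sigma> - Re l))"
      unfolding nt integral_mult_right_zero integral_inverse_sum_squares(2)[OF pos'] ..
    also have "\<dots> \<le> exp \<sigma> * (pi / 1)"
      using re[OF that] by (intro mult_left_mono divide_left_mono) (auto simp: \<sigma>)
    finally show "(LBINT \<omega>. norm (t l \<omega>)) \<le> exp \<sigma> * pi" by simp
  qed
  have "integrable lborel (\<lambda>\<omega>. sum_list (map (\<lambda>l. t l \<omega>) ks)) \<and>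
     (LBINT \<omega>. sum_list (map (\<lambda>l. t l \<omega>) ks)) = - 2 * pi * sum_list (map exp ks) \<and>
     integrable lborel (\<lambda>\<omega>. sum_list (map (\<lambda>l. norm (t l \<omega>)) ks)) \<and>
     (LBINT \<omega>. sum_list (map (\<lambda>l. norm (t l \<omega>)) ks)) \<le> exp \<sigma> * real (length ks) * pi"
    if "set ks \<subseteq> set ls" for ks :: "complex list"
    using that
  proof (induction ks)
    case (Cons k ks)
    have k: "k \<in> set ls" using Cons.prems by simp
    show ?case using t[OF k] Cons by (auto simp: algebra_simps)
  qed simp
  from this[of ls] have s: "integrable lborel (\<lambda>\<omega>. sum_list (map (\<lambda>l. t l \<omega>) ls))"
     "(LBINT \<omega>. sum_list (map (\<lambda>l. t l \<omega>) ls)) = - 2 * pi * sum_list (map exp ls)"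
     "integrable lborel (\<lambda>\<omega>. sum_list (map (\<lambda>l. norm (t l \<omega>)) ls))"
     "(LBINT \<omega>. sum_list (map (\<lambda>l. norm (t l \<omega>)) ls)) \<le> exp \<sigma> * real (length ls) * pi" by auto
  show i: "integrable lborel q" using s(1) unfolding q[symmetric] .
  show "(LBINT \<omega>. q \<omega>) = - 2 * pi * E r" using s(2) unfolding q[symmetric] E[OF ls(2)] .
  have "norm (sum_list (map (\<lambda>l. t l \<omega>) ks)) \<le> sum_list (map (\<lambda>l. norm (t l \<omega>)) ks)" for \<omega> and ks :: "complex list"
    by (induction ks) (auto intro: norm_triangle_mono)
  then have "(LBINT \<omega>. norm (q \<omega>)) \<le> (LBINT \<omega>. sum_list (map (\<lambda>l. norm (t l \<omega>)) ls))"
    unfolding q[symmetric] by (intro integral_mono integrable_norm i s(3)) (simp add: q)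
  then show "(LBINT \<omega>. norm (q \<omega>)) \<le> exp \<sigma> * real n * pi" using s(4) ls(1) by simp
qed

text \<open>Both sides of \<open>pencil_identity\<close> at \<zeta> = \<open>Z \<omega>\<close> are
  multiplied by exp \<zeta> and integrated over \<omega>. By Fubini the left side becomes the
  integral of -pi N(s) exp s, whose real part is non-negative, and the right side 2 pi^2 times the
  integral in question.\<close>

lemma Re_integral_kern'_nonneg:
  fixes E :: "real \<Rightarrow> complex"
  assumes \<epsilon>: "\<epsilon> > 0"
    and E: "\<And>r ls. r \<ge> 0 \<Longrightarrow> (\<forall>s. D s (\<i> * of_real r) = prod_list (map (\<lambda>l. s - l) ls)) \<Longrightarrow> E r = sum_list (map exp ls)"
  shows "0 \<le> Re (LINT r:{0..}|lborel. kern' \<epsilon> (\<i> * of_real r) * E r)"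
proof -
  define \<sigma> where "\<sigma> = \<alpha> + 1"
  define Z where "Z \<omega> = complex_of_real \<sigma> + \<i> * of_real \<omega>" for \<omega> :: real
  \<comment> \<open>Equals N(s) almost everywhere but vanishes for every s > \<alpha>. Thus only s
    with \<open>\<sigma>\<close> - s \<ge> 1 occur, as the inverse Laplace transform of the cube
    requires.\<close>
  define NI0 where "NI0 s = (if s \<le> \<alpha> then NI \<epsilon> s else 0)" for s
  define C where "C = (LBINT y. (real n * V / Im v) * (1 / (1 + \<epsilon>\<^sup>2 * y\<^sup>2)))"
  have NI_C: "norm (NI0 s) \<le> C" for s
    using norm_NI_le[OF \<epsilon>, of s] order_trans[OF norm_ge_zero norm_NI_le[OF \<epsilon>, of s]] unfolding NI0_def C_def by auto
  have C0: "C \<ge> 0" using order_trans[OF norm_ge_zero NI_C[of 0]] .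
  have [measurable]: "NI0 \<in> borel_measurable borel" unfolding NI0_def[abs_def] by measurable
  have NI0_AE: "AE s in lborel. NI0 s = NI \<epsilon> s \<and> Re (NI0 s) \<le> 0"
    using AE_D_0
  proof eventually_elim
    case (elim s)
    then show ?case using NI_residues[OF \<epsilon> elim] unfolding NI0_def by auto
  qed
  define g where "g s \<omega> = NI0 s * (exp (Z \<omega>) / (of_real s - Z \<omega>) ^ 3)" for s \<omega> :: real
  have Zm [measurable]: "Z \<in> borel_measurable borel" unfolding Z_def[abs_def] by measurable
  have g_inner: "integrable lborel (g s)" "(LBINT \<omega>. g s \<omega>) = NI0 s * (- pi * exp (complex_of_real s))"
    "(LBINT \<omega>. norm (g s \<omega>)) \<le> C * exp \<sigma> * pi * 2 * (1 / (1 + (\<sigma> + - 1 * s)\<^sup>2))" for s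
  proof -
    have "integrable lborel (g s) \<and> (LBINT \<omega>. g s \<omega>) = NI0 s * (- pi * exp (complex_of_real s)) \<and>
      (LBINT \<omega>. norm (g s \<omega>)) \<le> C * exp \<sigma> * pi * 2 * (1 / (1 + (\<sigma> + - 1 * s)\<^sup>2))"
    proof (cases "s \<le> \<alpha>")
      case False
      then have "g s = (\<lambda>\<omega>. 0)" "NI0 s = 0" unfolding g_def[abs_def] NI0_def by auto
      then show ?thesis using C0 by simp
    next
      case True
      define x where "x = \<sigma> - s"
      have x1: "x \<ge> 1" using True by (simp add: x_def \<sigma>_def)
      have pos: "Re (of_real x) > 0" using x1 by simp
      have e: "exp (Z \<omega>) / (of_real s - Z \<omega>) ^ 3
          = - exp (complex_of_real \<sigma>) * (exp (\<i> * of_real \<omega>) / (of_real x + \<i> * of_real \<omega>) ^ 3)" for \<omega>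
      proof -
        have "(of_real s - Z \<omega>) ^ 3 = - ((of_real x + \<i> * of_real \<omega>) ^ 3)"
          unfolding Z_def x_def by (simp add: power3_eq_cube algebra_simps)
        then show ?thesis by (simp add: Z_def exp_add)
      qed
      note il = inverse_laplace_cube[OF pos]
      have i: "integrable lborel (g s)" unfolding g_def e by (intro integrable_mult_right il(1))
      have "(LBINT \<omega>. g s \<omega>) = NI0 s * (- exp (complex_of_real \<sigma>) * (pi * exp (- complex_of_real x)))"
        unfolding g_def e integral_mult_right_zero il(2) ..
      also have "\<dots> = NI0 s * (- pi * (exp (complex_of_real \<sigma>) * exp (- complex_of_real x)))" by simp
      also have "exp (complex_of_real \<sigma>) * exp (- complex_of_real x) = exp (complex_of_real s)"
        unfolding exp_add[symmetric] by (simp add: x_def)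
      finally have v: "(LBINT \<omega>. g s \<omega>) = NI0 s * (- pi * exp (complex_of_real s))" .
      have n: "norm (g s \<omega>) \<le> C * exp \<sigma> / x * (1 / (x\<^sup>2 + (\<omega> - 0)\<^sup>2))" for \<omega>
      proof -
        define m where "m = norm (of_real x + \<i> * complex_of_real \<omega>)"
        have m2: "m\<^sup>2 = x\<^sup>2 + \<omega>\<^sup>2" unfolding m_def cmod_power2 by simp
        have m1: "x \<le> m" using complex_Re_le_cmod[of "of_real x + \<i> * complex_of_real \<omega>"] unfolding m_def by simp
        have "norm (g s \<omega>) = norm (NI0 s) * (exp \<sigma> * (1 / m ^ 3))"
          unfolding g_def e norm_mult norm_divide norm_power norm_minus_cancel m_def by simp
        \<comment> \<open>One factor of |x + i \<omega>|^3 is traded for x, so that the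
          \<omega>-integral has a closed form and decays like 1 / x^2, hence integrably in
          s.\<close>
        also have "\<dots> \<le> C * (exp \<sigma> * (1 / (x * m\<^sup>2)))"
        proof (intro mult_mono NI_C C0)
          have "x * m\<^sup>2 \<le> m * m\<^sup>2" using m1 by (intro mult_right_mono) auto
          also have "\<dots> = m ^ 3" by (simp add: power2_eq_square power3_eq_cube)
          finally show "1 / m ^ 3 \<le> 1 / (x * m\<^sup>2)"
            using x1 m1 by (intro divide_left_mono) (auto intro!: mult_pos_pos)
        qed (use x1 m1 in auto)
        finally show ?thesis unfolding m2 by simp
      qed
      have xp: "x > 0" using x1 by simp
      note sq = integral_inverse_sum_squares[OF xp, of 0]
      have "(LBINT \<omega>. norm (g s \<omega>)) \<le> (LBINT \<omega>. C * exp \<sigma> / x * (1 / (x\<^sup>2 + (\<omega> - 0)\<^sup>2)))"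
        by (intro integral_mono integrable_norm i integrable_mult_right sq(1) n)
      also have "\<dots> = C * exp \<sigma> / x * (pi / x)" unfolding integral_mult_right_zero sq(2) ..
      also have "\<dots> = C * exp \<sigma> * pi * (1 / x\<^sup>2)" by (simp add: power2_eq_square)
      \<comment> \<open>Valid since x \<ge> 1; the new form is integrable over all s, as a translate
        of a known density.\<close>
      also have "\<dots> \<le> C * exp \<sigma> * pi * (2 * (1 / (1 + x\<^sup>2)))"
      proof (rule mult_left_mono)
        have "1 \<le> x\<^sup>2" using x1 by (simp add: power2_eq_square mult_ge1_I)
        then show "1 / x\<^sup>2 \<le> 2 * (1 / (1 + x\<^sup>2))" by (simp add: divide_simps)
      qed (use C0 in simp)
      finally have "(LBINT \<omega>. norm (g s \<omega>)) \<le> C * exp \<sigma> * pi * 2 * (1 / (1 + (\<sigma> + - 1 * s)\<^sup>2))"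
        unfolding x_def by simp
      then show ?thesis using i v by blast
    qed
    then show "integrable lborel (g s)" "(LBINT \<omega>. g s \<omega>) = NI0 s * (- pi * exp (complex_of_real s))"
      "(LBINT \<omega>. norm (g s \<omega>)) \<le> C * exp \<sigma> * pi * 2 * (1 / (1 + (\<sigma> + - 1 * s)\<^sup>2))" by blast+
  qed
  have gm [measurable]: "(\<lambda>p. g (fst p) (snd p)) \<in> borel_measurable (borel \<Otimes>\<^sub>M borel)"
    unfolding g_def by measurable
  have g_int: "integrable (lborel \<Otimes>\<^sub>M lborel) (\<lambda>(s, \<omega>). g s \<omega>)"
    unfolding case_prod_unfold
  proof (rule lborel_pair.Fubini_integrable)
    show "integrable lborel (\<lambda>s. LBINT \<omega>. norm (g (fst (s, \<omega>)) (snd (s, \<omega>))))"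
    proof (rule Bochner_Integration.integrable_bound)
      show "integrable lborel (\<lambda>s. C * exp \<sigma> * pi * 2 * (1 / (1 + (\<sigma> + - 1 * s)\<^sup>2)))"
        by (intro integrable_mult_right lborel_integrable_real_affine[where c = "-1", OF integrable_inverse_1_plus_square_lborel]) simp
      show "(\<lambda>s. LBINT \<omega>. norm (g (fst (s, \<omega>)) (snd (s, \<omega>)))) \<in> borel_measurable lborel"
        by measurable
      show "AE s in lborel. norm (LBINT \<omega>. norm (g (fst (s, \<omega>)) (snd (s, \<omega>))))
         \<le> norm (C * exp \<sigma> * pi * 2 * (1 / (1 + (\<sigma> + - 1 * s)\<^sup>2)))"
      proof (rule AE_I2)
        fix s
        have 1: "norm (LBINT \<omega>. norm (g s \<omega>)) = (LBINT \<omega>. norm (g s \<omega>))" by simp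
        show "norm (LBINT \<omega>. norm (g (fst (s, \<omega>)) (snd (s, \<omega>))))
         \<le> norm (C * exp \<sigma> * pi * 2 * (1 / (1 + (\<sigma> + - 1 * s)\<^sup>2)))"
          unfolding fst_conv snd_conv 1 real_norm_def[of "_ * _"] by (rule order_trans[OF g_inner(3) abs_ge_self])
      qed
    qed
    show "AE s in lborel. integrable lborel (\<lambda>\<omega>. g (fst (s, \<omega>)) (snd (s, \<omega>)))" using g_inner(1) by simp
  qed measurable
  define q where "q r \<omega> = indicator {0..} r *\<^sub>R (kern' \<epsilon> (\<i> * of_real r) * (exp (Z \<omega>) * G1 (Z \<omega>) (\<i> * of_real r)))" for r \<omega> :: real
  have q_inner: "integrable lborel (q r)"
      "(LBINT \<omega>. q r \<omega>) = indicator {0..} r *\<^sub>R (kern' \<epsilon> (\<i> * of_real r) * (- 2 * pi * E r))"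
      "(LBINT \<omega>. norm (q r \<omega>)) \<le> 2 * (exp \<sigma> * real n * pi) * (1 / (1 + \<epsilon>\<^sup>2 * r\<^sup>2))" for r
  proof -
    have "integrable lborel (q r) \<and>
      (LBINT \<omega>. q r \<omega>) = indicator {0..} r *\<^sub>R (kern' \<epsilon> (\<i> * of_real r) * (- 2 * pi * E r)) \<and>
      (LBINT \<omega>. norm (q r \<omega>)) \<le> 2 * (exp \<sigma> * real n * pi) * (1 / (1 + \<epsilon>\<^sup>2 * r\<^sup>2))"
    proof (cases "r \<ge> 0")
      case False
      then have "q r = (\<lambda>\<omega>. 0)" unfolding q_def[abs_def] by simp
      then show ?thesis using False by simp
    next
      case True
      have Er: "E r = sum_list (map exp ls)" if "\<forall>s. D s (\<i> * of_real r) = prod_list (map (\<lambda>l. s - l) ls)" for ls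
        by (rule E[OF True that])
      note G = G1_imaginary_axis[of r E, OF Er True \<sigma>_def, folded Z_def]
      have qr: "q r = (\<lambda>\<omega>. kern' \<epsilon> (\<i> * of_real r) * (exp (Z \<omega>) * G1 (Z \<omega>) (\<i> * of_real r)))"
        unfolding q_def[abs_def] using True by simp
      have k: "norm (kern' \<epsilon> (\<i> * of_real r)) \<le> 2 / (1 + \<epsilon>\<^sup>2 * r\<^sup>2)"
        using norm_kern'_le[OF \<epsilon>, of "\<i> * of_real r"] True by (simp add: norm_mult)
      have "(LBINT \<omega>. norm (q r \<omega>)) = norm (kern' \<epsilon> (\<i> * of_real r)) * (LBINT \<omega>. norm (exp (Z \<omega>) * G1 (Z \<omega>) (\<i> * of_real r)))"
        unfolding qr norm_mult[of "kern' \<epsilon> (\<i> * of_real r)"] integral_mult_right_zero ..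
      also have "\<dots> \<le> 2 / (1 + \<epsilon>\<^sup>2 * r\<^sup>2) * (exp \<sigma> * real n * pi)"
        by (rule mult_mono[OF k G(3)]) (auto simp: add_nonneg_nonneg)
      also have "\<dots> = 2 * (exp \<sigma> * real n * pi) * (1 / (1 + \<epsilon>\<^sup>2 * r\<^sup>2))" by simp
      finally have 3: "(LBINT \<omega>. norm (q r \<omega>)) \<le> 2 * (exp \<sigma> * real n * pi) * (1 / (1 + \<epsilon>\<^sup>2 * r\<^sup>2))" .
      have 1: "integrable lborel (q r)" unfolding qr by (intro integrable_mult_right G(1))
      have 2: "(LBINT \<omega>. q r \<omega>) = kern' \<epsilon> (\<i> * of_real r) * (- 2 * pi * E r)"
      proof -
        have "(LBINT \<omega>. exp (Z \<omega>) * G1 (Z \<omega>) (\<i> * of_real r)) = - 2 * pi * E r" using G(2) by simp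
        then show ?thesis unfolding qr integral_mult_right_zero by simp
      qed
      show ?thesis using 1 2 3 True by simp
    qed
    then show "integrable lborel (q r)"
      "(LBINT \<omega>. q r \<omega>) = indicator {0..} r *\<^sub>R (kern' \<epsilon> (\<i> * of_real r) * (- 2 * pi * E r))"
      "(LBINT \<omega>. norm (q r \<omega>)) \<le> 2 * (exp \<sigma> * real n * pi) * (1 / (1 + \<epsilon>\<^sup>2 * r\<^sup>2))" by blast+
  qed
  have mF: "(\<lambda>p. F (Z (snd p)) (\<i> * complex_of_real (fst p))) \<in> borel_measurable (borel \<Otimes>\<^sub>M borel)"
    if "continuous_on UNIV (\<lambda>p. F (fst p) (snd p) :: complex)" for F
  proof -
    have "continuous_on UNIV (\<lambda>p :: real \<times> real. (Z (snd p), \<i> * complex_of_real (fst p)))"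
      unfolding Z_def by (intro continuous_intros)
    from continuous_on_compose2[OF that this]
    have "continuous_on UNIV (\<lambda>p :: real \<times> real. F (Z (snd p)) (\<i> * complex_of_real (fst p)))" by simp
    then show ?thesis unfolding borel_prod by (rule borel_measurable_continuous_onI)
  qed
  note [measurable] = mF[OF cont_D] mF[OF cont_Ds] mF[OF cont_Dss]
  have qm [measurable]: "(\<lambda>p. q (fst p) (snd p)) \<in> borel_measurable (borel \<Otimes>\<^sub>M borel)"
    unfolding q_def kern'_def G1_def by measurable
  have q_int: "integrable (lborel \<Otimes>\<^sub>M lborel) (\<lambda>(r, \<omega>). q r \<omega>)"
    unfolding case_prod_unfold
  proof (rule lborel_pair.Fubini_integrable)
    show "integrable lborel (\<lambda>r. LBINT \<omega>. norm (q (fst (r, \<omega>)) (snd (r, \<omega>))))"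
    proof (rule Bochner_Integration.integrable_bound)
      show "integrable lborel (\<lambda>r. 2 * (exp \<sigma> * real n * pi) * (1 / (1 + \<epsilon>\<^sup>2 * r\<^sup>2)))"
        by (intro integrable_mult_right integrable_inverse_1_plus_scaled_square \<epsilon>)
      show "(\<lambda>r. LBINT \<omega>. norm (q (fst (r, \<omega>)) (snd (r, \<omega>)))) \<in> borel_measurable lborel"
        by measurable
      show "AE r in lborel. norm (LBINT \<omega>. norm (q (fst (r, \<omega>)) (snd (r, \<omega>))))
         \<le> norm (2 * (exp \<sigma> * real n * pi) * (1 / (1 + \<epsilon>\<^sup>2 * r\<^sup>2)))"
      proof (rule AE_I2)
        fix r
        have 1: "norm (LBINT \<omega>. norm (q r \<omega>)) = (LBINT \<omega>. norm (q r \<omega>))" by simp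
        show "norm (LBINT \<omega>. norm (q (fst (r, \<omega>)) (snd (r, \<omega>))))
         \<le> norm (2 * (exp \<sigma> * real n * pi) * (1 / (1 + \<epsilon>\<^sup>2 * r\<^sup>2)))"
          unfolding fst_conv snd_conv 1 real_norm_def[of "_ * _"] by (rule order_trans[OF q_inner(3) abs_ge_self])
      qed
    qed
    show "AE r in lborel. integrable lborel (\<lambda>\<omega>. q (fst (r, \<omega>)) (snd (r, \<omega>)))" using q_inner(1) by simp
  qed measurable
  have link: "(LBINT s. g s \<omega>) = - pi * (LBINT r. q r \<omega>)" if "\<omega> \<noteq> 0" for \<omega>
  proof -
    have "(LBINT s. g s \<omega>) = (LBINT s. exp (Z \<omega>) * (NI \<epsilon> s / (of_real s - Z \<omega>) ^ 3))"
    proof (rule integral_cong_AE)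
      show "AE s in lborel. g s \<omega> = exp (Z \<omega>) * (NI \<epsilon> s / (of_real s - Z \<omega>) ^ 3)"
        using NI0_AE by eventually_elim (simp add: g_def)
    qed (simp_all add: g_def[abs_def])
    also have "\<dots> = exp (Z \<omega>) * (LBINT s. NI \<epsilon> s / (of_real s - Z \<omega>) ^ 3)" by (rule integral_mult_right_zero)
    also have "(LBINT s. NI \<epsilon> s / (of_real s - Z \<omega>) ^ 3)
        = - pi * (LINT r:{0..}|lborel. kern' \<epsilon> (\<i> * of_real r) * G1 (Z \<omega>) (\<i> * of_real r))"
      by (rule pencil_identity[OF \<epsilon>]) (use that in \<open>auto simp: Z_def \<sigma>_def\<close>)
    also have "exp (Z \<omega>) * (- pi * (LINT r:{0..}|lborel. kern' \<epsilon> (\<i> * of_real r) * G1 (Z \<omega>) (\<i> * of_real r)))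
        = - pi * (LINT r:{0..}|lborel. exp (Z \<omega>) * (kern' \<epsilon> (\<i> * of_real r) * G1 (Z \<omega>) (\<i> * of_real r)))"
      unfolding set_integral_mult_right by simp
    also have "\<dots> = - pi * (LBINT r. q r \<omega>)"
      unfolding set_lebesgue_integral_def q_def by (simp add: mult_ac)
    finally show ?thesis .
  qed
  have "(LBINT s. NI0 s * (- pi * exp (complex_of_real s))) = (LBINT s. LBINT \<omega>. g s \<omega>)" unfolding g_inner(2) ..
  also have "\<dots> = (LBINT \<omega>. LBINT s. g s \<omega>)" by (rule lborel_pair.Fubini_integral[OF g_int, symmetric])
  also have "\<dots> = (LBINT \<omega>. - pi * (LBINT r. q r \<omega>))"
  proof (rule integral_cong_AE)
    show "AE \<omega> in lborel. (LBINT s. g s \<omega>) = - pi * (LBINT r. q r \<omega>)"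
      using AE_lborel_singleton[of 0] by eventually_elim (rule link)
    show "(\<lambda>\<omega>. LBINT s. g s \<omega>) \<in> borel_measurable lborel" "(\<lambda>\<omega>. - pi * (LBINT r. q r \<omega>)) \<in> borel_measurable lborel"
      using lborel_pair.integrable_snd[OF g_int] lborel_pair.integrable_snd[OF q_int] by (auto dest: borel_measurable_integrable)
  qed
  also have "\<dots> = - pi * (LBINT \<omega>. LBINT r. q r \<omega>)" by (rule integral_mult_right_zero)
  also have "(LBINT \<omega>. LBINT r. q r \<omega>) = (LBINT r. LBINT \<omega>. q r \<omega>)" by (rule lborel_pair.Fubini_integral[OF q_int])
  also have "\<dots> = (LBINT r. - 2 * pi * (indicator {0..} r *\<^sub>R (kern' \<epsilon> (\<i> * of_real r) * E r)))"
    unfolding q_inner(2) by (simp add: mult_ac)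
  also have "\<dots> = - 2 * pi * (LINT r:{0..}|lborel. kern' \<epsilon> (\<i> * of_real r) * E r)"
    unfolding set_lebesgue_integral_def by (rule integral_mult_right_zero)
  finally have eq: "(LBINT s. NI0 s * (- pi * exp (complex_of_real s)))
      = - pi * (- 2 * pi * (LINT r:{0..}|lborel. kern' \<epsilon> (\<i> * of_real r) * E r))" .
  have int: "integrable lborel (\<lambda>s. NI0 s * (- pi * exp (complex_of_real s)))"
    using lborel_pair.integrable_fst[OF g_int] unfolding g_inner(2) .
  have "0 \<le> (LBINT s. Re (NI0 s * (- pi * exp (complex_of_real s))))"
  proof (rule integral_nonneg_AE)
    show "AE s in lborel. 0 \<le> Re (NI0 s * (- pi * exp (complex_of_real s)))"
      using NI0_AE
    proof eventually_elim
      case (elim s)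
      have "exp (complex_of_real s) = of_real (exp s)" by (simp add: exp_of_real)
      then have "Re (NI0 s * (- pi * exp (complex_of_real s))) = (- Re (NI0 s)) * (pi * exp s)" by simp
      moreover have "0 \<le> (- Re (NI0 s)) * (pi * exp s)" using elim by (intro mult_nonneg_nonneg) auto
      ultimately show ?case by simp
    qed
  qed
  also have "\<dots> = Re (LBINT s. NI0 s * (- pi * exp (complex_of_real s)))" by (rule integral_Re[OF int])
  also have "\<dots> = 2 * pi * pi * Re (LINT r:{0..}|lborel. kern' \<epsilon> (\<i> * of_real r) * E r)"
    unfolding eq by simp
  finally have "0 \<le> 2 * pi * pi * Re (LINT r:{0..}|lborel. kern' \<epsilon> (\<i> * of_real r) * E r)" .
  moreover have "0 < 2 * pi * pi" by simp
  ultimately show ?thesis by (metis zero_le_mult_iff not_less)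
qed

text \<open>Dominated convergence for \<epsilon> = 1 / (m + 1): on the imaginary axis
  \<open>kern'\<close> tends to 1 and has modulus |1 - x| / (1 + x)^3 \<le> 1 with x = \<epsilon> r,
  so |E| itself is the majorant.\<close>

lemma Re_integral_exp_roots_nonneg:
  fixes E :: "real \<Rightarrow> complex"
  assumes E: "\<And>r ls. r \<ge> 0 \<Longrightarrow> (\<forall>s. D s (\<i> * of_real r) = prod_list (map (\<lambda>l. s - l) ls)) \<Longrightarrow> E r = sum_list (map exp ls)"
    and int: "set_integrable lborel {0..} E"
  shows "0 \<le> Re (LINT r:{0..}|lborel. E r)"
proof -
  let ?e = "\<lambda>m. 1 / (real m + 1)"
  have e: "?e m > 0" for m by simp
  have "(\<lambda>m. LBINT r. indicator {0..} r *\<^sub>R (kern' (?e m) (\<i> * of_real r) * E r)) \<longlonglongrightarrow> (LBINT r. indicator {0..} r *\<^sub>R E r)"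
  proof (rule integral_dominated_convergence[where w = "\<lambda>r. norm (indicator {0..} r *\<^sub>R E r)"])
    have iE: "integrable lborel (\<lambda>r. indicator {0..} r *\<^sub>R E r)" using int unfolding set_integrable_def .
    then show "integrable lborel (\<lambda>r. norm (indicator {0..} r *\<^sub>R E r))" by (rule integrable_norm)
    have mE [measurable]: "(\<lambda>r. indicator {0..} r *\<^sub>R E r) \<in> borel_measurable borel" using iE by auto
    show "(\<lambda>r. indicator {0..} r *\<^sub>R E r) \<in> borel_measurable lborel" by simp
    show "(\<lambda>r. indicator {0..} r *\<^sub>R (kern' (?e m) (\<i> * of_real r) * E r)) \<in> borel_measurable lborel" for m
    proof -
      have "(\<lambda>r. kern' (?e m) (\<i> * of_real r) * (indicator {0..} r *\<^sub>R E r)) \<in> borel_measurable borel"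
        unfolding kern'_def by measurable
      then show ?thesis by simp
    qed
    show "AE r in lborel. norm (indicator {0..} r *\<^sub>R (kern' (?e m) (\<i> * of_real r) * E r)) \<le> norm (indicator {0..} r *\<^sub>R E r)" for m
    proof (rule AE_I2)
      fix r :: real
      show "norm (indicator {0..} r *\<^sub>R (kern' (?e m) (\<i> * of_real r) * E r)) \<le> norm (indicator {0..} r *\<^sub>R E r)"
      proof (cases "r \<ge> 0")
        case True
        define x where "x = ?e m * r"
        have x: "x \<ge> 0" using True by (simp add: x_def)
        have "\<bar>1 - x\<bar> \<le> (1 + x) ^ 1" using x by simp
        also have "\<dots> \<le> (1 + x) ^ 3" using x by (intro power_increasing) auto
        finally have "norm (kern' (?e m) (\<i> * of_real r)) \<le> 1"
          unfolding kern'_imaginary_axis norm_of_real x_def[symmetric] using x by (simp add: abs_mult)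
        then have "norm (kern' (?e m) (\<i> * of_real r)) * norm (E r) \<le> 1 * norm (E r)"
          by (intro mult_right_mono) auto
        then show ?thesis using True by (simp add: norm_mult)
      qed simp
    qed
    show "AE r in lborel. (\<lambda>m. indicator {0..} r *\<^sub>R (kern' (?e m) (\<i> * of_real r) * E r)) \<longlonglongrightarrow> indicator {0..} r *\<^sub>R E r"
    proof (rule AE_I2)
      fix r :: real
      have "?e \<longlonglongrightarrow> 0" using lim_inverse_n'[THEN LIMSEQ_Suc] by (simp add: add.commute)
      then have "(\<lambda>m. (1 - ?e m * r) / (1 + ?e m * r) ^ 3) \<longlonglongrightarrow> (1 - 0 * r) / (1 + 0 * r) ^ 3"
        by (intro tendsto_intros) auto
      then have "(\<lambda>m. kern' (?e m) (\<i> * of_real r)) \<longlonglongrightarrow> of_real ((1 - 0 * r) / (1 + 0 * r) ^ 3)"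
        unfolding kern'_imaginary_axis by (rule tendsto_of_real)
      then have "(\<lambda>m. indicator {0..} r *\<^sub>R (kern' (?e m) (\<i> * of_real r) * E r)) \<longlonglongrightarrow> indicator {0..} r *\<^sub>R (of_real ((1 - 0 * r) / (1 + 0 * r) ^ 3) * E r)"
        by (intro tendsto_intros)
      then show "(\<lambda>m. indicator {0..} r *\<^sub>R (kern' (?e m) (\<i> * of_real r) * E r)) \<longlonglongrightarrow> indicator {0..} r *\<^sub>R E r" by simp
    qed
  qed
  then have "(\<lambda>m. Re (LBINT r. indicator {0..} r *\<^sub>R (kern' (?e m) (\<i> * of_real r) * E r))) \<longlonglongrightarrow> Re (LBINT r. indicator {0..} r *\<^sub>R E r)"
    by (rule tendsto_Re)
  moreover have "0 \<le> Re (LBINT r. indicator {0..} r *\<^sub>R (kern' (?e m) (\<i> * of_real r) * E r))" for m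
    using Re_integral_kern'_nonneg[OF e[of m] E] unfolding set_lebesgue_integral_def by simp
  ultimately have "0 \<le> Re (LBINT r. indicator {0..} r *\<^sub>R E r)"
    by (meson LIMSEQ_le_const)
  then show ?thesis unfolding set_lebesgue_integral_def .
qed

end

section \<open>Exponential transforms of measures\<close>

lemma exp_minus_le_inverse_square:
  assumes "x \<ge> (0::real)" shows "exp (- x) \<le> 1 / (1 + (x / 2)\<^sup>2)"
proof -
  have "1 + (x / 2)\<^sup>2 \<le> (1 + x / 2)\<^sup>2" using assms by (simp add: power2_eq_square algebra_simps)
  also have "\<dots> \<le> (exp (x / 2))\<^sup>2" using assms by (intro power_mono exp_ge_add_one_self) auto
  also have "\<dots> = exp x" by (simp flip: exp_double)
  finally have le: "1 + (x / 2)\<^sup>2 \<le> exp x" .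
  have "exp (- x) = 1 / exp x" by (simp add: exp_minus inverse_eq_divide)
  also have "\<dots> \<le> 1 / (1 + (x / 2)\<^sup>2)" using le by (intro divide_left_mono) (auto simp: add_pos_nonneg)
  finally show ?thesis .
qed

lemma integrable_exp_decay:
  assumes "\<delta> > 0" shows "integrable lborel (\<lambda>r::real. indicator {0..} r * exp (- \<delta> * r))"
proof (rule Bochner_Integration.integrable_bound)
  have d: "\<delta> / 2 > 0" using assms by simp
  show "integrable lborel (\<lambda>r. 1 / (1 + (\<delta> / 2)\<^sup>2 * r\<^sup>2))" by (rule integrable_inverse_1_plus_scaled_square[OF d])
  show "AE r in lborel. norm (indicator {0..} r * exp (- \<delta> * r)) \<le> norm (1 / (1 + (\<delta> / 2)\<^sup>2 * r\<^sup>2))"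
  proof (rule AE_I2)
    fix r :: real
    have "exp (- \<delta> * r) \<le> 1 / (1 + (\<delta> / 2)\<^sup>2 * r\<^sup>2)" if "r \<ge> 0"
      using exp_minus_le_inverse_square[of "\<delta> * r"] that assms by (simp add: power_mult_distrib power_divide)
    then show "norm (indicator {0..} r * exp (- \<delta> * r)) \<le> norm (1 / (1 + (\<delta> / 2)\<^sup>2 * r\<^sup>2))"
      by (auto simp: indicator_def)
  qed
qed simp

lemma integrable_gaussian:
  assumes "\<sigma> > 0" shows "integrable lborel (\<lambda>r::real. exp (- (\<sigma> * r)\<^sup>2 / 2))"
proof (rule Bochner_Integration.integrable_bound)
  have d: "\<sigma> / 2 > 0" using assms by simp
  show "integrable lborel (\<lambda>r. 1 / (1 + (\<sigma> / 2)\<^sup>2 * r\<^sup>2))" by (rule integrable_inverse_1_plus_scaled_square[OF d])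
  show "AE r in lborel. norm (exp (- (\<sigma> * r)\<^sup>2 / 2)) \<le> norm (1 / (1 + (\<sigma> / 2)\<^sup>2 * r\<^sup>2))"
  proof (rule AE_I2)
    fix r :: real
    define x where "x = (\<sigma> * r)\<^sup>2 / 2"
    have x: "(\<sigma> / 2)\<^sup>2 * r\<^sup>2 \<le> x" by (simp add: x_def power_mult_distrib power_divide)
    have pos: "0 < 1 + (\<sigma> / 2)\<^sup>2 * r\<^sup>2" by (simp add: add_pos_nonneg)
    have "1 + (\<sigma> / 2)\<^sup>2 * r\<^sup>2 \<le> exp x" using x exp_ge_add_one_self[of x] by linarith
    then have "1 / exp x \<le> 1 / (1 + (\<sigma> / 2)\<^sup>2 * r\<^sup>2)" using pos by (intro divide_left_mono) auto
    moreover have "exp (- (\<sigma> * r)\<^sup>2 / 2) = 1 / exp x" by (simp add: x_def exp_minus inverse_eq_divide)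
    ultimately show "norm (exp (- (\<sigma> * r)\<^sup>2 / 2)) \<le> norm (1 / (1 + (\<sigma> / 2)\<^sup>2 * r\<^sup>2))" using pos by simp
  qed
qed simp

lemma std_normal_char:
  "(CLINT x|std_normal_distribution. iexp (t * x)) = of_real (exp (- t\<^sup>2 / 2))"
  using fun_cong[OF char_std_normal_distribution, of t] unfolding char_def by simp

lemma std_normal_fourier:
  "(CLBINT x. iexp (t * x) * of_real (exp (- x\<^sup>2 / 2))) = of_real (sqrt (2 * pi) * exp (- t\<^sup>2 / 2))"
proof -
  have "(CLINT x|std_normal_distribution. iexp (t * x)) = (CLBINT x. std_normal_density x *\<^sub>R iexp (t * x))"
    by (intro integral_density) auto
  also have "\<dots> = (CLBINT x. of_real (1 / sqrt (2 * pi)) * (iexp (t * x) * of_real (exp (- x\<^sup>2 / 2))))"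
    by (rule Bochner_Integration.integral_cong) (auto simp: std_normal_density_def scaleR_conv_of_real)
  also have "\<dots> = of_real (1 / sqrt (2 * pi)) * (CLBINT x. iexp (t * x) * of_real (exp (- x\<^sup>2 / 2)))"
    by (rule integral_mult_right_zero)
  finally have "of_real (exp (- t\<^sup>2 / 2)) = of_real (1 / sqrt (2 * pi)) * (CLBINT x. iexp (t * x) * of_real (exp (- x\<^sup>2 / 2)))"
    unfolding std_normal_char .
  then have "of_real (sqrt (2 * pi)) * complex_of_real (exp (- t\<^sup>2 / 2)) = (of_real (sqrt (2 * pi)) * of_real (1 / sqrt (2 * pi))) * (CLBINT x. iexp (t * x) * of_real (exp (- x\<^sup>2 / 2)))"
    by (simp only: mult.assoc)
  also have "of_real (sqrt (2 * pi)) * of_real (1 / sqrt (2 * pi)) = (1 :: complex)" by simp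
  finally show ?thesis by simp
qed

text \<open>The hypothesis holds for every \<theta>, so it may be averaged over \<theta> + \<sigma>
  x with x standard normal. The characteristic function of x produces the factor exp (- (\<sigma>
  r)^2 / 2), which ensures integrability by itself and allows \<delta> to tend to 0.\<close>

lemma poisson_imp_gaussian_positivity:
  fixes h :: "real \<Rightarrow> complex"
  assumes [measurable]: "h \<in> borel_measurable borel" and K: "\<And>r. norm (h r) \<le> K"
    and pos: "\<And>\<theta> \<delta>. \<delta> > 0 \<Longrightarrow> 0 \<le> Re (LINT r:{0..}|lborel. iexp (r * \<theta>) * of_real (exp (- \<delta> * r)) * h r)"
    and \<sigma>: "\<sigma> > 0"
  shows "0 \<le> Re (LINT r:{0..}|lborel. iexp (r * \<theta>) * of_real (exp (- (\<sigma> * r)\<^sup>2 / 2)) * h r)"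
proof -
  have K0: "K \<ge> 0" using order_trans[OF norm_ge_zero K[of 0]] .
  have A: "0 \<le> Re (LBINT r. indicator {0..} r *\<^sub>R (iexp (r * \<theta>) * of_real (exp (- (\<sigma> * r)\<^sup>2 / 2)) * of_real (exp (- \<delta> * r)) * h r))"
    if \<delta>: "\<delta> > 0" for \<delta>
  proof -
    interpret N: prob_space std_normal_distribution by (rule prob_space_normal_density) simp
    interpret P: pair_sigma_finite std_normal_distribution lborel ..
    define f where "f x r = indicator {0..} r *\<^sub>R (iexp (r * (\<theta> + \<sigma> * x)) * of_real (exp (- \<delta> * r)) * h r)" for x r :: real
    have fm [measurable]: "(\<lambda>p. f (fst p) (snd p)) \<in> borel_measurable (borel \<Otimes>\<^sub>M borel)" unfolding f_def by measurable
    have bd: "norm (f x r) \<le> K * (indicator {0..} r * exp (- \<delta> * r))" for x r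
      using K[of r] unfolding f_def by (auto simp: indicator_def norm_mult)
    have ib: "integrable lborel (\<lambda>r. K * (indicator {0..} r * exp (- \<delta> * r)))"
      by (intro integrable_mult_right integrable_exp_decay \<delta>)
    have fx: "integrable lborel (f x)" for x
    proof (rule Bochner_Integration.integrable_bound[OF ib])
      show "f x \<in> borel_measurable lborel" unfolding f_def[abs_def] by measurable
      show "AE r in lborel. norm (f x r) \<le> norm (K * (indicator {0..} r * exp (- \<delta> * r)))"
        by (rule AE_I2, rule order_trans[OF bd], unfold real_norm_def, rule abs_ge_self)
    qed
    have int: "integrable (std_normal_distribution \<Otimes>\<^sub>M lborel) (\<lambda>(x, r). f x r)"
      unfolding case_prod_unfold
    proof (rule P.Fubini_integrable)
      show "(\<lambda>p. f (fst p) (snd p)) \<in> borel_measurable (std_normal_distribution \<Otimes>\<^sub>M lborel)" by measurable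
      show "AE x in std_normal_distribution. integrable lborel (\<lambda>r. f (fst (x, r)) (snd (x, r)))" using fx by simp
      show "integrable std_normal_distribution (\<lambda>x. LBINT r. norm (f (fst (x, r)) (snd (x, r))))"
      proof (rule N.integrable_const_bound)
        show "AE x in std_normal_distribution. norm (LBINT r. norm (f (fst (x, r)) (snd (x, r)))) \<le> (LBINT r. K * (indicator {0..} r * exp (- \<delta> * r)))"
        proof (rule AE_I2)
          fix x
          have "(LBINT r. norm (f x r)) \<le> (LBINT r. K * (indicator {0..} r * exp (- \<delta> * r)))"
            by (intro integral_mono integrable_norm fx ib bd)
          then show "norm (LBINT r. norm (f (fst (x, r)) (snd (x, r)))) \<le> (LBINT r. K * (indicator {0..} r * exp (- \<delta> * r)))" by simp
        qed
      qed measurable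
    qed
    have innerN: "(\<integral>x. f x r \<partial>std_normal_distribution) = indicator {0..} r *\<^sub>R (iexp (r * \<theta>) * of_real (exp (- (\<sigma> * r)\<^sup>2 / 2)) * of_real (exp (- \<delta> * r)) * h r)" for r
    proof -
      have "f x r = (indicator {0..} r *\<^sub>R (iexp (r * \<theta>) * of_real (exp (- \<delta> * r)) * h r)) * iexp ((\<sigma> * r) * x)" for x
        unfolding f_def by (simp add: exp_add algebra_simps)
      then have "(\<integral>x. f x r \<partial>std_normal_distribution)
         = (indicator {0..} r *\<^sub>R (iexp (r * \<theta>) * of_real (exp (- \<delta> * r)) * h r)) * (\<integral>x. iexp ((\<sigma> * r) * x) \<partial>std_normal_distribution)"
        by (simp only: integral_mult_right_zero)
      then show ?thesis unfolding std_normal_char by simp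
    qed
    have "0 \<le> (\<integral>x. Re (LBINT r. f x r) \<partial>std_normal_distribution)"
    proof (rule integral_nonneg_AE, rule AE_I2)
      fix x
      show "0 \<le> Re (LBINT r. f x r)" using pos[OF \<delta>, of "\<theta> + \<sigma> * x"] unfolding f_def set_lebesgue_integral_def .
    qed
    also have "\<dots> = Re (\<integral>x. (LBINT r. f x r) \<partial>std_normal_distribution)"
      by (rule integral_Re[OF P.integrable_fst[OF int]])
    also have "(\<integral>x. (LBINT r. f x r) \<partial>std_normal_distribution) = (LBINT r. (\<integral>x. f x r \<partial>std_normal_distribution))"
      by (rule P.Fubini_integral[OF int, symmetric])
    also have "\<dots> = (LBINT r. indicator {0..} r *\<^sub>R (iexp (r * \<theta>) * of_real (exp (- (\<sigma> * r)\<^sup>2 / 2)) * of_real (exp (- \<delta> * r)) * h r))"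
      unfolding innerN ..
    finally show ?thesis .
  qed
  let ?d = "\<lambda>m. 1 / (real m + 1)"
  let ?G = "\<lambda>r. indicator {0..} r *\<^sub>R (iexp (r * \<theta>) * of_real (exp (- (\<sigma> * r)\<^sup>2 / 2)) * h r)"
  let ?F = "\<lambda>m r. indicator {0..} r *\<^sub>R (iexp (r * \<theta>) * of_real (exp (- (\<sigma> * r)\<^sup>2 / 2)) * of_real (exp (- ?d m * r)) * h r)"
  have "(\<lambda>m. LBINT r. ?F m r) \<longlonglongrightarrow> (LBINT r. ?G r)"
  proof (rule integral_dominated_convergence[where w = "\<lambda>r. K * exp (- (\<sigma> * r)\<^sup>2 / 2)"])
    show "integrable lborel (\<lambda>r. K * exp (- (\<sigma> * r)\<^sup>2 / 2))" by (intro integrable_mult_right integrable_gaussian \<sigma>)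
    show "AE r in lborel. norm (?F m r) \<le> K * exp (- (\<sigma> * r)\<^sup>2 / 2)" for m
    proof (rule AE_I2)
      fix r :: real
      show "norm (?F m r) \<le> K * exp (- (\<sigma> * r)\<^sup>2 / 2)"
      proof (cases "r \<ge> 0")
        case True
        have "norm (?F m r) = exp (- (\<sigma> * r)\<^sup>2 / 2) * (exp (- ?d m * r) * norm (h r))" using True by (simp add: norm_mult)
        also have "\<dots> \<le> exp (- (\<sigma> * r)\<^sup>2 / 2) * (1 * K)"
          using True K by (intro mult_left_mono mult_mono) auto
        finally show ?thesis by (simp add: mult.commute)
      qed (use K0 in simp)
    qed
    show "AE r in lborel. (\<lambda>m. ?F m r) \<longlonglongrightarrow> ?G r"
    proof (rule AE_I2)
      fix r :: real
      have "?d \<longlonglongrightarrow> 0" using lim_inverse_n'[THEN LIMSEQ_Suc] by (simp add: add.commute)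
      then have t: "(\<lambda>m. complex_of_real (exp (- ?d m * r))) \<longlonglongrightarrow> of_real (exp (- 0 * r))"
        by (intro tendsto_intros)
      have "(\<lambda>m. ?F m r) \<longlonglongrightarrow> indicator {0..} r *\<^sub>R (iexp (r * \<theta>) * of_real (exp (- (\<sigma> * r)\<^sup>2 / 2)) * of_real (exp (- 0 * r)) * h r)"
        by (intro tendsto_mult tendsto_scaleR tendsto_const t)
      then show "(\<lambda>m. ?F m r) \<longlonglongrightarrow> ?G r" by simp
    qed
  qed measurable
  then have "(\<lambda>m. Re (LBINT r. ?F m r)) \<longlonglongrightarrow> Re (LBINT r. ?G r)" by (rule tendsto_Re)
  moreover have "0 \<le> Re (LBINT r. ?F m r)" for m by (rule A) simp
  ultimately have "0 \<le> Re (LBINT r. ?G r)"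
    by (meson LIMSEQ_le_const)
  then show ?thesis unfolding set_lebesgue_integral_def .
qed

text \<open>Fourier inversion at 0 presupposes that p is integrable, which is part of the claim.
  Damping p by a Gaussian makes Fubini legitimate; the damped integral is an average of g over a
  shrinking normal distribution and tends to g 0. Since p \<ge> 0, monotone convergence then removes
  the damping.\<close>

lemma integral_nonneg_fourier_transform:
  fixes g :: "real \<Rightarrow> complex" and p :: "real \<Rightarrow> real"
  assumes g: "integrable lborel g" and cont: "continuous_on UNIV g" and bd: "\<And>r. norm (g r) \<le> K"
    and p: "\<And>\<theta>. of_real (p \<theta>) = (CLBINT r. iexp (- (r * \<theta>)) * g r) / (2 * pi)" and p0: "\<And>\<theta>. p \<theta> \<ge> 0"
    and [measurable]: "p \<in> borel_measurable borel"
  shows "integrable lborel p" and "of_real (LBINT \<theta>. p \<theta>) = g 0"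
proof -
  have gm [measurable]: "g \<in> borel_measurable borel" using g by auto
  let ?\<eta> = "\<lambda>m. 1 / (real m + 1)"
  have step: "integrable lborel (\<lambda>\<theta>. p \<theta> * exp (- (\<eta> * \<theta>)\<^sup>2 / 2))"
    "of_real (LBINT \<theta>. p \<theta> * exp (- (\<eta> * \<theta>)\<^sup>2 / 2)) = (CLBINT x. g (\<eta> * x) * of_real (exp (- x\<^sup>2 / 2))) / sqrt (2 * pi)"
    if \<eta>: "\<eta> > 0" for \<eta>
  proof -
    define f where "f \<theta> r = iexp (- (r * \<theta>)) * g r * of_real (exp (- (\<eta> * \<theta>)\<^sup>2 / 2))" for \<theta> r :: real
    have int: "integrable (lborel \<Otimes>\<^sub>M lborel) (\<lambda>p. f (fst p) (snd p))"
    proof (rule integrable_pair_product_bound)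
      show "(\<lambda>p. f (fst p) (snd p)) \<in> borel_measurable (borel \<Otimes>\<^sub>M borel)" unfolding f_def by measurable
      show "integrable lborel (\<lambda>\<theta>. exp (- (\<eta> * \<theta>)\<^sup>2 / 2))" by (rule integrable_gaussian[OF \<eta>])
      show "integrable lborel (\<lambda>r. norm (g r))" using g by (rule integrable_norm)
      show "norm (f (fst (\<theta>, r)) (snd (\<theta>, r))) \<le> exp (- (\<eta> * \<theta>)\<^sup>2 / 2) * norm (g r)" for \<theta> r
        unfolding f_def by (simp add: norm_mult)
    qed
    then have int': "integrable (lborel \<Otimes>\<^sub>M lborel) (\<lambda>(\<theta>, r). f \<theta> r)" by (simp add: case_prod_unfold)
    have inner: "(CLBINT r. f \<theta> r) = of_real (2 * pi * (p \<theta> * exp (- (\<eta> * \<theta>)\<^sup>2 / 2)))" for \<theta>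
    proof -
      have "(CLBINT r. f \<theta> r) = (CLBINT r. iexp (- (r * \<theta>)) * g r) * of_real (exp (- (\<eta> * \<theta>)\<^sup>2 / 2))"
        unfolding f_def by (rule integral_mult_left_zero)
      also have "(CLBINT r. iexp (- (r * \<theta>)) * g r) = 2 * pi * complex_of_real (p \<theta>)" unfolding p by simp
      finally show ?thesis by simp
    qed
    have "integrable lborel (\<lambda>\<theta>. complex_of_real (2 * pi * (p \<theta> * exp (- (\<eta> * \<theta>)\<^sup>2 / 2))))"
      using lborel_pair.integrable_fst[OF int'] unfolding inner .
    then have "integrable lborel (\<lambda>\<theta>. 2 * pi * (p \<theta> * exp (- (\<eta> * \<theta>)\<^sup>2 / 2)))"
      by (simp only: complex_of_real_integrable_eq)
    then show "integrable lborel (\<lambda>\<theta>. p \<theta> * exp (- (\<eta> * \<theta>)\<^sup>2 / 2))" by simp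
    have inner2: "(CLBINT \<theta>. f \<theta> r) = g r * of_real (sqrt (2 * pi) * exp (- (r / \<eta>)\<^sup>2 / 2) / \<eta>)" for r
    proof -
      let ?k = "\<lambda>\<theta>. iexp (- (r * \<theta>)) * complex_of_real (exp (- (\<eta> * \<theta>)\<^sup>2 / 2))"
      have "(CLBINT \<theta>. ?k \<theta>) = \<bar>1 / \<eta>\<bar> *\<^sub>R (CLBINT x. ?k (0 + 1 / \<eta> * x))"
        using \<eta> by (intro lborel_integral_real_affine) simp
      also have "(\<lambda>x. ?k (0 + 1 / \<eta> * x)) = (\<lambda>x. iexp ((- (r / \<eta>)) * x) * of_real (exp (- x\<^sup>2 / 2)))"
        using \<eta> by (intro ext) simp
      also have "\<bar>1 / \<eta>\<bar> *\<^sub>R (CLBINT x. iexp ((- (r / \<eta>)) * x) * of_real (exp (- x\<^sup>2 / 2))) = of_real (sqrt (2 * pi) * exp (- (r / \<eta>)\<^sup>2 / 2) / \<eta>)"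
        unfolding std_normal_fourier using \<eta> by (simp add: scaleR_conv_of_real)
      finally have k: "(CLBINT \<theta>. ?k \<theta>) = of_real (sqrt (2 * pi) * exp (- (r / \<eta>)\<^sup>2 / 2) / \<eta>)" .
      have "(CLBINT \<theta>. f \<theta> r) = (CLBINT \<theta>. g r * ?k \<theta>)" unfolding f_def by (simp add: mult_ac)
      also have "\<dots> = g r * (CLBINT \<theta>. ?k \<theta>)" by (rule integral_mult_right_zero)
      finally show ?thesis unfolding k .
    qed
    have "complex_of_real (2 * pi) * of_real (LBINT \<theta>. p \<theta> * exp (- (\<eta> * \<theta>)\<^sup>2 / 2)) = of_real (LBINT \<theta>. 2 * pi * (p \<theta> * exp (- (\<eta> * \<theta>)\<^sup>2 / 2)))"
      by simp
    also have "\<dots> = (CLBINT \<theta>. CLBINT r. f \<theta> r)" unfolding inner integral_complex_of_real ..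
    also have "\<dots> = (CLBINT r. CLBINT \<theta>. f \<theta> r)" by (rule lborel_pair.Fubini_integral[OF int', symmetric])
    also have "\<dots> = (CLBINT r. g r * of_real (sqrt (2 * pi) * exp (- (r / \<eta>)\<^sup>2 / 2) / \<eta>))"
      unfolding inner2 ..
    also have "\<dots> = \<bar>\<eta>\<bar> *\<^sub>R (CLBINT x. g (0 + \<eta> * x) * of_real (sqrt (2 * pi) * exp (- ((0 + \<eta> * x) / \<eta>)\<^sup>2 / 2) / \<eta>))"
      using \<eta> by (intro lborel_integral_real_affine) simp
    also have "\<dots> = \<bar>\<eta>\<bar> *\<^sub>R (CLBINT x. of_real (sqrt (2 * pi) / \<eta>) * (g (\<eta> * x) * of_real (exp (- x\<^sup>2 / 2))))"
      using \<eta> by (simp add: mult_ac)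
    also have "\<dots> = of_real (sqrt (2 * pi)) * (CLBINT x. g (\<eta> * x) * of_real (exp (- x\<^sup>2 / 2)))"
      unfolding integral_mult_right_zero using \<eta> by (simp add: scaleR_conv_of_real)
    finally have e: "complex_of_real (2 * pi) * of_real (LBINT \<theta>. p \<theta> * exp (- (\<eta> * \<theta>)\<^sup>2 / 2))
        = of_real (sqrt (2 * pi)) * (CLBINT x. g (\<eta> * x) * of_real (exp (- x\<^sup>2 / 2)))" .
    \<comment> \<open>The inverse transform carries 1 / (2 pi) and the Gaussian integral sqrt (2
      pi), so one factor 1 / sqrt (2 pi) remains, the normalization of the normal density.\<close>
    have s: "complex_of_real (2 * pi) = of_real (sqrt (2 * pi)) * of_real (sqrt (2 * pi))"
      unfolding of_real_mult[symmetric] by simp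
    have s0: "complex_of_real (sqrt (2 * pi)) \<noteq> 0" by simp
    from e show "of_real (LBINT \<theta>. p \<theta> * exp (- (\<eta> * \<theta>)\<^sup>2 / 2)) = (CLBINT x. g (\<eta> * x) * of_real (exp (- x\<^sup>2 / 2))) / sqrt (2 * pi)"
      unfolding s mult.assoc mult_cancel_left using s0 by (simp add: eq_divide_eq mult.commute)
  qed
  have \<eta>0: "?\<eta> \<longlonglongrightarrow> 0" using lim_inverse_n'[THEN LIMSEQ_Suc] by (simp add: add.commute)
  have one: "integrable lborel (\<lambda>x::real. exp (- x\<^sup>2 / 2))" using integrable_gaussian[of 1] by simp
  have "(\<lambda>m. CLBINT x. g (?\<eta> m * x) * of_real (exp (- x\<^sup>2 / 2))) \<longlonglongrightarrow> (CLBINT x. g 0 * of_real (exp (- x\<^sup>2 / 2)))"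
  proof (rule integral_dominated_convergence[where w = "\<lambda>x. K * exp (- x\<^sup>2 / 2)"])
    show "integrable lborel (\<lambda>x. K * exp (- x\<^sup>2 / 2))" by (intro integrable_mult_right one)
    show "AE x in lborel. norm (g (?\<eta> m * x) * of_real (exp (- x\<^sup>2 / 2))) \<le> K * exp (- x\<^sup>2 / 2)" for m
      using bd by (intro AE_I2) (simp add: norm_mult mult_right_mono)
    show "AE x in lborel. (\<lambda>m. g (?\<eta> m * x) * of_real (exp (- x\<^sup>2 / 2))) \<longlonglongrightarrow> g 0 * of_real (exp (- x\<^sup>2 / 2))"
    proof (rule AE_I2)
      fix x :: real
      have "(\<lambda>m. ?\<eta> m * x) \<longlonglongrightarrow> 0 * x" by (intro tendsto_intros \<eta>0)
      then have "(\<lambda>m. g (?\<eta> m * x)) \<longlonglongrightarrow> g 0"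
        using continuous_on_tendsto_compose[OF cont, of "\<lambda>m. ?\<eta> m * x" 0] by simp
      then show "(\<lambda>m. g (?\<eta> m * x) * of_real (exp (- x\<^sup>2 / 2))) \<longlonglongrightarrow> g 0 * of_real (exp (- x\<^sup>2 / 2))"
        by (intro tendsto_intros)
    qed
  qed measurable
  also have "(CLBINT x. g 0 * of_real (exp (- x\<^sup>2 / 2))) = g 0 * of_real (sqrt (2 * pi))"
    using std_normal_fourier[of 0] by simp
  finally have lim: "(\<lambda>m. CLBINT x. g (?\<eta> m * x) * of_real (exp (- x\<^sup>2 / 2))) \<longlonglongrightarrow> g 0 * of_real (sqrt (2 * pi))" .
  have \<eta>p: "?\<eta> m > 0" for m by simp
  have "(\<lambda>m. (CLBINT x. g (?\<eta> m * x) * of_real (exp (- x\<^sup>2 / 2))) / sqrt (2 * pi)) \<longlonglongrightarrow> g 0 * of_real (sqrt (2 * pi)) / of_real (sqrt (2 * pi))"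
    by (intro tendsto_divide lim tendsto_const) simp
  then have limC: "(\<lambda>m. complex_of_real (LBINT \<theta>. p \<theta> * exp (- (?\<eta> m * \<theta>)\<^sup>2 / 2))) \<longlonglongrightarrow> g 0"
    unfolding step(2)[OF \<eta>p] by simp
  from tendsto_Re[OF this] have limR: "(\<lambda>m. LBINT \<theta>. p \<theta> * exp (- (?\<eta> m * \<theta>)\<^sup>2 / 2)) \<longlonglongrightarrow> Re (g 0)" by simp
  from tendsto_Im[OF limC] have "Im (g 0) = 0" using LIMSEQ_unique[OF tendsto_const] by fastforce
  then have g0: "g 0 = of_real (Re (g 0))" by (simp add: complex_eq_iff)
  \<comment> \<open>As m grows the damping parameter decreases, so the Gaussian factors increase to
    1; p \<ge> 0 carries this over to the products.\<close>
  have mono: "AE \<theta> in lborel. mono (\<lambda>m. p \<theta> * exp (- (?\<eta> m * \<theta>)\<^sup>2 / 2))"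
  proof (rule AE_I2, rule monoI)
    fix \<theta> :: real and a b :: nat
    assume "a \<le> b"
    then have "?\<eta> b \<le> ?\<eta> a" by (intro divide_left_mono) auto
    then have "(?\<eta> b)\<^sup>2 \<le> (?\<eta> a)\<^sup>2" by (intro power_mono) auto
    then have "(?\<eta> b)\<^sup>2 * \<theta>\<^sup>2 \<le> (?\<eta> a)\<^sup>2 * \<theta>\<^sup>2" by (intro mult_right_mono) auto
    then have "(?\<eta> b * \<theta>)\<^sup>2 \<le> (?\<eta> a * \<theta>)\<^sup>2" by (simp only: power_mult_distrib)
    then show "p \<theta> * exp (- (?\<eta> a * \<theta>)\<^sup>2 / 2) \<le> p \<theta> * exp (- (?\<eta> b * \<theta>)\<^sup>2 / 2)"
      using p0[of \<theta>] by (intro mult_left_mono) auto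
  qed
  have conv: "AE \<theta> in lborel. (\<lambda>m. p \<theta> * exp (- (?\<eta> m * \<theta>)\<^sup>2 / 2)) \<longlonglongrightarrow> p \<theta>"
  proof (rule AE_I2)
    fix \<theta> :: real
    have "(\<lambda>m. p \<theta> * exp (- (?\<eta> m * \<theta>)\<^sup>2 / 2)) \<longlonglongrightarrow> p \<theta> * exp (- (0 * \<theta>)\<^sup>2 / 2)"
      by (intro tendsto_intros \<eta>0) simp
    then show "(\<lambda>m. p \<theta> * exp (- (?\<eta> m * \<theta>)\<^sup>2 / 2)) \<longlonglongrightarrow> p \<theta>" by simp
  qed
  have pm: "p \<in> borel_measurable lborel" by simp
  show "integrable lborel p"
    by (rule integrable_monotone_convergence[OF step(1)[OF \<eta>p] mono conv limR pm])
  have "(LBINT \<theta>. p \<theta>) = Re (g 0)"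
    by (rule integral_monotone_convergence[OF step(1)[OF \<eta>p] mono conv limR pm])
  then show "of_real (LBINT \<theta>. p \<theta>) = g 0" using g0 by simp
qed

lemma exp_gaussian_le:
  fixes \<sigma> r :: real
  assumes "\<sigma> > 0" shows "exp (- (\<sigma> * r)\<^sup>2 / 2) \<le> 1 / (1 + (\<sigma> / 2)\<^sup>2 * r\<^sup>2)"
proof -
  define x where "x = (\<sigma> * r)\<^sup>2 / 2"
  have x: "(\<sigma> / 2)\<^sup>2 * r\<^sup>2 \<le> x" by (simp add: x_def power_mult_distrib power_divide)
  have pos: "0 < 1 + (\<sigma> / 2)\<^sup>2 * r\<^sup>2" by (simp add: add_pos_nonneg)
  have "1 + (\<sigma> / 2)\<^sup>2 * r\<^sup>2 \<le> exp x" using x exp_ge_add_one_self[of x] by linarith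
  then have "1 / exp x \<le> 1 / (1 + (\<sigma> / 2)\<^sup>2 * r\<^sup>2)" using pos by (intro divide_left_mono) auto
  then show ?thesis by (simp add: x_def exp_minus inverse_eq_divide)
qed

text \<open>An entire F has a primitive G, so the two truncated vertical integrals differ by
  increments of G along the horizontal segments at heights R and -R. These are bounded by |\<tau>|
  times the maximum of |F| there, which tends to 0.\<close>

lemma integral_vertical_line_shift:
  fixes F :: "complex \<Rightarrow> complex"
  assumes holo: "F holomorphic_on UNIV" and c: "c > 0"
    and bd: "\<And>z. \<bar>Re z\<bar> \<le> \<bar>\<tau>\<bar> \<Longrightarrow> norm (F z) \<le> K / (1 + c\<^sup>2 * (Im z)\<^sup>2)"
  shows "integrable lborel (\<lambda>r. F (of_real \<tau> + \<i> * of_real r))"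
    and "(LBINT r. F (of_real \<tau> + \<i> * of_real r)) = (LBINT r. F (\<i> * of_real r))"
proof -
  have K: "K \<ge> 0" using bd[of 0] order_trans[OF norm_ge_zero[of "F 0"]] by simp
  obtain G where G: "(G has_field_derivative F z) (at z)" for z
    using holomorphic_convex_primitive'[of UNIV F] holo by auto
  have contF: "continuous_on UNIV F" by (rule holomorphic_on_imp_continuous_on[OF holo])
  have int: "integrable lborel (\<lambda>r. F (of_real t + \<i> * of_real r))" if t: "\<bar>t\<bar> \<le> \<bar>\<tau>\<bar>" for t
  proof (rule Bochner_Integration.integrable_bound)
    show "integrable lborel (\<lambda>y. K * (1 / (1 + c\<^sup>2 * y\<^sup>2)))"
      by (intro integrable_mult_right integrable_inverse_1_plus_scaled_square c)
    have "continuous_on UNIV (\<lambda>r. F (of_real t + \<i> * complex_of_real r))"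
      by (rule continuous_on_compose2[OF contF]) (intro continuous_intros, simp)
    then show "(\<lambda>r. F (of_real t + \<i> * complex_of_real r)) \<in> borel_measurable lborel"
      by (simp add: borel_measurable_continuous_onI)
    show "AE r in lborel. norm (F (of_real t + \<i> * of_real r)) \<le> norm (K * (1 / (1 + c\<^sup>2 * r\<^sup>2)))"
    proof (rule AE_I2)
      fix r :: real
      have "norm (F (of_real t + \<i> * of_real r)) \<le> K * (1 / (1 + c\<^sup>2 * r\<^sup>2))"
        using bd[of "of_real t + \<i> * of_real r"] t by simp
      then show "norm (F (of_real t + \<i> * of_real r)) \<le> norm (K * (1 / (1 + c\<^sup>2 * r\<^sup>2)))"
        unfolding real_norm_def by (rule order_trans[OF _ abs_ge_self])
    qed
  qed
  show i\<tau>: "integrable lborel (\<lambda>r. F (of_real \<tau> + \<i> * of_real r))" by (rule int) simp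
  have i0: "integrable lborel (\<lambda>r. F (\<i> * of_real r))" using int[of 0] by simp
  have FTC: "integral {-R..R} (\<lambda>r. \<i> * F (of_real t + \<i> * of_real r)) = G (of_real t + \<i> * of_real R) - G (of_real t - \<i> * of_real R)"
    if "R \<ge> 0" for t R
  proof -
    have "((\<lambda>r. \<i> * F (of_real t + \<i> * of_real r)) has_integral (G (of_real t + \<i> * of_real R) - G (of_real t + \<i> * of_real (- R)))) {-R..R}"
    proof (rule fundamental_theorem_of_calculus)
      show "- R \<le> R" using that by simp
      fix r
      have L: "((\<lambda>w. of_real t + \<i> * w) has_field_derivative \<i>) (at (complex_of_real r))"
        by (rule derivative_eq_intros refl | simp)+
      have "((\<lambda>w. G (of_real t + \<i> * w)) has_field_derivative F (of_real t + \<i> * of_real r) * \<i>) (at (of_real r))"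
        by (rule DERIV_chain2[OF G[of "of_real t + \<i> * of_real r"] L])
      from has_vector_derivative_real_field[OF this]
      have "((\<lambda>r. G (of_real t + \<i> * of_real r)) has_vector_derivative \<i> * F (of_real t + \<i> * of_real r)) (at r)"
        by (simp add: mult.commute)
      then show "((\<lambda>r. G (of_real t + \<i> * of_real r)) has_vector_derivative \<i> * F (of_real t + \<i> * of_real r)) (at r within {-R..R})"
        by (rule has_vector_derivative_at_within)
    qed
    from integral_unique[OF this] show ?thesis by (simp only: of_real_minus mult_minus_right add_uminus_conv_diff)
  qed
  have diff: "norm (G (of_real \<tau> + \<i> * of_real R) - G (\<i> * of_real R)) \<le> K / (1 + c\<^sup>2 * R\<^sup>2) * \<bar>\<tau>\<bar>" for R
  proof -
    let ?S = "closed_segment (of_real \<tau> + \<i> * of_real R) (\<i> * complex_of_real R)"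
    have "norm (G (of_real \<tau> + \<i> * of_real R) - G (\<i> * of_real R)) \<le> K / (1 + c\<^sup>2 * R\<^sup>2) * norm ((of_real \<tau> + \<i> * of_real R) - \<i> * complex_of_real R)"
    proof (rule field_differentiable_bound[where S = ?S and f' = F])
      show "(G has_field_derivative F z) (at z within ?S)" for z by (rule has_field_derivative_at_within[OF G])
      show "norm (F z) \<le> K / (1 + c\<^sup>2 * R\<^sup>2)" if z: "z \<in> ?S" for z
      proof -
        obtain u where u: "0 \<le> u" "u \<le> 1" and zu: "z = (1 - u) *\<^sub>R (of_real \<tau> + \<i> * of_real R) + u *\<^sub>R (\<i> * complex_of_real R)"
          using z unfolding in_segment by blast
        have "Re z = (1 - u) * \<tau>" "Im z = R" by (simp_all add: zu algebra_simps)
        moreover have "\<bar>(1 - u) * \<tau>\<bar> \<le> \<bar>\<tau>\<bar>" using u by (simp add: abs_mult mult_left_le_one_le)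
        ultimately show ?thesis using bd[of z] by simp
      qed
    qed auto
    then show ?thesis by simp
  qed
  have "(\<lambda>n. integral {-real n..real n} (\<lambda>r. \<i> * F (of_real \<tau> + \<i> * of_real r)) - integral {-real n..real n} (\<lambda>r. \<i> * F (of_real 0 + \<i> * of_real r))) \<longlonglongrightarrow> 0"
  proof (rule Lim_null_comparison)
    show "\<forall>\<^sub>F n in sequentially. norm (integral {-real n..real n} (\<lambda>r. \<i> * F (of_real \<tau> + \<i> * of_real r)) - integral {-real n..real n} (\<lambda>r. \<i> * F (of_real 0 + \<i> * of_real r)))
       \<le> (2 * K * \<bar>\<tau>\<bar> / c\<^sup>2) / real n"
    proof (rule eventually_sequentiallyI[of 1])
      fix n :: nat
      assume n: "1 \<le> n"
      have e: "integral {-real n..real n} (\<lambda>r. \<i> * F (of_real \<tau> + \<i> * of_real r)) - integral {-real n..real n} (\<lambda>r. \<i> * F (of_real 0 + \<i> * of_real r))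
        = (G (of_real \<tau> + \<i> * of_real (real n)) - G (\<i> * of_real (real n))) - (G (of_real \<tau> + \<i> * of_real (- real n)) - G (\<i> * of_real (- real n)))"
        using FTC[of "real n" \<tau>] FTC[of "real n" 0] by simp
      have "real n \<le> (real n)\<^sup>2" using n by (simp add: power2_eq_square)
      then have "c\<^sup>2 * real n \<le> c\<^sup>2 * (real n)\<^sup>2" by (intro mult_left_mono) auto
      then have "c\<^sup>2 * real n \<le> 1 + c\<^sup>2 * (real n)\<^sup>2" by linarith
      then have k: "K / (1 + c\<^sup>2 * (real n)\<^sup>2) * \<bar>\<tau>\<bar> \<le> K / (c\<^sup>2 * real n) * \<bar>\<tau>\<bar>"
        using K n c by (intro mult_right_mono divide_left_mono) (auto intro!: mult_pos_pos add_pos_nonneg)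
      have "norm ((G (of_real \<tau> + \<i> * of_real (real n)) - G (\<i> * of_real (real n))) - (G (of_real \<tau> + \<i> * of_real (- real n)) - G (\<i> * of_real (- real n))))
        \<le> K / (1 + c\<^sup>2 * (real n)\<^sup>2) * \<bar>\<tau>\<bar> + K / (1 + c\<^sup>2 * (- real n)\<^sup>2) * \<bar>\<tau>\<bar>"
        by (rule order_trans[OF norm_triangle_ineq4 add_mono[OF diff diff]])
      also have "\<dots> \<le> K / (c\<^sup>2 * real n) * \<bar>\<tau>\<bar> + K / (c\<^sup>2 * real n) * \<bar>\<tau>\<bar>"
        unfolding power2_minus by (rule add_mono[OF k k])
      also have "\<dots> = (2 * K * \<bar>\<tau>\<bar> / c\<^sup>2) / real n" by (simp add: mult_ac)
      finally show "norm (integral {-real n..real n} (\<lambda>r. \<i> * F (of_real \<tau> + \<i> * of_real r)) - integral {-real n..real n} (\<lambda>r. \<i> * F (of_real 0 + \<i> * of_real r)))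
       \<le> (2 * K * \<bar>\<tau>\<bar> / c\<^sup>2) / real n" unfolding e .
    qed
    show "(\<lambda>n. (2 * K * \<bar>\<tau>\<bar> / c\<^sup>2) / real n) \<longlonglongrightarrow> 0" by (rule lim_const_over_n)
  qed
  moreover have "(\<lambda>n. integral {-real n..real n} (\<lambda>r. \<i> * F (of_real \<tau> + \<i> * of_real r)) - integral {-real n..real n} (\<lambda>r. \<i> * F (of_real 0 + \<i> * of_real r)))
     \<longlonglongrightarrow> (LBINT r. \<i> * F (of_real \<tau> + \<i> * of_real r)) - (LBINT r. \<i> * F (of_real 0 + \<i> * of_real r))"
    by (intro tendsto_diff integral_lborel_limit_symmetric integrable_mult_right i\<tau>) (use i0 in simp)
  ultimately have "(LBINT r. \<i> * F (of_real \<tau> + \<i> * of_real r)) - (LBINT r. \<i> * F (of_real 0 + \<i> * of_real r)) = 0"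
    using LIMSEQ_unique by blast
  then show "(LBINT r. F (of_real \<tau> + \<i> * of_real r)) = (LBINT r. F (\<i> * of_real r))"
    unfolding integral_mult_right_zero by simp
qed

text \<open>The negative half-line contributes the conjugate of the positive one. The fold is
  written with u (-r) because positivity is stated for arguments -i r.\<close>

lemma integral_hermitian_function:
  fixes u :: "real \<Rightarrow> complex"
  assumes u: "integrable lborel u" and h: "\<And>r. u (- r) = cnj (u r)"
  shows "(LBINT r. u r) = of_real (2 * Re (LINT r:{0..}|lborel. u (- r)))"
proof -
  have iv: "integrable lborel (\<lambda>r. u (- r))" using lborel_integrable_real_affine[OF u, of "-1" 0] by simp
  have a: "integrable lborel (\<lambda>r. indicator {0..} r *\<^sub>R u r)" by (intro integrable_mult_indicator u) simp
  have b: "integrable lborel (\<lambda>r. indicator {..<0} r *\<^sub>R u r)" by (intro integrable_mult_indicator u) simp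
  have "(LBINT r. u r) = (LBINT r. indicator {0..} r *\<^sub>R u r + indicator {..<0} r *\<^sub>R u r)"
    by (rule Bochner_Integration.integral_cong) (auto simp: indicator_def)
  also have "\<dots> = (LBINT r. indicator {0..} r *\<^sub>R u r) + (LBINT r. indicator {..<0} r *\<^sub>R u r)"
    by (rule Bochner_Integration.integral_add[OF a b])
  also have "(LBINT r. indicator {0..} r *\<^sub>R u r) = (LBINT r. cnj (indicator {0..} r *\<^sub>R u (- r)))"
    by (rule Bochner_Integration.integral_cong) (auto simp: indicator_def h)
  also have "\<dots> = cnj (LINT r:{0..}|lborel. u (- r))"
    unfolding set_lebesgue_integral_def by (rule Bochner_Integration.integral_cnj)
  also have "(LBINT r. indicator {..<0} r *\<^sub>R u r) = (LBINT r. indicator {..<0} (- r) *\<^sub>R u (- r))"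
    using lborel_integral_real_affine[of "-1" "\<lambda>r. indicator {..<0} r *\<^sub>R u r" 0] by simp
  also have "\<dots> = (LBINT r. indicator {0..} r *\<^sub>R u (- r))"
  proof (rule integral_cong_AE)
    show "AE r in lborel. indicator {..<0} (- r) *\<^sub>R u (- r) = indicator {0..} r *\<^sub>R u (- r)"
      using AE_lborel_singleton[of "0::real"] by eventually_elim (auto simp: indicator_def)
  qed (use iv in \<open>auto\<close>)
  also have "\<dots> = (LINT r:{0..}|lborel. u (- r))" unfolding set_lebesgue_integral_def ..
  also have "cnj (LINT r:{0..}|lborel. u (- r)) + (LINT r:{0..}|lborel. u (- r)) = of_real (2 * Re (LINT r:{0..}|lborel. u (- r)))"
    by (simp add: complex_eq_iff)
  finally show ?thesis .
qed

section \<open>Weak limits of measures with bounded exponential moments\<close>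

lemma tight_of_exponential_moments:
  fixes M :: "nat \<Rightarrow> real measure"
  assumes M: "\<And>k. real_distribution (M k)"
    and int: "\<And>k t. integrable (M k) (\<lambda>x. exp (t * x))"
    and bd: "\<And>k t. (\<integral>x. exp (t * x) \<partial>M k) \<le> C t"
  shows "tight M"
  unfolding tight_def
proof (intro conjI allI impI)
  fix k show "real_distribution (M k)" by (rule M)
next
  fix \<epsilon> :: real
  assume \<epsilon>: "\<epsilon> > 0"
  \<comment> \<open>Outside (-R, R] the function exp x + exp (-x) is at least exp R, so by Markov
    the mass there is at most (C 1 + C (-1)) / exp R. The choice of R makes the numerator at most
    \<epsilon> R < \<epsilon> exp R, and R \<ge> 1 keeps the interval non-degenerate.\<close>
  define R where "R = max 1 ((C 1 + C (-1)) / \<epsilon>)"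
  have R1: "R \<ge> 1" by (simp add: R_def)
  have "(C 1 + C (-1)) / \<epsilon> \<le> R" by (simp add: R_def)
  then have RC: "C 1 + C (-1) \<le> \<epsilon> * R" using \<epsilon> by (simp add: divide_le_eq mult.commute)
  have "measure (M k) {-R<..R} > 1 - \<epsilon>" for k
  proof -
    interpret real_distribution "M k" by (rule M)
    have i: "integrable (M k) (\<lambda>x. exp x + exp (- x))" using int[of k 1] int[of k "-1"] by simp
    have c: "{x. \<not> (- R < x \<and> x \<le> R)} \<in> sets (M k)" by simp
    have "measure (M k) {x. \<not> (- R < x \<and> x \<le> R)} = (\<integral>x. indicator {x. \<not> (- R < x \<and> x \<le> R)} x \<partial>M k)"
      using c by simp
    then have "exp R * measure (M k) {x. \<not> (- R < x \<and> x \<le> R)} = (\<integral>x. exp R * indicator {x. \<not> (- R < x \<and> x \<le> R)} x \<partial>M k)"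
      by simp
    also have "\<dots> \<le> (\<integral>x. exp x + exp (- x) \<partial>M k)"
    proof (rule integral_mono)
      show "integrable (M k) (\<lambda>x. exp R * indicator {x. \<not> (- R < x \<and> x \<le> R)} x)"
        by (intro integrable_mult_right integrable_real_indicator c) (simp add: emeasure_eq_measure)
      show "exp R * indicator {x. \<not> (- R < x \<and> x \<le> R)} x \<le> exp x + exp (- x)" for x
      proof (cases "- R < x \<and> x \<le> R")
        case True
        then show ?thesis by (simp add: add_nonneg_nonneg)
      next
        case False
        then have "R \<le> x \<or> R \<le> - x" by linarith
        then have "exp R \<le> exp x \<or> exp R \<le> exp (- x)" by simp
        moreover have "0 \<le> exp x" "0 \<le> exp (- x)" by simp_all
        ultimately have "exp R \<le> exp x + exp (- x)" by linarith
        then show ?thesis using False by simp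
      qed
    qed (rule i)
    also have "\<dots> = (\<integral>x. exp (1 * x) \<partial>M k) + (\<integral>x. exp (- 1 * x) \<partial>M k)"
      using int[of k 1] int[of k "-1"] by (subst Bochner_Integration.integral_add) simp_all
    also have "\<dots> \<le> C 1 + C (- 1)" by (intro add_mono bd)
    also have "\<dots> \<le> \<epsilon> * R" by (rule RC)
    also have "\<dots> < \<epsilon> * exp R" using \<epsilon> exp_ge_add_one_self[of R] by (intro mult_strict_left_mono) linarith+
    finally have "exp R * measure (M k) {x. \<not> (- R < x \<and> x \<le> R)} < exp R * \<epsilon>" by (simp add: mult.commute)
    then have lt: "measure (M k) {x. \<not> (- R < x \<and> x \<le> R)} < \<epsilon>" by simp
    have "space (M k) - {-R<..R} = {x. \<not> (- R < x \<and> x \<le> R)}" by auto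
    then have "measure (M k) {x. \<not> (- R < x \<and> x \<le> R)} = 1 - measure (M k) {-R<..R}"
      using prob_compl[of "{-R<..R}"] by simp
    then show ?thesis using lt by linarith
  qed
  then show "\<exists>a b. a < b \<and> (\<forall>n. 1 - \<epsilon> < measure (M n) {a<..b})" using R1 by (intro exI[of _ "- R"] exI[of _ R]) auto
qed

text \<open>Weak convergence controls only bounded continuous functions. The exponentials are
  therefore cut off at height J, and the error is bounded by the moment at 2 t divided by J,
  uniformly along the sequence and also for the limit.\<close>

lemma exponential_moments_limit:
  fixes M :: "nat \<Rightarrow> real measure" and L :: "real \<Rightarrow> real"
  assumes M: "\<And>k. real_distribution (M k)"
    and int: "\<And>k t. integrable (M k) (\<lambda>x. exp (t * x))"
    and lim: "\<And>t. (\<lambda>k. \<integral>x. exp (t * x) \<partial>M k) \<longlonglongrightarrow> L t"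
  shows "\<exists>N. real_distribution N \<and> (\<forall>t. integrable N (\<lambda>x. exp (t * x)) \<and> (\<integral>x. exp (t * x) \<partial>N) = L t)"
proof -
  have "\<exists>C. \<forall>k. (\<integral>x. exp (t * x) \<partial>M k) \<le> C" for t
  proof -
    have "Bseq (\<lambda>k. \<integral>x. exp (t * x) \<partial>M k)" using lim[of t] by (intro convergent_imp_Bseq) (auto simp: convergent_def)
    then obtain C where "\<forall>k. norm (\<integral>x. exp (t * x) \<partial>M k) \<le> C" unfolding Bseq_def by blast
    then have "\<forall>k. (\<integral>x. exp (t * x) \<partial>M k) \<le> C" by (auto simp: abs_le_iff)
    then show ?thesis by blast
  qed
  then obtain C where C: "\<And>k t. (\<integral>x. exp (t * x) \<partial>M k) \<le> C t" by metis
  have "tight M" by (rule tight_of_exponential_moments[OF M int C])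
  from tight_imp_convergent_subsubsequence[OF this strict_mono_id]
  obtain r N where r: "strict_mono (r :: nat \<Rightarrow> nat)" and N: "real_distribution N" and w: "weak_conv_m (M \<circ> id \<circ> r) N"
    by blast
  define M' where "M' k = M (r k)" for k
  have M': "real_distribution (M' k)" for k unfolding M'_def by (rule M)
  have w': "weak_conv_m M' N" using w by (simp add: comp_def M'_def[abs_def])
  have lim': "(\<lambda>k. \<integral>x. exp (t * x) \<partial>M' k) \<longlonglongrightarrow> L t" for t
    using LIMSEQ_subseq_LIMSEQ[OF lim r] by (simp add: comp_def M'_def)
  interpret N: real_distribution N by (rule N)
  have trunc: "(\<lambda>k. \<integral>x. min (exp (t * x)) J \<partial>M' k) \<longlonglongrightarrow> (\<integral>x. min (exp (t * x)) J \<partial>N)" if J: "J > 0" for t J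
  proof (rule weak_conv_imp_integral_bdd_continuous_conv[OF M' N w'])
    show "isCont (\<lambda>x. min (exp (t * x)) J) x" for x by (intro continuous_intros)
    show "norm (min (exp (t * x)) J) \<le> J" for x using J by simp
  qed
  have minint: "integrable P (\<lambda>x. min (exp (t * x)) J)" if "real_distribution P" "J > 0" for P t J
  proof -
    interpret P: real_distribution P by (rule that)
    show ?thesis by (rule P.integrable_const_bound[of _ J]) (use that in auto)
  qed
  have trunc_le: "(\<integral>x. min (exp (t * x)) J \<partial>N) \<le> C t" if J: "J > 0" for t J
  proof (rule LIMSEQ_le_const2[OF trunc[OF J]])
    have "(\<integral>x. min (exp (t * x)) J \<partial>M' k) \<le> (\<integral>x. exp (t * x) \<partial>M' k)" for k
      by (intro integral_mono minint M' J) (auto simp: M'_def int)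
    then show "\<exists>k0. \<forall>k\<ge>k0. (\<integral>x. min (exp (t * x)) J \<partial>M' k) \<le> C t"
      using C order_trans unfolding M'_def by blast
  qed
  \<comment> \<open>Integrability under the limit comes first, by monotone convergence of the
    truncations, whose integrals inherit the bound \<open>C\<close>; only then can the cut-off error
    under \<open>N\<close> be estimated.\<close>
  have Nint: "integrable N (\<lambda>x. exp (t * x))" for t
  proof -
    let ?f = "\<lambda>j x. min (exp (t * x)) (real j + 1)"
    have inc: "incseq (\<lambda>j. \<integral>x. ?f j x \<partial>N)"
      by (intro incseq_SucI integral_mono minint N) auto
    have up: "(\<integral>x. ?f j x \<partial>N) \<le> C t" for j by (rule trunc_le) simp
    obtain c where c: "(\<lambda>j. \<integral>x. ?f j x \<partial>N) \<longlonglongrightarrow> c"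
      using incseq_convergent[OF inc, of "C t"] up by blast
    show ?thesis
    proof (rule integrable_monotone_convergence[OF minint[OF N] _ _ c])
      show "AE x in N. mono (\<lambda>j. ?f j x)" by (intro AE_I2 monoI) auto
      show "AE x in N. (\<lambda>j. ?f j x) \<longlonglongrightarrow> exp (t * x)"
      proof (rule AE_I2, rule tendsto_eventually)
        fix x
        obtain J :: nat where "exp (t * x) \<le> real J" using real_arch_simple by blast
        then show "\<forall>\<^sub>F j in sequentially. ?f j x = exp (t * x)"
          by (intro eventually_sequentiallyI[of J]) auto
      qed
    qed auto
  qed
  \<comment> \<open>Where the truncation acts, exp (t x) / J > 1, so multiplying exp (t x) by this
    ratio only enlarges it.\<close>
  have cut: "exp (t * x) - min (exp (t * x)) J \<le> exp (2 * t * x) / J" if "J > 0" for t x J :: real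
  proof (cases "exp (t * x) \<le> J")
    case True
    then show ?thesis using that by simp
  next
    case False
    then have "J * exp (t * x) \<le> exp (t * x) * exp (t * x)" by (intro mult_right_mono) auto
    also have "\<dots> = exp (2 * t * x)" by (simp add: exp_add[symmetric])
    finally have "exp (t * x) \<le> exp (2 * t * x) / J" using that by (simp add: field_simps)
    moreover have "0 \<le> min (exp (t * x)) J" using that by simp
    ultimately show ?thesis by linarith
  qed
  have close: "\<bar>(\<integral>x. exp (t * x) \<partial>P) - (\<integral>x. min (exp (t * x)) J \<partial>P)\<bar> \<le> (\<integral>x. exp (2 * t * x) \<partial>P) / J"
    if P: "real_distribution P" "\<And>t. integrable P (\<lambda>x. exp (t * x))" and J: "J > 0" for P t J
  proof -
    have "(\<integral>x. exp (t * x) \<partial>P) - (\<integral>x. min (exp (t * x)) J \<partial>P) = (\<integral>x. exp (t * x) - min (exp (t * x)) J \<partial>P)"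
      by (rule Bochner_Integration.integral_diff[symmetric, OF P(2) minint[OF P(1) J]])
    moreover have "0 \<le> (\<integral>x. exp (t * x) - min (exp (t * x)) J \<partial>P)"
      by (intro integral_nonneg_AE AE_I2) simp
    moreover have "(\<integral>x. exp (t * x) - min (exp (t * x)) J \<partial>P) \<le> (\<integral>x. exp (2 * t * x) / J \<partial>P)"
      by (intro integral_mono Bochner_Integration.integrable_diff minint P J integrable_divide cut)
    ultimately show ?thesis by simp
  qed
  have "(\<integral>x. exp (t * x) \<partial>N) = L t" for t
  proof -
    define A where "A = (\<integral>x. exp (2 * t * x) \<partial>N) + C (2 * t)"
    have le: "\<bar>(\<integral>x. exp (t * x) \<partial>N) - L t\<bar> \<le> A / J" if J: "J > 0" for J
    proof -
      have "(\<lambda>k. \<bar>(\<integral>x. exp (t * x) \<partial>M' k) - (\<integral>x. min (exp (t * x)) J \<partial>M' k)\<bar>) \<longlonglongrightarrow> \<bar>L t - (\<integral>x. min (exp (t * x)) J \<partial>N)\<bar>"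
        by (intro tendsto_rabs tendsto_diff lim' trunc J)
      moreover have "\<bar>(\<integral>x. exp (t * x) \<partial>M' k) - (\<integral>x. min (exp (t * x)) J \<partial>M' k)\<bar> \<le> C (2 * t) / J" for k
      proof -
        have "\<bar>(\<integral>x. exp (t * x) \<partial>M' k) - (\<integral>x. min (exp (t * x)) J \<partial>M' k)\<bar> \<le> (\<integral>x. exp (2 * t * x) \<partial>M' k) / J"
          by (rule close[OF M' _ J]) (simp add: M'_def int)
        also have "\<dots> \<le> C (2 * t) / J" using C[of "r k" "2 * t"] J by (intro divide_right_mono) (auto simp: M'_def)
        finally show ?thesis .
      qed
      ultimately have "\<bar>L t - (\<integral>x. min (exp (t * x)) J \<partial>N)\<bar> \<le> C (2 * t) / J"
        by (intro LIMSEQ_le_const2) auto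
      moreover have "\<bar>(\<integral>x. exp (t * x) \<partial>N) - (\<integral>x. min (exp (t * x)) J \<partial>N)\<bar> \<le> (\<integral>x. exp (2 * t * x) \<partial>N) / J"
        by (rule close[OF N Nint J])
      ultimately show ?thesis unfolding A_def add_divide_distrib by linarith
    qed
    have "(\<lambda>j. A / real j) \<longlonglongrightarrow> 0" by (rule lim_const_over_n)
    then have "\<bar>(\<integral>x. exp (t * x) \<partial>N) - L t\<bar> \<le> 0"
    proof (rule LIMSEQ_le_const)
      show "\<exists>j0. \<forall>j\<ge>j0. \<bar>(\<integral>x. exp (t * x) \<partial>N) - L t\<bar> \<le> A / real j"
        using le by (intro exI[of _ 1]) auto
    qed
    then show ?thesis by simp
  qed
  then show ?thesis using N Nint by blast
qed

text \<open>Chernoff's bound: the mass of [b + \<eta>, \<infinity>) is at most K exp (- t \<eta>)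
  for every t > 0. Letting t grow makes it 0, and countably many \<eta> exhaust x > b.\<close>

lemma AE_le_of_exponential_moments:
  assumes M: "real_distribution M" and int: "\<And>t. integrable M (\<lambda>x. exp (t * x))"
    and bd: "\<And>t. t > 0 \<Longrightarrow> (\<integral>x. exp (t * x) \<partial>M) \<le> K * exp (t * b)"
  shows "AE x in M. x \<le> b"
proof -
  interpret real_distribution M by (rule M)
  have null: "measure M {x. x \<ge> b + \<eta>} = 0" if \<eta>: "\<eta> > 0" for \<eta>
  proof -
    have le: "measure M {x. x \<ge> b + \<eta>} \<le> K * exp (- t * \<eta>)" if t: "t > 0" for t
    proof -
      have c: "{x. x \<ge> b + \<eta>} \<in> sets M" by simp
      have "exp (t * (b + \<eta>)) * measure M {x. x \<ge> b + \<eta>} = (\<integral>x. exp (t * (b + \<eta>)) * indicator {x. x \<ge> b + \<eta>} x \<partial>M)"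
        using c by simp
      also have "\<dots> \<le> (\<integral>x. exp (t * x) \<partial>M)"
      proof (rule integral_mono)
        show "integrable M (\<lambda>x. exp (t * (b + \<eta>)) * indicator {x. x \<ge> b + \<eta>} x)"
          by (intro integrable_mult_right integrable_real_indicator c) (simp add: emeasure_eq_measure)
      qed (use t in \<open>auto simp: int indicator_def\<close>)
      also have "\<dots> \<le> K * exp (t * b)" by (rule bd[OF t])
      also have "exp (t * b) = exp (t * (b + \<eta>)) * exp (- t * \<eta>)" unfolding exp_add[symmetric] by (simp add: algebra_simps)
      finally have "exp (t * (b + \<eta>)) * measure M {x. x \<ge> b + \<eta>} \<le> exp (t * (b + \<eta>)) * (K * exp (- t * \<eta>))" by (simp add: mult_ac)
      then show ?thesis by simp
    qed
    have "((\<lambda>m. K * exp (- real m * \<eta>)) \<longlonglongrightarrow> K * 0)"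
    proof (intro tendsto_intros)
      have "filterlim (\<lambda>m. \<eta> * real m) at_top sequentially"
        using filterlim_tendsto_pos_mult_at_top[OF tendsto_const \<eta> filterlim_real_sequentially] .
      then have "filterlim (\<lambda>m. - (\<eta> * real m)) at_bot sequentially" by (simp add: filterlim_uminus_at_top)
      from filterlim_compose[OF exp_at_bot this] show "(\<lambda>m. exp (- real m * \<eta>)) \<longlonglongrightarrow> 0" by (simp add: mult.commute)
    qed
    then have "measure M {x. x \<ge> b + \<eta>} \<le> K * 0"
    proof (rule LIMSEQ_le_const)
      show "\<exists>m0. \<forall>m\<ge>m0. measure M {x. x \<ge> b + \<eta>} \<le> K * exp (- real m * \<eta>)"
        using le by (intro exI[of _ 1]) auto
    qed
    then have "measure M {x. x \<ge> b + \<eta>} \<le> 0" by simp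
    then show ?thesis using measure_nonneg by (rule order_antisym)
  qed
  have "AE x in M. \<forall>m::nat. \<not> (x \<ge> b + 1 / (real m + 1))"
    unfolding AE_all_countable
  proof
    fix m :: nat
    have "emeasure M {x. x \<ge> b + 1 / (real m + 1)} = 0" using null[of "1 / (real m + 1)"] by (simp add: emeasure_eq_measure)
    then have "{x. x \<ge> b + 1 / (real m + 1)} \<in> null_sets M" by (intro null_setsI) auto
    from AE_not_in[OF this] show "AE x in M. \<not> (x \<ge> b + 1 / (real m + 1))" by simp
  qed
  then show ?thesis
  proof eventually_elim
    case (elim x)
    show "x \<le> b"
    proof (rule ccontr)
      assume "\<not> x \<le> b"
      then have "0 < x - b" by simp
      then obtain m :: nat where "inverse (of_nat (Suc m)) < x - b" using reals_Archimedean by blast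
      then have "x \<ge> b + 1 / (real m + 1)" by (simp add: inverse_eq_divide add.commute)
      then show False using elim by blast
    qed
  qed
qed

text \<open>If \<Phi> z were the integral of exp (z x) over a measure M, then convolving M with a
  centred normal law of variance \<sigma>^2 would multiply \<Phi> by exp (\<sigma>^2 z^2 / 2) and
  produce a smooth density. This density is written down by Fourier inversion, its non-negativity
  follows from \<open>pos\<close>, and M is recovered for \<sigma> tending to 0. The growth
  indicators \<open>b1\<close> and \<open>bn\<close> become bounds of the support.\<close>

lemma exponential_type_representation:
  fixes \<Phi> :: "complex \<Rightarrow> complex"
  assumes holo: "\<Phi> holomorphic_on UNIV"
    and bd: "\<And>z. norm (\<Phi> z) \<le> K * exp (max (Re z * b1) (Re z * bn))"
    and herm: "\<And>z. \<Phi> (cnj z) = cnj (\<Phi> z)"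
    and pos: "\<And>\<theta> \<delta>. \<delta> > 0 \<Longrightarrow> 0 \<le> Re (LINT r:{0..}|lborel. iexp (r * \<theta>) * of_real (exp (- \<delta> * r)) * \<Phi> (- (\<i> * of_real r)))"
    and \<Phi>0: "Re (\<Phi> 0) > 0" and b1_le_bn: "b1 \<le> bn"
  shows "\<exists>M. real_distribution M \<and> (AE x in M. b1 \<le> x \<and> x \<le> bn) \<and>
    (\<forall>t. integrable M (\<lambda>x. exp (t * x)) \<and> \<Phi> (of_real t) = of_real (Re (\<Phi> 0) * (\<integral>x. exp (t * x) \<partial>M)))"
proof -
  have K: "K \<ge> 0"
    using bd[of 0] order_trans[OF norm_ge_zero[of "\<Phi> 0"]] by simp
  have cont\<Phi>: "continuous_on UNIV \<Phi>" by (rule holomorphic_on_imp_continuous_on[OF holo])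
  define B where "B = max \<bar>b1\<bar> \<bar>bn\<bar>"
  have bdB: "norm (\<Phi> z) \<le> K * exp (\<bar>Re z\<bar> * B)" for z
  proof -
    have "Re z * b1 \<le> \<bar>Re z\<bar> * B" "Re z * bn \<le> \<bar>Re z\<bar> * B"
      using abs_ge_self[of "Re z * b1"] abs_ge_self[of "Re z * bn"]
        mult_left_mono[of "\<bar>b1\<bar>" B "\<bar>Re z\<bar>"] mult_left_mono[of "\<bar>bn\<bar>" B "\<bar>Re z\<bar>"]
      unfolding abs_mult B_def by linarith+
    then have "exp (max (Re z * b1) (Re z * bn)) \<le> exp (\<bar>Re z\<bar> * B)" by simp
    then have "K * exp (max (Re z * b1) (Re z * bn)) \<le> K * exp (\<bar>Re z\<bar> * B)" by (rule mult_left_mono[OF _ K])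
    then show ?thesis using bd[of z] by linarith
  qed
  have imag_cont: "continuous_on UNIV (\<lambda>r. \<Phi> (of_real \<tau> + \<i> * complex_of_real r))" for \<tau>
    by (rule continuous_on_compose2[OF cont\<Phi>]) (intro continuous_intros, simp)
  define h where "h r = \<Phi> (- (\<i> * of_real r))" for r :: real
  have hm: "h \<in> borel_measurable borel"
  proof (rule borel_measurable_continuous_onI)
    show "continuous_on UNIV h" unfolding h_def[abs_def]
      by (rule continuous_on_compose2[OF cont\<Phi>]) (intro continuous_intros, simp)
  qed
  have hK: "norm (h r) \<le> K" for r using bdB[of "- (\<i> * of_real r)"] by (simp add: h_def)
  \<comment> \<open>Fourier inversion for the smoothed measure. Its integrand at -r is the conjugate
    of that at r, so the full line is twice the real part of a half-line; this turns 1 / (2 pi) into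
    1 / pi.\<close>
  define p where "p \<sigma> \<theta> = Re (LINT r:{0..}|lborel. iexp (r * \<theta>) * of_real (exp (- (\<sigma> * r)\<^sup>2 / 2)) * h r) / pi" for \<sigma> \<theta>
  have p_nonneg: "p \<sigma> \<theta> \<ge> 0" if "\<sigma> > 0" for \<sigma> \<theta>
  proof -
    have "0 \<le> Re (LINT r:{0..}|lborel. iexp (r * \<theta>) * of_real (exp (- (\<sigma> * r)\<^sup>2 / 2)) * h r)"
      by (rule poisson_imp_gaussian_positivity[OF hm hK _ that]) (use pos in \<open>simp add: h_def\<close>)
    then show ?thesis unfolding p_def by simp
  qed
  have p_meas: "p \<sigma> \<in> borel_measurable borel" for \<sigma>
  proof -
    note [measurable] = hm
    have "(\<lambda>\<theta>. LBINT r. indicator {0..} r *\<^sub>R (iexp (r * \<theta>) * of_real (exp (- (\<sigma> * r)\<^sup>2 / 2)) * h r)) \<in> borel_measurable borel"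
      by measurable
    then show ?thesis unfolding p_def[abs_def] set_lebesgue_integral_def by measurable
  qed
  \<comment> \<open>The expected transform of the smoothed measure on the line Re z = \<tau>; at r =
    0 it is the exponential moment at \<tau>.\<close>
  define g where "g \<sigma> \<tau> r = exp (of_real (\<sigma>\<^sup>2) * (of_real \<tau> + \<i> * of_real r)\<^sup>2 / 2) * \<Phi> (of_real \<tau> + \<i> * of_real r)" for \<sigma> \<tau> r :: real
  have norm_exp_sq: "norm (exp (of_real (\<sigma>\<^sup>2) * z\<^sup>2 / 2)) = exp (\<sigma>\<^sup>2 * (Re z)\<^sup>2 / 2) * exp (- (\<sigma> * Im z)\<^sup>2 / 2)" for \<sigma> z
  proof -
    have "Re (of_real (\<sigma>\<^sup>2) * z\<^sup>2 / 2) = \<sigma>\<^sup>2 * ((Re z)\<^sup>2 - (Im z)\<^sup>2) / 2"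
      unfolding Re_divide_numeral Re_complex_of_real times_complex.sel by (simp add: power2_eq_square)
    also have "\<dots> = \<sigma>\<^sup>2 * (Re z)\<^sup>2 / 2 + (- (\<sigma> * Im z)\<^sup>2 / 2)" by (simp add: power_mult_distrib field_simps)
    finally show ?thesis unfolding norm_exp_eq_Re exp_add[symmetric] by simp
  qed
  have mgf: "integrable lborel (\<lambda>\<theta>. exp (\<tau> * \<theta>) * p \<sigma> \<theta>)" "of_real (LBINT \<theta>. exp (\<tau> * \<theta>) * p \<sigma> \<theta>) = g \<sigma> \<tau> 0"
    if \<sigma>: "\<sigma> > 0" for \<sigma> \<tau>
  proof -
    have \<sigma>2: "\<sigma> / 2 > 0" using \<sigma> by simp
    have line: "integrable lborel (\<lambda>r. exp (- (of_real \<tau> + \<i> * of_real r) * of_real \<theta>) * g \<sigma> \<tau> r)"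
      "(LBINT r. exp (- (of_real \<tau> + \<i> * of_real r) * of_real \<theta>) * g \<sigma> \<tau> r) = (LBINT r. exp (- (\<i> * of_real r) * of_real \<theta>) * g \<sigma> 0 r)"
      for \<tau> \<theta>
    proof -
      \<comment> \<open>The entire integrand of Fourier inversion. The Gaussian factor dominates the
        exponential growth of the other factors in any vertical strip, so the line may be shifted
        from \<tau> to 0.\<close>
      define F where "F z = exp (- z * of_real \<theta>) * (exp (of_real (\<sigma>\<^sup>2) * z\<^sup>2 / 2) * \<Phi> z)" for z
      have hol: "F holomorphic_on UNIV" unfolding F_def by (intro holomorphic_intros holo) simp_all
      define KK where "KK = exp (\<bar>\<tau>\<bar> * \<bar>\<theta>\<bar>) * (exp (\<sigma>\<^sup>2 * \<tau>\<^sup>2 / 2) * (K * exp (\<bar>\<tau>\<bar> * B)))"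
      have B0: "B \<ge> 0" by (simp add: B_def)
      have "norm (F z) \<le> KK / (1 + (\<sigma> / 2)\<^sup>2 * (Im z)\<^sup>2)" if z: "\<bar>Re z\<bar> \<le> \<bar>\<tau>\<bar>" for z
      proof -
        have n1: "norm (exp (- z * of_real \<theta>)) \<le> exp (\<bar>\<tau>\<bar> * \<bar>\<theta>\<bar>)"
        proof -
          have "- Re z * \<theta> \<le> \<bar>Re z\<bar> * \<bar>\<theta>\<bar>" using abs_ge_self[of "- Re z * \<theta>"] by (simp add: abs_mult)
          also have "\<dots> \<le> \<bar>\<tau>\<bar> * \<bar>\<theta>\<bar>" using z by (intro mult_right_mono) auto
          finally show ?thesis unfolding norm_exp_eq_Re by simp
        qed
        have "(Re z)\<^sup>2 \<le> \<tau>\<^sup>2" using z by (simp add: abs_le_square_iff)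
        then have "\<sigma>\<^sup>2 * (Re z)\<^sup>2 / 2 \<le> \<sigma>\<^sup>2 * \<tau>\<^sup>2 / 2" by (simp add: mult_left_mono)
        then have n2: "exp (\<sigma>\<^sup>2 * (Re z)\<^sup>2 / 2) \<le> exp (\<sigma>\<^sup>2 * \<tau>\<^sup>2 / 2)" by simp
        have "\<bar>Re z\<bar> * B \<le> \<bar>\<tau>\<bar> * B" using z B0 by (intro mult_right_mono) auto
        then have "K * exp (\<bar>Re z\<bar> * B) \<le> K * exp (\<bar>\<tau>\<bar> * B)" using K by (intro mult_left_mono) auto
        then have n3: "norm (\<Phi> z) \<le> K * exp (\<bar>\<tau>\<bar> * B)" using bdB[of z] by linarith
        have n4: "exp (- (\<sigma> * Im z)\<^sup>2 / 2) \<le> 1 / (1 + (\<sigma> / 2)\<^sup>2 * (Im z)\<^sup>2)" by (rule exp_gaussian_le[OF \<sigma>])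
        have "norm (F z) = norm (exp (- z * of_real \<theta>)) * ((exp (\<sigma>\<^sup>2 * (Re z)\<^sup>2 / 2) * norm (\<Phi> z)) * exp (- (\<sigma> * Im z)\<^sup>2 / 2))"
          unfolding F_def norm_mult norm_exp_sq by (simp add: mult_ac)
        also have "\<dots> \<le> exp (\<bar>\<tau>\<bar> * \<bar>\<theta>\<bar>) * ((exp (\<sigma>\<^sup>2 * \<tau>\<^sup>2 / 2) * (K * exp (\<bar>\<tau>\<bar> * B))) * (1 / (1 + (\<sigma> / 2)\<^sup>2 * (Im z)\<^sup>2)))"
          using K by (intro mult_mono n1 n2 n3 n4) auto
        also have "\<dots> = KK / (1 + (\<sigma> / 2)\<^sup>2 * (Im z)\<^sup>2)" by (simp add: KK_def)
        finally show ?thesis .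
      qed
      have sh1: "integrable lborel (\<lambda>r. F (of_real \<tau> + \<i> * of_real r))"
        by (rule integral_vertical_line_shift(1)[OF hol \<sigma>2]) fact
      have sh2: "(LBINT r. F (of_real \<tau> + \<i> * of_real r)) = (LBINT r. F (\<i> * of_real r))"
        by (rule integral_vertical_line_shift(2)[OF hol \<sigma>2]) fact
      show "integrable lborel (\<lambda>r. exp (- (of_real \<tau> + \<i> * of_real r) * of_real \<theta>) * g \<sigma> \<tau> r)"
        using sh1 unfolding F_def g_def .
      show "(LBINT r. exp (- (of_real \<tau> + \<i> * of_real r) * of_real \<theta>) * g \<sigma> \<tau> r) = (LBINT r. exp (- (\<i> * of_real r) * of_real \<theta>) * g \<sigma> 0 r)"
        using sh2 unfolding F_def g_def by simp
    qed
    have p_eq: "(LBINT r. exp (- (\<i> * of_real r) * of_real \<theta>) * g \<sigma> 0 r) = of_real (2 * pi * p \<sigma> \<theta>)" for \<theta>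
    proof -
      define u where "u r = exp (- (\<i> * of_real r) * of_real \<theta>) * g \<sigma> 0 r" for r
      have u: "u r = exp (- (\<i> * of_real r) * of_real \<theta>) * (of_real (exp (- (\<sigma> * r)\<^sup>2 / 2)) * \<Phi> (\<i> * of_real r))" for r
      proof -
        have "of_real (\<sigma>\<^sup>2) * (of_real 0 + \<i> * of_real r)\<^sup>2 / 2 = complex_of_real (- (\<sigma> * r)\<^sup>2 / 2)"
          by (simp add: power_mult_distrib)
        then show ?thesis unfolding u_def g_def exp_of_real[symmetric] by simp
      qed
      have ui: "integrable lborel u" using line(1)[of 0 \<theta>] unfolding u_def by simp
      have uh: "u (- r) = cnj (u r)" for r
        unfolding u using herm[of "\<i> * of_real r"] by (simp add: exp_cnj)
      have um: "u (- r) = iexp (r * \<theta>) * of_real (exp (- (\<sigma> * r)\<^sup>2 / 2)) * h r" for r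
        unfolding u h_def by (simp add: mult.assoc)
      have "(LBINT r. u r) = of_real (2 * Re (LINT r:{0..}|lborel. u (- r)))" by (rule integral_hermitian_function[OF ui uh])
      also have "\<dots> = of_real (2 * pi * p \<sigma> \<theta>)" unfolding um p_def by simp
      finally show ?thesis unfolding u_def .
    qed
    define P where "P \<theta> = exp (\<tau> * \<theta>) * p \<sigma> \<theta>" for \<theta>
    have P0: "P \<theta> \<ge> 0" for \<theta> unfolding P_def using p_nonneg[OF \<sigma>] by simp
    have Pm: "P \<in> borel_measurable borel" unfolding P_def[abs_def] using p_meas[of \<sigma>] by measurable
    have gi: "integrable lborel (g \<sigma> \<tau>)" using line(1)[of \<tau> 0] by simp
    have gc: "continuous_on UNIV (g \<sigma> \<tau>)" unfolding g_def[abs_def] by (intro continuous_intros imag_cont) simp_all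
    have gb: "norm (g \<sigma> \<tau> r) \<le> exp (\<sigma>\<^sup>2 * \<tau>\<^sup>2 / 2) * (K * exp (\<bar>\<tau>\<bar> * B))" for r
    proof -
      have "norm (g \<sigma> \<tau> r) = exp (\<sigma>\<^sup>2 * \<tau>\<^sup>2 / 2) * exp (- (\<sigma> * r)\<^sup>2 / 2) * norm (\<Phi> (of_real \<tau> + \<i> * of_real r))"
        unfolding g_def norm_mult norm_exp_sq by simp
      also have "\<dots> \<le> exp (\<sigma>\<^sup>2 * \<tau>\<^sup>2 / 2) * 1 * (K * exp (\<bar>\<tau>\<bar> * B))"
        using bdB[of "of_real \<tau> + \<i> * of_real r"] K by (intro mult_mono) auto
      finally show ?thesis by simp
    qed
    \<comment> \<open>The shift shows that exp (\<tau> \<theta>) p is the Fourier transform of g on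
      the line Re z = \<tau>. Its integral is thus g at 0, without assuming in advance that the
      exponential moment exists.\<close>
    have PE: "of_real (P \<theta>) = (CLBINT r. iexp (- (r * \<theta>)) * g \<sigma> \<tau> r) / (2 * pi)" for \<theta>
    proof -
      have "exp (- (of_real \<tau> + \<i> * of_real r) * of_real \<theta>) * g \<sigma> \<tau> r = of_real (exp (- \<tau> * \<theta>)) * (iexp (- (r * \<theta>)) * g \<sigma> \<tau> r)" for r
      proof -
        have "exp (- (of_real \<tau> + \<i> * of_real r) * complex_of_real \<theta>) = exp (of_real (- \<tau> * \<theta>)) * iexp (- (r * \<theta>))"
          unfolding exp_add[symmetric] by (simp add: algebra_simps)
        then show ?thesis unfolding exp_of_real by simp
      qed
      then have "of_real (exp (- \<tau> * \<theta>)) * (CLBINT r. iexp (- (r * \<theta>)) * g \<sigma> \<tau> r) = of_real (2 * pi * p \<sigma> \<theta>)"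
        using line(2)[of \<tau> \<theta>] unfolding p_eq by (simp only: integral_mult_right_zero)
      then have "of_real (exp (\<tau> * \<theta>)) * (of_real (exp (- \<tau> * \<theta>)) * (CLBINT r. iexp (- (r * \<theta>)) * g \<sigma> \<tau> r)) = complex_of_real (exp (\<tau> * \<theta>)) * of_real (2 * pi * p \<sigma> \<theta>)"
        by simp
      moreover have "complex_of_real (exp (\<tau> * \<theta>)) * of_real (exp (- \<tau> * \<theta>)) = 1"
        unfolding of_real_mult[symmetric] exp_add[symmetric] by simp
      ultimately have "(CLBINT r. iexp (- (r * \<theta>)) * g \<sigma> \<tau> r) = complex_of_real (exp (\<tau> * \<theta>)) * of_real (2 * pi * p \<sigma> \<theta>)"
        by (simp only: mult.assoc[symmetric] mult_1_left)
      then show ?thesis unfolding P_def by simp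
    qed
    have "integrable lborel P" by (rule integral_nonneg_fourier_transform(1)[OF gi gc gb PE P0 Pm])
    then show "integrable lborel (\<lambda>\<theta>. exp (\<tau> * \<theta>) * p \<sigma> \<theta>)" unfolding P_def .
    have "of_real (LBINT \<theta>. P \<theta>) = g \<sigma> \<tau> 0" by (rule integral_nonneg_fourier_transform(2)[OF gi gc gb PE P0 Pm])
    then show "of_real (LBINT \<theta>. exp (\<tau> * \<theta>) * p \<sigma> \<theta>) = g \<sigma> \<tau> 0" unfolding P_def .
  qed
  have real\<Phi>: "\<Phi> (of_real t) = of_real (Re (\<Phi> (of_real t)))" for t
    using herm[of "of_real t"] by (simp add: complex_eq_iff)
  have mass: "(LBINT \<theta>. exp (\<tau> * \<theta>) * p \<sigma> \<theta>) = exp (\<sigma>\<^sup>2 * \<tau>\<^sup>2 / 2) * Re (\<Phi> (of_real \<tau>))" if "\<sigma> > 0" for \<sigma> \<tau>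
  proof -
    have "complex_of_real (LBINT \<theta>. exp (\<tau> * \<theta>) * p \<sigma> \<theta>) = exp (of_real (\<sigma>\<^sup>2 * \<tau>\<^sup>2 / 2)) * \<Phi> (of_real \<tau>)"
      unfolding mgf(2)[OF that] g_def by simp
    also have "\<dots> = of_real (exp (\<sigma>\<^sup>2 * \<tau>\<^sup>2 / 2) * Re (\<Phi> (of_real \<tau>)))"
      unfolding exp_of_real by (subst real\<Phi>) simp
    finally show ?thesis by (simp only: of_real_eq_iff)
  qed
  \<comment> \<open>The total mass of each smoothed density. Dividing by it gives probability
    measures, to which the selection theorem applies.\<close>
  define m0 where "m0 = Re (\<Phi> 0)"
  have m0: "m0 > 0" using \<Phi>0 by (simp add: m0_def)
  define sg where "sg k = 1 / (real k + 1)" for k :: nat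
  have sg: "sg k > 0" for k by (simp add: sg_def)
  define M where "M k = density lborel (\<lambda>\<theta>. ennreal (p (sg k) \<theta> / m0))" for k
  have pM: "(\<lambda>\<theta>. p (sg k) \<theta> / m0) \<in> borel_measurable borel" for k using p_meas[of "sg k"] by measurable
  have pn: "0 \<le> p (sg k) \<theta> / m0" for k \<theta> using p_nonneg[OF sg, of k \<theta>] m0 by simp
  have M_int: "integrable (M k) (\<lambda>x. exp (t * x))" for k t
  proof -
    have "integrable lborel (\<lambda>\<theta>. (p (sg k) \<theta> / m0) *\<^sub>R exp (t * \<theta>))"
      using integrable_divide[OF mgf(1)[OF sg], of t k m0] by (simp add: mult.commute)
    then show ?thesis unfolding M_def
      by (subst integrable_density) (use pM pn in auto)
  qed
  have M_val: "(\<integral>x. exp (t * x) \<partial>M k) = exp ((sg k)\<^sup>2 * t\<^sup>2 / 2) * Re (\<Phi> (of_real t)) / m0" for k t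
  proof -
    have "(\<integral>x. exp (t * x) \<partial>M k) = (LBINT \<theta>. (p (sg k) \<theta> / m0) *\<^sub>R exp (t * \<theta>))"
      unfolding M_def by (rule integral_density) (use pM pn in auto)
    also have "\<dots> = (LBINT \<theta>. (exp (t * \<theta>) * p (sg k) \<theta>) / m0)"
      by (rule Bochner_Integration.integral_cong) auto
    also have "\<dots> = (LBINT \<theta>. exp (t * \<theta>) * p (sg k) \<theta>) / m0" by (rule integral_divide_zero)
    finally show ?thesis unfolding mass[OF sg] .
  qed
  have M: "real_distribution (M k)" for k
  proof -
    have i: "integrable lborel (\<lambda>\<theta>. p (sg k) \<theta> / m0)" using integrable_divide[OF mgf(1)[OF sg], of 0 k m0] by simp
    have "(LBINT \<theta>. p (sg k) \<theta> / m0) = 1"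
    proof -
      have "(LBINT \<theta>. p (sg k) \<theta> / m0) = (LBINT \<theta>. p (sg k) \<theta>) / m0" by (rule integral_divide_zero)
      also have "(LBINT \<theta>. p (sg k) \<theta>) = m0" using mass[OF sg, of 0 k] by (simp add: m0_def)
      finally show ?thesis using m0 by simp
    qed
    then have "(\<integral>\<^sup>+ \<theta>. ennreal (p (sg k) \<theta> / m0) \<partial>lborel) = 1"
      using nn_integral_eq_integral[OF i] pn by simp
    then have "emeasure (M k) (space (M k)) = 1"
      unfolding M_def using pM by (subst emeasure_density) auto
    then show ?thesis
      by (intro real_distribution.intro real_distribution_axioms.intro prob_spaceI) (auto simp: M_def)
  qed
  have M_lim: "(\<lambda>k. \<integral>x. exp (t * x) \<partial>M k) \<longlonglongrightarrow> Re (\<Phi> (of_real t)) / m0" for t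
  proof -
    have "sg \<longlonglongrightarrow> 0" unfolding sg_def using lim_inverse_n'[THEN LIMSEQ_Suc] by (simp add: add.commute)
    then have "(\<lambda>k. exp ((sg k)\<^sup>2 * t\<^sup>2 / 2) * Re (\<Phi> (of_real t)) / m0) \<longlonglongrightarrow> exp (0\<^sup>2 * t\<^sup>2 / 2) * Re (\<Phi> (of_real t)) / m0"
      using m0 by (intro tendsto_intros) auto
    then show ?thesis unfolding M_val by simp
  qed
  obtain N where N: "real_distribution N" and Ni: "\<And>t. integrable N (\<lambda>x. exp (t * x))"
    and Nv: "\<And>t. (\<integral>x. exp (t * x) \<partial>N) = Re (\<Phi> (of_real t)) / m0"
    using exponential_moments_limit[OF M M_int M_lim] by blast
  have Nb: "(\<integral>x. exp (t * x) \<partial>N) \<le> K / m0 * exp (max (t * b1) (t * bn))" for t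
  proof -
    have "Re (\<Phi> (of_real t)) \<le> K * exp (max (t * b1) (t * bn))"
      using complex_Re_le_cmod[of "\<Phi> (of_real t)"] bd[of "of_real t"] by simp
    then show ?thesis unfolding Nv using m0 by (simp add: divide_right_mono)
  qed
  have up: "AE x in N. x \<le> bn"
  proof (rule AE_le_of_exponential_moments[OF N Ni])
    fix t :: real assume "t > 0"
    then have "max (t * b1) (t * bn) = t * bn" using b1_le_bn by (simp add: max_def)
    then show "(\<integral>x. exp (t * x) \<partial>N) \<le> K / m0 * exp (t * bn)" using Nb[of t] by simp
  qed
  interpret N: real_distribution N by (rule N)
  \<comment> \<open>The lower end of the support is the upper end for the image under x to
    -x.\<close>
  have N': "real_distribution (distr N borel uminus)"
    by (intro real_distribution.intro real_distribution_axioms.intro N.prob_space_distr) auto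
  have "AE x in distr N borel uminus. x \<le> - b1"
  proof (rule AE_le_of_exponential_moments[OF N'])
    show "integrable (distr N borel uminus) (\<lambda>x. exp (t * x))" for t
      by (subst integrable_distr_eq) (use Ni[of "- t"] in auto)
    fix t :: real assume t: "t > 0"
    have "(\<integral>x. exp (t * x) \<partial>distr N borel uminus) = (\<integral>x. exp (- t * x) \<partial>N)"
      by (subst integral_distr) auto
    also have "\<dots> \<le> K / m0 * exp (max (- t * b1) (- t * bn))" by (rule Nb)
    also have "max (- t * b1) (- t * bn) = t * - b1" using b1_le_bn t by (simp add: max_def)
    finally show "(\<integral>x. exp (t * x) \<partial>distr N borel uminus) \<le> K / m0 * exp (t * - b1)" .
  qed
  then have "AE x in N. - x \<le> - b1" by (subst (asm) AE_distr_iff) auto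
  with up have "AE x in N. b1 \<le> x \<and> x \<le> bn" by eventually_elim simp
  moreover have "\<Phi> (of_real t) = of_real (Re (\<Phi> 0) * (\<integral>x. exp (t * x) \<partial>N))" for t
  proof -
    have "Re (\<Phi> 0) * (\<integral>x. exp (t * x) \<partial>N) = Re (\<Phi> (of_real t))" unfolding Nv using m0 by (simp add: m0_def)
    then show ?thesis using real\<Phi>[of t] by simp
  qed
  ultimately show ?thesis using N Ni by blast
qed

section \<open>Hermitian matrices\<close>

lemma index_mult_mat_sum:
  assumes "X \<in> carrier_mat n n" "Y \<in> carrier_mat n n" "i < n" "j < n"
  shows "(X * Y) $$ (i, j) = (\<Sum>l<n. X $$ (i, l) * Y $$ (l, j))"
  using assms by (auto simp: scalar_prod_def lessThan_atLeast0 intro!: sum.cong)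

lemma mat_trace_mult_comm:
  assumes "X \<in> carrier_mat n n" "Y \<in> carrier_mat n n"
  shows "mat_trace (X * Y) = mat_trace (Y * X)"
proof -
  have "mat_trace (X * Y) = (\<Sum>i<n. \<Sum>l<n. X $$ (i, l) * Y $$ (l, i))"
    using assms by (auto simp: mat_trace_def index_mult_mat_sum[OF assms] simp del: index_mult_mat(1) intro!: sum.cong)
  also have "\<dots> = (\<Sum>l<n. \<Sum>i<n. Y $$ (l, i) * X $$ (i, l))"
    by (subst sum.swap) (simp add: mult.commute)
  also have "\<dots> = mat_trace (Y * X)"
    using assms by (auto simp: mat_trace_def index_mult_mat_sum[OF assms(2,1)] simp del: index_mult_mat(1) intro!: sum.cong)
  finally show ?thesis .
qed

text \<open>Entries above the diagonal are left out: those on or below it determine themselves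
  recursively, since only the index l = i contributes to the product.\<close>

lemma upper_triangular_pow_index:
  fixes T :: "complex mat"
  assumes T: "T \<in> carrier_mat n n" "upper_triangular T" and "i < n" "j \<le> i"
  shows "(T ^\<^sub>m k) $$ (i, j) = (if i = j then T $$ (i, i) ^ k else 0)"
  using assms(3,4)
proof (induction k arbitrary: i j)
  case 0
  then show ?case using T by auto
next
  case (Suc k)
  have "(T ^\<^sub>m Suc k) $$ (i, j) = (\<Sum>l<n. (T ^\<^sub>m k) $$ (i, l) * T $$ (l, j))"
    using Suc T by (simp add: index_mult_mat_sum[of _ n] del: index_mult_mat(1))
  also have "\<dots> = (\<Sum>l<n. if l = i then (if i = j then T $$ (i, i) ^ Suc k else 0) else 0)"
  proof (rule sum.cong)
    fix l assume l: "l \<in> {..<n}"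
    consider "l < i" | "l = i" | "l > i" by linarith
    then show "(T ^\<^sub>m k) $$ (i, l) * T $$ (l, j) = (if l = i then (if i = j then T $$ (i, i) ^ Suc k else 0) else 0)"
    proof cases
      case 1
      then show ?thesis using Suc by simp
    next
      case 2
      then show ?thesis using Suc upper_triangularD[OF T(2), of j i] T(1) by auto
    next
      case 3
      then show ?thesis using Suc upper_triangularD[OF T(2), of j l] T(1) l by auto
    qed
  qed simp
  also have "\<dots> = (if i = j then T $$ (i, i) ^ Suc k else 0)" using Suc by simp
  finally show ?case .
qed

text \<open>Schur triangularization rather than diagonalization, because A + z B with non-real z
  need not be diagonalizable. The trace is invariant under the similarity and sees only the diagonal
  of the triangular power.\<close>

lemma mat_trace_pow:
  assumes X: "X \<in> carrier_mat n n" and es: "char_poly X = (\<Prod>e\<leftarrow>es. [:- e, 1:])"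
  shows "mat_trace (X ^\<^sub>m k) = (\<Sum>e\<leftarrow>es. e ^ k)"
proof -
  obtain T P Q where sd: "schur_decomposition X es = (T, P, Q)" by (cases "schur_decomposition X es")
  from schur_decomposition[OF X es sd]
  have sim: "similar_mat_wit X T P Q" and ut: "upper_triangular T" and dg: "diag_mat T = es" by auto
  note c = similar_mat_witD2[OF X sim]
  have Tk: "T ^\<^sub>m k \<in> carrier_mat n n" using c by simp
  have "mat_trace (X ^\<^sub>m k) = mat_trace ((P * T ^\<^sub>m k) * Q)" by (simp add: similar_mat_wit_pow_id[OF sim])
  also have "\<dots> = mat_trace (Q * (P * T ^\<^sub>m k))"
    by (rule mat_trace_mult_comm[of _ n]) (use c Tk in auto)
  also have "Q * (P * T ^\<^sub>m k) = Q * P * T ^\<^sub>m k"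
    by (rule assoc_mult_mat[symmetric, of _ n n _ n _ n]) (use c Tk in auto)
  also have "\<dots> = T ^\<^sub>m k" using c Tk by simp
  also have "mat_trace (T ^\<^sub>m k) = (\<Sum>i<n. T $$ (i, i) ^ k)"
    using c Tk upper_triangular_pow_index[OF c(5) ut] by (auto simp: mat_trace_def intro!: sum.cong)
  also have "\<dots> = (\<Sum>e\<leftarrow>diag_mat T. e ^ k)"
    using c by (simp add: diag_mat_def sum_list_sum_nth lessThan_atLeast0)
  finally show ?thesis by (simp add: dg)
qed

lemma norm_pow_mat_index_le:
  fixes X :: "complex mat"
  assumes X: "X \<in> carrier_mat n n" and m: "\<And>i j. i < n \<Longrightarrow> j < n \<Longrightarrow> norm (X $$ (i, j)) \<le> m"
    and "i < n" "j < n"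
  shows "norm ((X ^\<^sub>m k) $$ (i, j)) \<le> (real n * m) ^ k"
  using assms(3,4)
proof (induction k arbitrary: i j)
  case 0
  then show ?case using X by auto
next
  case (Suc k)
  have m0: "m \<ge> 0" using m[of i j] Suc(2,3) norm_ge_zero order_trans by blast
  have "(X ^\<^sub>m Suc k) $$ (i, j) = (\<Sum>l<n. (X ^\<^sub>m k) $$ (i, l) * X $$ (l, j))"
    using Suc X by (simp add: index_mult_mat_sum[of _ n] del: index_mult_mat(1))
  also have "norm \<dots> \<le> (\<Sum>l<n. (real n * m) ^ k * m)"
    by (rule sum_norm_le) (use Suc m m0 in \<open>auto simp: norm_mult intro!: mult_mono\<close>)
  also have "\<dots> = (real n * m) ^ Suc k" by simp
  finally show ?case .
qed

lemma summable_norm_mat_exp: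
  fixes X :: "complex mat"
  assumes X: "X \<in> carrier_mat n n" and ij: "i < n" "j < n"
  shows "summable (\<lambda>k. (X ^\<^sub>m k) $$ (i, j) / fact k)"
proof -
  define m where "m = (\<Sum>i<n. \<Sum>j<n. norm (X $$ (i, j)))"
  have m: "norm (X $$ (i, j)) \<le> m" if "i < n" "j < n" for i j
  proof -
    have "norm (X $$ (i, j)) \<le> (\<Sum>j<n. norm (X $$ (i, j)))"
      by (rule member_le_sum) (use that in auto)
    also have "\<dots> \<le> m" unfolding m_def
      by (rule member_le_sum[of i _ "\<lambda>i. \<Sum>j<n. norm (X $$ (i, j))"]) (use that in \<open>auto intro: sum_nonneg\<close>)
    finally show ?thesis .
  qed
  show ?thesis
  proof (rule summable_comparison_test)
    show "summable (\<lambda>k. inverse (fact k) * (real n * m) ^ k)" by (rule summable_exp)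
    show "\<exists>N. \<forall>k\<ge>N. norm ((X ^\<^sub>m k) $$ (i, j) / fact k) \<le> inverse (fact k) * (real n * m) ^ k"
      using norm_pow_mat_index_le[OF X m ij] by (auto simp: norm_divide divide_simps mult.commute)
  qed
qed

lemma mat_trace_mat_exp_sums:
  assumes X: "X \<in> carrier_mat n n"
  shows "(\<lambda>k. mat_trace (X ^\<^sub>m k) / fact k) sums mat_trace (mat_exp X)"
proof -
  have "(\<lambda>k. \<Sum>i<n. (X ^\<^sub>m k) $$ (i, i) / fact k) sums (\<Sum>i<n. \<Sum>k. (X ^\<^sub>m k) $$ (i, i) / fact k)"
    by (rule sums_sum) (use summable_norm_mat_exp[OF X] in \<open>auto intro: summable_sums\<close>)
  moreover have "mat_trace (mat_exp X) = (\<Sum>i<n. \<Sum>k. (X ^\<^sub>m k) $$ (i, i) / fact k)"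
    using X by (simp add: mat_trace_def mat_exp_def)
  ultimately show ?thesis using X by (simp add: mat_trace_def sum_divide_distrib)
qed

lemma mat_trace_mat_exp:
  assumes X: "X \<in> carrier_mat n n" and es: "char_poly X = (\<Prod>e\<leftarrow>es. [:- e, 1:])"
  shows "mat_trace (mat_exp X) = (\<Sum>e\<leftarrow>es. exp e)"
proof (rule sums_unique2[OF mat_trace_mat_exp_sums[OF X]])
  have "(\<lambda>k. (\<Sum>e\<leftarrow>es. e ^ k) / fact k) sums (\<Sum>e\<leftarrow>es. exp e)" for es :: "complex list"
  proof (induction es)
    case (Cons e es)
    have "(\<lambda>k. e ^ k / fact k) sums exp e"
      using exp_converges[of e] by (simp add: scaleR_conv_of_real field_simps)
    from sums_add[OF this Cons] show ?case by (simp add: add_divide_distrib)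
  qed (simp add: sums_zero)
  then show "(\<lambda>k. mat_trace (X ^\<^sub>m k) / fact k) sums (\<Sum>e\<leftarrow>es. exp e)"
    by (simp add: mat_trace_pow[OF X es])
qed

section \<open>Rayleigh quotients of Hermitian matrices\<close>

lemma hermitian_mat_index:
  assumes "hermitian_mat M" "M \<in> carrier_mat n n" "i < n" "j < n"
  shows "cnj (M $$ (i, j)) = M $$ (j, i)"
proof -
  have "M $$ (j, i) = mat_adjoint M $$ (j, i)" using assms(1) by (simp add: hermitian_mat_def)
  also have "\<dots> = cnj (M $$ (i, j))" using assms by (simp add: mat_adjoint_def mat_of_rows_def)
  finally show ?thesis by simp
qed

text \<open>Eigenvectors become plain functions, used only below n, so that quadratic forms are
  finite sums without carrier conditions.\<close>

lemma eigenvalue_iff_sum: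
  fixes M :: "complex mat"
  assumes M: "M \<in> carrier_mat n n"
  shows "eigenvalue M l \<longleftrightarrow>
    (\<exists>\<xi>. (\<exists>i<n. \<xi> i \<noteq> 0) \<and> (\<forall>i<n. (\<Sum>j<n. M $$ (i, j) * \<xi> j) = l * \<xi> i))"
proof
  assume "eigenvalue M l"
  then obtain v where v: "v \<in> carrier_vec n" "v \<noteq> 0\<^sub>v n" "M *\<^sub>v v = l \<cdot>\<^sub>v v"
    using M unfolding eigenvalue_def eigenvector_def by auto
  have 1: "\<exists>i<n. v $ i \<noteq> 0" using v(1,2) by (metis eq_vecI carrier_vecD index_zero_vec)
  have 2: "(\<Sum>j<n. M $$ (i, j) * v $ j) = l * v $ i" if "i < n" for i
  proof -
    have "(\<Sum>j<n. M $$ (i, j) * v $ j) = (M *\<^sub>v v) $ i"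
      using that M v(1) by (auto simp: scalar_prod_def lessThan_atLeast0 intro!: sum.cong)
    also have "\<dots> = l * v $ i" using v that by simp
    finally show ?thesis .
  qed
  show "\<exists>\<xi>. (\<exists>i<n. \<xi> i \<noteq> 0) \<and> (\<forall>i<n. (\<Sum>j<n. M $$ (i, j) * \<xi> j) = l * \<xi> i)"
    by (rule exI[of _ "\<lambda>i. v $ i"]) (use 1 2 in auto)
next
  assume "\<exists>\<xi>. (\<exists>i<n. \<xi> i \<noteq> 0) \<and> (\<forall>i<n. (\<Sum>j<n. M $$ (i, j) * \<xi> j) = l * \<xi> i)"
  then obtain \<xi> i0 where \<xi>: "i0 < n" "\<xi> i0 \<noteq> 0" "\<And>i. i < n \<Longrightarrow> (\<Sum>j<n. M $$ (i, j) * \<xi> j) = l * \<xi> i" by blast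
  define v where "v = vec n \<xi>"
  have "v \<noteq> 0\<^sub>v n" using \<xi>(1,2) unfolding v_def by (metis index_vec index_zero_vec(1))
  moreover have "M *\<^sub>v v = l \<cdot>\<^sub>v v"
  proof (rule eq_vecI)
    fix i assume "i < dim_vec (l \<cdot>\<^sub>v v)"
    then have i: "i < n" by (simp add: v_def)
    have "(M *\<^sub>v v) $ i = (\<Sum>j<n. M $$ (i, j) * \<xi> j)"
      using i M by (auto simp: v_def scalar_prod_def lessThan_atLeast0 intro!: sum.cong)
    then show "(M *\<^sub>v v) $ i = (l \<cdot>\<^sub>v v) $ i" using \<xi>(3)[OF i] i by (simp add: v_def)
  qed (use M in \<open>simp add: v_def\<close>)
  ultimately show "eigenvalue M l"
    using M unfolding eigenvalue_def eigenvector_def by (auto intro!: exI[of _ v] simp: v_def)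
qed

text \<open>The quadratic form of M at \<xi>; divided by the squared norm of \<xi> it is the
  Rayleigh quotient.\<close>

definition sesq :: "nat \<Rightarrow> complex mat \<Rightarrow> (nat \<Rightarrow> complex) \<Rightarrow> complex" where
  "sesq n M \<xi> = (\<Sum>i<n. cnj (\<xi> i) * (\<Sum>j<n. M $$ (i, j) * \<xi> j))"

lemma sesq_hermitian_Reals:
  assumes "hermitian_mat M" "M \<in> carrier_mat n n"
  shows "sesq n M \<xi> \<in> \<real>"
proof -
  have "cnj (sesq n M \<xi>) = (\<Sum>i<n. \<Sum>j<n. \<xi> i * (cnj (M $$ (i, j)) * cnj (\<xi> j)))"
    by (simp add: sesq_def sum_distrib_left)
  also have "\<dots> = (\<Sum>i<n. \<Sum>j<n. \<xi> i * (M $$ (j, i) * cnj (\<xi> j)))"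
    by (intro sum.cong refl) (use hermitian_mat_index[OF assms] in simp)
  also have "\<dots> = (\<Sum>j<n. \<Sum>i<n. \<xi> i * (M $$ (j, i) * cnj (\<xi> j)))" by (rule sum.swap)
  also have "\<dots> = sesq n M \<xi>" by (simp add: sesq_def sum_distrib_left mult_ac)
  finally show ?thesis by (simp add: Reals_cnj_iff)
qed

lemma sesq_eigen:
  assumes "\<forall>i<n. (\<Sum>j<n. M $$ (i, j) * \<xi> j) = l * \<xi> i"
  shows "sesq n M \<xi> = l * of_real (\<Sum>i<n. (norm (\<xi> i))\<^sup>2)"
proof -
  have "sesq n M \<xi> = (\<Sum>i<n. l * (\<xi> i * cnj (\<xi> i)))"
    unfolding sesq_def using assms by (intro sum.cong) auto
  also have "\<dots> = (\<Sum>i<n. l * of_real ((norm (\<xi> i))\<^sup>2))" by (simp add: complex_norm_square del: of_real_power)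
  finally show ?thesis by (simp add: sum_distrib_left)
qed

lemma norm_sesq_le:
  "norm (sesq n M \<xi>) \<le> (\<Sum>i<n. \<Sum>j<n. norm (M $$ (i, j))) * (\<Sum>i<n. (norm (\<xi> i))\<^sup>2)"
proof -
  define N where "N = (\<Sum>i<n. (norm (\<xi> i))\<^sup>2)"
  have N: "norm (\<xi> i) * norm (\<xi> j) \<le> N" if "i < n" "j < n" for i j
  proof -
    have le: "(norm (\<xi> i))\<^sup>2 \<le> N" if "i < n" for i
      unfolding N_def by (rule member_le_sum) (use that in auto)
    have "2 * (norm (\<xi> i) * norm (\<xi> j)) \<le> (norm (\<xi> i))\<^sup>2 + (norm (\<xi> j))\<^sup>2"
      using sum_squares_bound[of "norm (\<xi> i)" "norm (\<xi> j)"] by (simp add: mult.assoc)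
    then show ?thesis using le[OF that(1)] le[OF that(2)] by linarith
  qed
  have "norm (sesq n M \<xi>) = norm (\<Sum>i<n. \<Sum>j<n. cnj (\<xi> i) * (M $$ (i, j) * \<xi> j))"
    by (simp add: sesq_def sum_distrib_left)
  also have "\<dots> \<le> (\<Sum>i<n. \<Sum>j<n. norm (M $$ (i, j)) * N)"
  proof (intro sum_norm_le)
    fix i j assume "i \<in> {..<n}" "j \<in> {..<n}"
    then have "norm (M $$ (i, j)) * (norm (\<xi> i) * norm (\<xi> j)) \<le> norm (M $$ (i, j)) * N"
      by (intro mult_left_mono N) auto
    then show "norm (cnj (\<xi> i) * (M $$ (i, j) * \<xi> j)) \<le> norm (M $$ (i, j)) * N"
      by (simp add: norm_mult mult_ac)
  qed
  finally show ?thesis by (simp add: N_def sum_distrib_right)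
qed

lemma sum_norm_square_pos:
  fixes \<xi> :: "nat \<Rightarrow> complex"
  assumes "\<exists>i<n. \<xi> i \<noteq> 0" shows "(\<Sum>i<n. (norm (\<xi> i))\<^sup>2) > 0"
proof -
  obtain i where "i < n" "\<xi> i \<noteq> 0" using assms by blast
  then show ?thesis by (intro sum_pos2[of _ i]) auto
qed

lemma hermitian_eigenvalue_real:
  assumes "hermitian_mat M" "M \<in> carrier_mat n n" "eigenvalue M l"
  shows "l \<in> \<real>"
proof -
  obtain \<xi> where \<xi>: "\<exists>i<n. \<xi> i \<noteq> 0" "\<forall>i<n. (\<Sum>j<n. M $$ (i, j) * \<xi> j) = l * \<xi> i"
    using assms eigenvalue_iff_sum by blast
  define N where "N = (\<Sum>i<n. (norm (\<xi> i))\<^sup>2)"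
  have "N > 0" using sum_norm_square_pos[OF \<xi>(1)] by (simp add: N_def)
  moreover have "l * of_real N \<in> \<real>"
    using sesq_hermitian_Reals[OF assms(1,2), of \<xi>] sesq_eigen[OF \<xi>(2)] by (simp add: N_def)
  then have "l * of_real N / of_real N \<in> \<real>" by (intro Reals_divide) auto
  ultimately show ?thesis by simp
qed

lemma Cauchy_Schwarz_complex_sum:
  fixes x y :: "nat \<Rightarrow> complex"
  shows "(norm (\<Sum>i<n. cnj (x i) * y i))\<^sup>2 \<le> (\<Sum>i<n. (norm (x i))\<^sup>2) * (\<Sum>i<n. (norm (y i))\<^sup>2)"
proof -
  have "norm (\<Sum>i<n. cnj (x i) * y i) \<le> (\<Sum>i<n. norm (x i) * norm (y i))"
    by (rule sum_norm_le) (simp add: norm_mult)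
  also have "\<dots> \<le> L2_set (\<lambda>i. norm (x i)) {..<n} * L2_set (\<lambda>i. norm (y i)) {..<n}"
    using L2_set_mult_ineq[of "\<lambda>i. norm (x i)" "\<lambda>i. norm (y i)" "{..<n}"] by simp
  finally have "(norm (\<Sum>i<n. cnj (x i) * y i))\<^sup>2 \<le> (L2_set (\<lambda>i. norm (x i)) {..<n} * L2_set (\<lambda>i. norm (y i)) {..<n})\<^sup>2"
    by (intro power_mono) auto
  then show ?thesis by (simp add: power_mult_distrib L2_set_def sum_nonneg)
qed

text \<open>For Hermitian C the squared norms w k of C^k \<xi> are log-convex by Cauchy-Schwarz. A
  bounded log-convex sequence cannot start by increasing, so |C \<xi>| \<le> |\<xi>|, and
  Cauchy-Schwarz bounds the form. This takes the place of an orthonormal eigenbasis.\<close>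

lemma sesq_hermitian_power_bounded:
  assumes herm: "hermitian_mat C" and C: "C \<in> carrier_mat n n"
    and bd: "\<And>k i j. i < n \<Longrightarrow> j < n \<Longrightarrow> norm ((C ^\<^sub>m k) $$ (i, j)) \<le> c"
  shows "norm (sesq n C \<xi>) \<le> (\<Sum>i<n. (norm (\<xi> i))\<^sup>2)"
proof -
  define F :: "(nat \<Rightarrow> complex) \<Rightarrow> nat \<Rightarrow> complex" where "F = (\<lambda>x i. \<Sum>j<n. C $$ (i, j) * x j)"
  define x where "x k = (F ^^ k) \<xi>" for k
  define w where "w k = (\<Sum>i<n. (norm (x k i))\<^sup>2)" for k
  have sym: "(\<Sum>i<n. cnj (F u i) * z i) = (\<Sum>i<n. cnj (u i) * F z i)" for u z
  proof -
    have "(\<Sum>i<n. cnj (F u i) * z i) = (\<Sum>i<n. \<Sum>j<n. cnj (C $$ (i, j)) * cnj (u j) * z i)"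
      by (simp add: F_def sum_distrib_right)
    also have "\<dots> = (\<Sum>i<n. \<Sum>j<n. C $$ (j, i) * cnj (u j) * z i)"
      by (intro sum.cong refl) (use hermitian_mat_index[OF herm C] in simp)
    also have "\<dots> = (\<Sum>j<n. \<Sum>i<n. C $$ (j, i) * cnj (u j) * z i)" by (rule sum.swap)
    also have "\<dots> = (\<Sum>i<n. cnj (u i) * F z i)" by (simp add: F_def sum_distrib_left mult_ac)
    finally show ?thesis .
  qed
  have xS: "x (Suc k) = F (x k)" for k by (simp add: x_def)
  have wc: "complex_of_real (w k) = (\<Sum>i<n. cnj (x k i) * x k i)" for k
    by (simp add: w_def complex_norm_square mult.commute del: of_real_power)
  have w0: "w k \<ge> 0" for k by (simp add: w_def sum_nonneg)
  \<comment> \<open>Symmetry of C shifts one application from left to right: the inner product of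
    C^(k+1) \<xi> with itself is that of C^k \<xi> with C^(k+2) \<xi>.\<close>
  have lc: "(w (Suc k))\<^sup>2 \<le> w k * w (Suc (Suc k))" for k
  proof -
    have "complex_of_real (w (Suc k)) = (\<Sum>i<n. cnj (x k i) * x (Suc (Suc k)) i)"
      unfolding wc by (simp add: xS sym)
    then have "(norm (complex_of_real (w (Suc k))))\<^sup>2 \<le> w k * w (Suc (Suc k))"
      unfolding w_def using Cauchy_Schwarz_complex_sum[of "x k" "x (Suc (Suc k))" n] by simp
    then show ?thesis by simp
  qed
  have pw: "(F ^^ k) z i = (\<Sum>j<n. (C ^\<^sub>m k) $$ (i, j) * z j)" if "i < n" for k z i
    using that
  proof (induction k arbitrary: z)
    case 0
    have "(\<Sum>j<n. (C ^\<^sub>m 0) $$ (i, j) * z j) = (\<Sum>j<n. if j = i then z j else 0)"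
      by (rule sum.cong) (use C 0 in auto)
    then show ?case using 0 by simp
  next
    case (Suc k)
    have "(F ^^ Suc k) z i = (F ^^ k) (F z) i" by (simp only: funpow_Suc_right o_def)
    also have "\<dots> = (\<Sum>j<n. \<Sum>l<n. (C ^\<^sub>m k) $$ (i, j) * C $$ (j, l) * z l)"
      by (subst Suc) (use Suc in \<open>auto simp: F_def sum_distrib_left mult.assoc\<close>)
    also have "\<dots> = (\<Sum>l<n. \<Sum>j<n. (C ^\<^sub>m k) $$ (i, j) * C $$ (j, l) * z l)" by (rule sum.swap)
    also have "\<dots> = (\<Sum>l<n. (C ^\<^sub>m Suc k) $$ (i, l) * z l)"
      using C Suc by (simp add: index_mult_mat_sum[of _ n] sum_distrib_right del: index_mult_mat(1))
    finally show ?case .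
  qed
  define K where "K = real n * (c * (\<Sum>j<n. norm (\<xi> j)))\<^sup>2"
  have wK: "w k \<le> K" for k
  proof -
    have "norm (x k i) \<le> c * (\<Sum>j<n. norm (\<xi> j))" if "i < n" for i
    proof -
      have "norm (x k i) \<le> (\<Sum>j<n. c * norm (\<xi> j))"
        unfolding x_def pw[OF that]
        by (rule sum_norm_le) (use bd that in \<open>auto simp: norm_mult intro!: mult_right_mono\<close>)
      then show ?thesis by (simp add: sum_distrib_left)
    qed
    then have "w k \<le> (\<Sum>i<n. (c * (\<Sum>j<n. norm (\<xi> j)))\<^sup>2)"
      unfolding w_def by (intro sum_mono power_mono) auto
    then show ?thesis by (simp add: K_def)
  qed
  have w10: "w 1 \<le> w 0"
  proof (rule ccontr)
    assume "\<not> w 1 \<le> w 0"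
    then have gt: "w 1 > w 0" by simp
    have w0p: "w 0 > 0"
    proof (rule ccontr)
      assume "\<not> w 0 > 0"
      then have "w 0 = 0" using w0[of 0] by simp
      then have "(w 1)\<^sup>2 \<le> 0" using lc[of 0] by simp
      then show False using gt \<open>w 0 = 0\<close> by simp
    qed
    \<comment> \<open>By log-convexity the ratios w (k + 1) / w k never fall below the first one, so
      w grows at least geometrically, against the bound \<open>K\<close>.\<close>
    define q where "q = w 1 / w 0"
    have q: "q > 1" using gt w0p by (simp add: q_def)
    have step: "w k > 0 \<and> w (Suc k) \<ge> q * w k" for k
    proof (induction k)
      case 0
      then show ?case using w0p by (simp add: q_def)
    next
      case (Suc k)
      have p: "w (Suc k) > 0" using Suc q by (smt (verit) mult_pos_pos)
      have "w (Suc k) * (q * w k) \<le> w (Suc k) * w (Suc k)" using Suc p by (intro mult_left_mono) auto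
      also have "\<dots> \<le> w k * w (Suc (Suc k))" using lc[of k] by (simp add: power2_eq_square)
      finally have "w k * (q * w (Suc k)) \<le> w k * w (Suc (Suc k))" by (simp add: mult_ac)
      then have "q * w (Suc k) \<le> w (Suc (Suc k))" using Suc by simp
      then show ?case using p by simp
    qed
    have ge: "w k \<ge> q ^ k * w 0" for k
    proof (induction k)
      case (Suc k)
      have "q ^ Suc k * w 0 \<le> q * w k" using Suc q by (simp add: mult.assoc)
      then show ?case using step[of k] by linarith
    qed simp
    obtain k where "q ^ k > K / w 0" using real_arch_pow[OF q] by blast
    then have "q ^ k * w 0 > K" using w0p by (simp add: divide_less_eq)
    then show False using ge[of k] wK[of k] by linarith
  qed
  have "sesq n C \<xi> = (\<Sum>i<n. cnj (x 0 i) * x 1 i)" by (simp add: sesq_def x_def F_def)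
  then have "(norm (sesq n C \<xi>))\<^sup>2 \<le> w 0 * w 1"
    unfolding w_def using Cauchy_Schwarz_complex_sum[of "x 0" "x 1" n] by simp
  also have "\<dots> \<le> (w 0)\<^sup>2" using w10 w0[of 0] by (simp add: power2_eq_square mult_left_mono)
  finally have "norm (sesq n C \<xi>) \<le> w 0" using w0[of 0] by (rule power2_le_imp_le)
  then show ?thesis by (simp add: w_def x_def)
qed

lemma sum_if_smult:
  fixes i n :: nat
  assumes "i < n"
  shows "(\<Sum>j<n. (if i = j then c else 0) * x j) = c * (x i :: complex)"
proof -
  have "(\<Sum>j<n. (if i = j then c else 0) * x j) = (\<Sum>j<n. if j = i then c * x j else 0)"
    by (rule sum.cong) auto
  then show ?thesis using assms by simp
qed

text \<open>B is shifted by the midpoint m of [b1, bn] and divided by slightly more than the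
  half-length h. The spectral radius then is below 1, powers stay bounded by the Jordan normal form
  estimate, and the previous bound on the form translates back.\<close>

lemma sesq_hermitian_between:
  assumes herm: "hermitian_mat B" and B: "B \<in> carrier_mat n n"
    and ev: "\<And>x. eigenvalue B (of_real x) \<Longrightarrow> b1 \<le> x \<and> x \<le> bn" and le: "b1 \<le> bn"
  defines "N \<equiv> \<lambda>\<xi>. \<Sum>i<n. (norm (\<xi> i))\<^sup>2"
  shows "b1 * N \<xi> \<le> Re (sesq n B \<xi>)" "Re (sesq n B \<xi>) \<le> bn * N \<xi>"
proof -
  define m where "m = (b1 + bn) / 2"
  define h where "h = (bn - b1) / 2"
  have h0: "h \<ge> 0" using le by (simp add: h_def)
  have N0: "N \<xi> \<ge> 0" by (simp add: N_def sum_nonneg)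
  \<comment> \<open>The slack \<eta> makes the spectral radius strictly less than 1 and the scaling
    meaningful also for h = 0; it is removed at the end.\<close>
  have key: "\<bar>Re (sesq n B \<xi>) - m * N \<xi>\<bar> \<le> (h + \<eta>) * N \<xi>" if \<eta>: "\<eta> > 0" for \<eta>
  proof -
    define k where "k = 1 / (h + \<eta>)"
    have k: "k > 0" "k * (h + \<eta>) = 1" using h0 \<eta> by (auto simp: k_def)
    define C where "C = mat n n (\<lambda>(i, j). of_real k * (B $$ (i, j) - (if i = j then of_real m else 0)))"
    have C: "C \<in> carrier_mat n n" by (simp add: C_def)
    have CF: "(\<Sum>j<n. C $$ (i, j) * x j) = of_real k * ((\<Sum>j<n. B $$ (i, j) * x j) - of_real m * x i)"
      if "i < n" for i x
    proof -
      have "(\<Sum>j<n. C $$ (i, j) * x j) = (\<Sum>j<n. of_real k * (B $$ (i, j) * x j - (if i = j then of_real m else 0) * x j))"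
        by (rule sum.cong) (use that in \<open>auto simp: C_def algebra_simps\<close>)
      also have "\<dots> = of_real k * ((\<Sum>j<n. B $$ (i, j) * x j) - of_real m * x i)"
        unfolding sum_distrib_left[symmetric] sum_subtractf sum_if_smult[OF that] ..
      finally show ?thesis .
    qed
    have hC: "hermitian_mat C"
      unfolding hermitian_mat_def
      by (rule eq_matI) (use hermitian_mat_index[OF herm B] in \<open>auto simp: C_def mat_adjoint_def mat_of_rows_def\<close>)
    have evC: "norm l < 1" if l: "eigenvalue C l" for l
    proof -
      obtain x where x: "\<exists>i<n. x i \<noteq> 0" "\<forall>i<n. (\<Sum>j<n. C $$ (i, j) * x j) = l * x i"
        using l eigenvalue_iff_sum[OF C] by blast
      have "(\<Sum>j<n. B $$ (i, j) * x j) = (l / of_real k + of_real m) * x i" if "i < n" for i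
        using x(2) CF[OF that, of x] that k(1) by (auto simp: field_simps)
      then have eB: "eigenvalue B (l / of_real k + of_real m)" using x(1) eigenvalue_iff_sum[OF B] by blast
      obtain y where y: "l / of_real k + of_real m = complex_of_real y"
        using hermitian_eigenvalue_real[OF herm B eB] by (auto elim: Reals_cases)
      have "b1 \<le> y" "y \<le> bn" using ev[of y] eB y by auto
      then have ym: "\<bar>y - m\<bar> \<le> h" by (auto simp: m_def h_def abs_le_iff field_simps)
      have "l = of_real (k * (y - m))" using y k(1) by (auto simp: field_simps)
      then have "norm l = k * \<bar>y - m\<bar>" using k(1) by (simp add: abs_mult del: of_real_mult of_real_diff)
      also have "\<dots> < k * (h + \<eta>)" using ym \<eta> k(1) by (intro mult_strict_left_mono) auto
      finally show ?thesis using k by simp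
    qed
    \<comment> \<open>For n = 0 the spectrum is empty and has no maximum, so this case is
      separate.\<close>
    have "\<exists>c. \<forall>k. norm_bound (C ^\<^sub>m k) c"
    proof (cases "n = 0")
      case True
      then show ?thesis using C by (auto simp: norm_bound_def)
    next
      case False
      have "spectral_radius C < 1"
        using spectral_radius_mem_max(1)[OF C] False evC by (auto simp: spectrum_def)
      then show ?thesis using spectral_radius_jnf_norm_bound_less_1_upper_triangular[OF C] by blast
    qed
    then obtain c where c: "\<And>k. norm_bound (C ^\<^sub>m k) c" by blast
    have bd: "norm ((C ^\<^sub>m k) $$ (i, j)) \<le> c" if "i < n" "j < n" for i j k
      using c[of k] that C unfolding norm_bound_def by (auto simp: pow_mat_dim_square[OF C])
    have nrm: "norm (sesq n C \<xi>) \<le> N \<xi>"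
      unfolding N_def by (rule sesq_hermitian_power_bounded[OF hC C bd])
    have "sesq n C \<xi> = of_real k * (sesq n B \<xi> - of_real m * of_real (N \<xi>))"
    proof -
      have "sesq n C \<xi> = (\<Sum>i<n. of_real k * (cnj (\<xi> i) * (\<Sum>j<n. B $$ (i, j) * \<xi> j) - of_real m * (\<xi> i * cnj (\<xi> i))))"
        unfolding sesq_def by (rule sum.cong, simp, simp only: CF lessThan_iff, simp add: algebra_simps)
      also have "\<dots> = of_real k * (sesq n B \<xi> - of_real m * (\<Sum>i<n. \<xi> i * cnj (\<xi> i)))"
        unfolding sum_distrib_left[symmetric] sum_subtractf sesq_def ..
      also have "(\<Sum>i<n. \<xi> i * cnj (\<xi> i)) = of_real (N \<xi>)"
        by (simp add: N_def complex_norm_square del: of_real_power)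
      finally show ?thesis .
    qed
    then have "k * \<bar>Re (sesq n B \<xi>) - m * N \<xi>\<bar> \<le> norm (sesq n C \<xi>)"
      using abs_Re_le_cmod[of "sesq n C \<xi>"] k(1) by (simp add: abs_mult)
    then have "k * \<bar>Re (sesq n B \<xi>) - m * N \<xi>\<bar> \<le> N \<xi>" using nrm by linarith
    then have "\<bar>Re (sesq n B \<xi>) - m * N \<xi>\<bar> \<le> N \<xi> / k" using k(1) by (simp add: field_simps)
    also have "N \<xi> / k = (h + \<eta>) * N \<xi>" by (simp add: k_def)
    finally show ?thesis .
  qed
  have "\<bar>Re (sesq n B \<xi>) - m * N \<xi>\<bar> \<le> h * N \<xi>"
  proof (rule field_le_epsilon)
    \<comment> \<open>The slack e / (\<open>N \<xi>\<close> + 1) contributes at most e after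
      multiplication by \<open>N \<xi>\<close>, and it is well defined when \<open>N \<xi>\<close> =
      0.\<close>
    fix e :: real assume e: "e > 0"
    have "\<bar>Re (sesq n B \<xi>) - m * N \<xi>\<bar> \<le> (h + e / (N \<xi> + 1)) * N \<xi>"
      by (rule key) (use e N0 in simp)
    also have "\<dots> = h * N \<xi> + e * (N \<xi> / (N \<xi> + 1))" by (simp add: algebra_simps)
    also have "e * (N \<xi> / (N \<xi> + 1)) \<le> e * 1" using e N0 by (intro mult_left_mono) auto
    finally show "\<bar>Re (sesq n B \<xi>) - m * N \<xi>\<bar> \<le> h * N \<xi> + e" by simp
  qed
  moreover have "m * N \<xi> + h * N \<xi> = bn * N \<xi>" "m * N \<xi> - h * N \<xi> = b1 * N \<xi>"
    by (simp_all add: m_def h_def algebra_simps flip: add_divide_distrib diff_divide_distrib)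
  ultimately show "b1 * N \<xi> \<le> Re (sesq n B \<xi>)" "Re (sesq n B \<xi>) \<le> bn * N \<xi>" by linarith+
qed

text \<open>Pairing the eigenvector equation with the eigenvector itself makes a and b the Rayleigh
  quotients of A and B at the same vector. Both are real for every complex z, although A + z B is
  not Hermitian in general. For b the sharp interval is kept, as it determines the support; for a a
  bound uniform in z suffices.\<close>

lemma eigenvalue_hermitian_pencil:
  assumes hA: "hermitian_mat A" and A: "A \<in> carrier_mat n n"
    and hB: "hermitian_mat B" and B: "B \<in> carrier_mat n n"
    and ev: "\<And>x. eigenvalue B (of_real x) \<Longrightarrow> b1 \<le> x \<and> x \<le> bn" and le: "b1 \<le> bn"
    and l: "eigenvalue (A + z \<cdot>\<^sub>m B) l"
  obtains a b :: real where "\<bar>a\<bar> \<le> (\<Sum>i<n. \<Sum>j<n. norm (A $$ (i, j)))" "b1 \<le> b" "b \<le> bn"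
    "l = of_real a + z * of_real b"
proof -
  have AB: "A + z \<cdot>\<^sub>m B \<in> carrier_mat n n" using A B by simp
  obtain \<xi> where \<xi>: "\<exists>i<n. \<xi> i \<noteq> 0" "\<forall>i<n. (\<Sum>j<n. (A + z \<cdot>\<^sub>m B) $$ (i, j) * \<xi> j) = l * \<xi> i"
    using l eigenvalue_iff_sum[OF AB] by blast
  define N where "N = (\<Sum>i<n. (norm (\<xi> i))\<^sup>2)"
  have N: "N > 0" using sum_norm_square_pos[OF \<xi>(1)] by (simp add: N_def)
  have split: "sesq n (A + z \<cdot>\<^sub>m B) \<xi> = sesq n A \<xi> + z * sesq n B \<xi>"
  proof -
    have "sesq n (A + z \<cdot>\<^sub>m B) \<xi> = (\<Sum>i<n. cnj (\<xi> i) * (\<Sum>j<n. A $$ (i, j) * \<xi> j) + z * (cnj (\<xi> i) * (\<Sum>j<n. B $$ (i, j) * \<xi> j)))"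
      unfolding sesq_def
    proof (rule sum.cong)
      fix i assume "i \<in> {..<n}"
      then have "(\<Sum>j<n. (A + z \<cdot>\<^sub>m B) $$ (i, j) * \<xi> j) = (\<Sum>j<n. A $$ (i, j) * \<xi> j + z * (B $$ (i, j) * \<xi> j))"
        using A B by (intro sum.cong) (auto simp: algebra_simps)
      then have "(\<Sum>j<n. (A + z \<cdot>\<^sub>m B) $$ (i, j) * \<xi> j) = (\<Sum>j<n. A $$ (i, j) * \<xi> j) + z * (\<Sum>j<n. B $$ (i, j) * \<xi> j)"
        by (simp add: sum.distrib sum_distrib_left)
      then show "cnj (\<xi> i) * (\<Sum>j<n. (A + z \<cdot>\<^sub>m B) $$ (i, j) * \<xi> j) =
        cnj (\<xi> i) * (\<Sum>j<n. A $$ (i, j) * \<xi> j) + z * (cnj (\<xi> i) * (\<Sum>j<n. B $$ (i, j) * \<xi> j))"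
        by (simp add: algebra_simps)
    qed simp
    then show ?thesis by (simp add: sesq_def sum.distrib sum_distrib_left)
  qed
  define a b where "a = Re (sesq n A \<xi>) / N" and "b = Re (sesq n B \<xi>) / N"
  have "l * of_real N = sesq n A \<xi> + z * sesq n B \<xi>"
    using sesq_eigen[OF \<xi>(2)] split by (simp add: N_def)
  moreover have "sesq n A \<xi> = of_real (a * N)" "sesq n B \<xi> = of_real (b * N)"
    using N sesq_hermitian_Reals[OF hA A, of \<xi>] sesq_hermitian_Reals[OF hB B, of \<xi>]
    by (simp_all add: a_def b_def of_real_Re)
  ultimately have "l * of_real N = (of_real a + z * of_real b) * of_real N" by (simp add: algebra_simps)
  then have leq: "l = of_real a + z * of_real b" using N by simp
  have "\<bar>Re (sesq n A \<xi>)\<bar> \<le> (\<Sum>i<n. \<Sum>j<n. norm (A $$ (i, j))) * N"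
    using abs_Re_le_cmod[of "sesq n A \<xi>"] norm_sesq_le[of n A \<xi>] by (simp add: N_def)
  then have ale: "\<bar>a\<bar> \<le> (\<Sum>i<n. \<Sum>j<n. norm (A $$ (i, j)))"
    using N by (simp add: a_def divide_le_eq)
  have "b1 \<le> b" "b \<le> bn"
    using sesq_hermitian_between[OF hB B ev le, of \<xi>] N by (simp_all add: b_def N_def[symmetric] field_simps)
  then show ?thesis using that ale leq by blast
qed

lemma hermitian_real_eigenvalues:
  assumes "hermitian_mat B" "B \<in> carrier_mat n n" "n \<ge> 1"
  shows "finite {x::real. eigenvalue B (of_real x)}" "{x::real. eigenvalue B (of_real x)} \<noteq> {}"
proof -
  have eq: "{x::real. eigenvalue B (of_real x)} = complex_of_real -` spectrum B" by (auto simp: spectrum_def)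
  show "finite {x::real. eigenvalue B (of_real x)}"
    unfolding eq by (rule finite_vimageI[OF card_finite_spectrum(1)[OF assms(2)]]) (simp add: inj_on_def)
  obtain l where l: "eigenvalue B l" using spectrum_non_empty[OF assms(2)] assms(3) by (auto simp: spectrum_def)
  then obtain x where "l = complex_of_real x"
    using hermitian_eigenvalue_real[OF assms(1,2)] by (auto elim: Reals_cases)
  then show "{x::real. eigenvalue B (of_real x)} \<noteq> {}" using l by auto
qed

section \<open>Polynomial functions of two variables\<close>

inductive bivariate_poly :: "(complex \<Rightarrow> complex \<Rightarrow> complex) \<Rightarrow> bool" where
  const: "bivariate_poly (\<lambda>s y. c)"
| fst: "bivariate_poly (\<lambda>s y. s)"
| snd: "bivariate_poly (\<lambda>s y. y)"
| add: "bivariate_poly f \<Longrightarrow> bivariate_poly g \<Longrightarrow> bivariate_poly (\<lambda>s y. f s y + g s y)"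
| mult: "bivariate_poly f \<Longrightarrow> bivariate_poly g \<Longrightarrow> bivariate_poly (\<lambda>s y. f s y * g s y)"

lemma bivariate_poly_minus:
  assumes "bivariate_poly f" "bivariate_poly g" shows "bivariate_poly (\<lambda>s y. f s y - g s y)"
  using bivariate_poly.add[OF assms(1) bivariate_poly.mult[OF bivariate_poly.const[of "-1"] assms(2)]] by simp

lemma bivariate_poly_sum:
  assumes "\<And>i. i \<in> I \<Longrightarrow> bivariate_poly (f i)" shows "bivariate_poly (\<lambda>s y. \<Sum>i\<in>I. f i s y)"
  using assms by (induction I rule: infinite_finite_induct)
    (simp_all add: bivariate_poly.const bivariate_poly.add)

lemma bivariate_poly_prod:
  assumes "\<And>i. i \<in> I \<Longrightarrow> bivariate_poly (f i)" shows "bivariate_poly (\<lambda>s y. \<Prod>i\<in>I. f i s y)"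
  using assms by (induction I rule: infinite_finite_induct)
    (simp_all add: bivariate_poly.const bivariate_poly.mult)

text \<open>The Leibniz expansion keeps determinants inside the class. Working with a class of
  functions closed under sums and products lets continuity and partial derivatives of D follow by
  rule induction.\<close>

lemma bivariate_poly_det:
  assumes "\<And>i j. i < n \<Longrightarrow> j < n \<Longrightarrow> bivariate_poly (f i j)"
  shows "bivariate_poly (\<lambda>s y. det (mat n n (\<lambda>(i, j). f i j s y)))"
proof -
  have "bivariate_poly (\<lambda>s y. \<Sum>p\<in>{p. p permutes {0..<n}}. signof p * (\<Prod>i = 0..<n. f i (p i) s y))"
    by (intro bivariate_poly_sum bivariate_poly.mult bivariate_poly.const bivariate_poly_prod assms)
      (auto dest: permutes_in_image)
  moreover have "det (mat n n (\<lambda>(i, j). f i j s y)) =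
      (\<Sum>p\<in>{p. p permutes {0..<n}}. signof p * (\<Prod>i = 0..<n. f i (p i) s y))" for s y
    by (subst det_def'[of _ n]) (auto intro!: sum.cong prod.cong dest: permutes_in_image)
  ultimately show ?thesis by simp
qed

lemma bivariate_poly_continuous:
  "bivariate_poly f \<Longrightarrow> continuous_on UNIV (\<lambda>p. f (fst p) (snd p))"
  by (induction rule: bivariate_poly.induct) (auto intro!: continuous_intros)

text \<open>The induction carries both orders of the mixed derivative at once, with one witness
  \<open>fsy\<close>, because \<open>pencil\<close> asks for their equality. The derivatives are
  again in the class, so the lemma can be iterated for the third-order derivative.\<close>

lemma bivariate_poly_derivatives:
  assumes "bivariate_poly f"
  shows "\<exists>fs fy fsy. bivariate_poly fs \<and> bivariate_poly fy \<and> bivariate_poly fsy \<and>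
    (\<forall>s y. ((\<lambda>s. f s y) has_field_derivative fs s y) (at s)) \<and>
    (\<forall>s y. ((\<lambda>y. f s y) has_field_derivative fy s y) (at y)) \<and>
    (\<forall>s y. ((\<lambda>y. fs s y) has_field_derivative fsy s y) (at y)) \<and>
    (\<forall>s y. ((\<lambda>s. fy s y) has_field_derivative fsy s y) (at s))"
  using assms
proof induction
  case (const c)
  show ?case
    by (rule exI[of _ "\<lambda>_ _. 0"], rule exI[of _ "\<lambda>_ _. 0"], rule exI[of _ "\<lambda>_ _. 0"]) (auto intro: bivariate_poly.const)
next
  case fst
  show ?case
    by (rule exI[of _ "\<lambda>_ _. 1"], rule exI[of _ "\<lambda>_ _. 0"], rule exI[of _ "\<lambda>_ _. 0"]) (auto intro: bivariate_poly.const)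
next
  case snd
  show ?case
    by (rule exI[of _ "\<lambda>_ _. 0"], rule exI[of _ "\<lambda>_ _. 1"], rule exI[of _ "\<lambda>_ _. 0"]) (auto intro: bivariate_poly.const)
next
  case (add f g)
  from add.IH(1) obtain fs fy fsy where
    f: "bivariate_poly fs" "bivariate_poly fy" "bivariate_poly fsy"
      "\<And>s y. ((\<lambda>s. f s y) has_field_derivative fs s y) (at s)"
      "\<And>s y. ((\<lambda>y. f s y) has_field_derivative fy s y) (at y)"
      "\<And>s y. ((\<lambda>y. fs s y) has_field_derivative fsy s y) (at y)"
      "\<And>s y. ((\<lambda>s. fy s y) has_field_derivative fsy s y) (at s)"
    by (elim exE conjE) (rule that, (assumption | erule allE, erule allE, assumption)+)
  from add.IH(2) obtain gs gy gsy where
    g: "bivariate_poly gs" "bivariate_poly gy" "bivariate_poly gsy"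
      "\<And>s y. ((\<lambda>s. g s y) has_field_derivative gs s y) (at s)"
      "\<And>s y. ((\<lambda>y. g s y) has_field_derivative gy s y) (at y)"
      "\<And>s y. ((\<lambda>y. gs s y) has_field_derivative gsy s y) (at y)"
      "\<And>s y. ((\<lambda>s. gy s y) has_field_derivative gsy s y) (at s)"
    by (elim exE conjE) (rule that, (assumption | erule allE, erule allE, assumption)+)
  show ?case
    by (rule exI[of _ "\<lambda>s y. fs s y + gs s y"], rule exI[of _ "\<lambda>s y. fy s y + gy s y"],
        rule exI[of _ "\<lambda>s y. fsy s y + gsy s y"])
      (intro conjI allI bivariate_poly.add DERIV_add f g)
next
  case (mult f g)
  from mult.IH(1) obtain fs fy fsy where
    f: "bivariate_poly fs" "bivariate_poly fy" "bivariate_poly fsy"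
      "\<And>s y. ((\<lambda>s. f s y) has_field_derivative fs s y) (at s)"
      "\<And>s y. ((\<lambda>y. f s y) has_field_derivative fy s y) (at y)"
      "\<And>s y. ((\<lambda>y. fs s y) has_field_derivative fsy s y) (at y)"
      "\<And>s y. ((\<lambda>s. fy s y) has_field_derivative fsy s y) (at s)"
    by (elim exE conjE) (rule that, (assumption | erule allE, erule allE, assumption)+)
  from mult.IH(2) obtain gs gy gsy where
    g: "bivariate_poly gs" "bivariate_poly gy" "bivariate_poly gsy"
      "\<And>s y. ((\<lambda>s. g s y) has_field_derivative gs s y) (at s)"
      "\<And>s y. ((\<lambda>y. g s y) has_field_derivative gy s y) (at y)"
      "\<And>s y. ((\<lambda>y. gs s y) has_field_derivative gsy s y) (at y)"
      "\<And>s y. ((\<lambda>s. gy s y) has_field_derivative gsy s y) (at s)"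
    by (elim exE conjE) (rule that, (assumption | erule allE, erule allE, assumption)+)
  show ?case
  proof (rule exI[of _ "\<lambda>s y. fs s y * g s y + gs s y * f s y"],
      rule exI[of _ "\<lambda>s y. fy s y * g s y + gy s y * f s y"],
      rule exI[of _ "\<lambda>s y. (fsy s y * g s y + gy s y * fs s y) + (gsy s y * f s y + fy s y * gs s y)"],
      intro conjI allI)
    fix s y
    show "((\<lambda>s. f s y * g s y) has_field_derivative fs s y * g s y + gs s y * f s y) (at s)"
      by (rule DERIV_mult[OF f(4) g(4)])
    show "((\<lambda>y. f s y * g s y) has_field_derivative fy s y * g s y + gy s y * f s y) (at y)"
      by (rule DERIV_mult[OF f(5) g(5)])
    show "((\<lambda>y. fs s y * g s y + gs s y * f s y) has_field_derivative
        (fsy s y * g s y + gy s y * fs s y) + (gsy s y * f s y + fy s y * gs s y)) (at y)"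
      by (rule DERIV_add[OF DERIV_mult[OF f(6) g(5)] DERIV_mult[OF g(6) f(5)]])
    show "((\<lambda>s. fy s y * g s y + gy s y * f s y) has_field_derivative
        (fsy s y * g s y + gy s y * fs s y) + (gsy s y * f s y + fy s y * gs s y)) (at s)"
      by (rule DERIV_cong[OF DERIV_add[OF DERIV_mult[OF f(7) g(4)] DERIV_mult[OF g(7) f(4)]]]) (simp add: algebra_simps)
  qed (intro bivariate_poly.add bivariate_poly.mult f g mult.hyps)+
qed

lemma poly_char_poly_det:
  fixes M :: "complex mat"
  assumes M: "M \<in> carrier_mat n n"
  shows "poly (char_poly M) s = det (mat n n (\<lambda>(i, j). (if i = j then s else 0) - M $$ (i, j)))"
  unfolding char_poly_matrix[OF M]
  by (rule arg_cong[of _ _ det], rule eq_matI) (use M in \<open>auto simp: char_matrix_def\<close>)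

lemma poly_prod_linear_factors:
  fixes s :: complex
  shows "poly (\<Prod>l\<leftarrow>ls. [:- l, 1:]) s = (\<Prod>l\<leftarrow>ls. s - l)"
  by (induction ls) (auto simp: algebra_simps)

lemma Re_sum_list_map_pos:
  fixes f :: "'a \<Rightarrow> complex"
  assumes "\<And>l. l \<in> set ls \<Longrightarrow> Re (f l) > 0" "ls \<noteq> []"
  shows "Re (\<Sum>l\<leftarrow>ls. f l) > 0"
  using assms
proof (induction ls)
  case (Cons l ls)
  then show ?case by (cases "ls = []") (auto intro: add_pos_pos)
qed simp

text \<open>S - y M equals -M (y - M^(-1) S), with the inverse written through the adjugate. Up to a
  constant factor the determinant is therefore a characteristic polynomial in y, which provides
  exactly n roots in y.\<close>

lemma mat_affine_factorization:
  fixes M S :: "complex mat"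
  assumes M: "M \<in> carrier_mat n n" and S: "S \<in> carrier_mat n n" and d: "det M \<noteq> 0"
  shows "det (S - y \<cdot>\<^sub>m M) = (- 1) ^ n * det M * poly (char_poly ((1 / det M) \<cdot>\<^sub>m (adj_mat M * S))) y"
proof -
  let ?Y = "(1 / det M) \<cdot>\<^sub>m (adj_mat M * S)"
  note N = adj_mat[OF M]
  have Y: "?Y \<in> carrier_mat n n" using N(1) S by simp
  have yY: "y \<cdot>\<^sub>m 1\<^sub>m n - ?Y \<in> carrier_mat n n" by (rule minus_carrier_mat[OF Y])
  have "M * ?Y = (1 / det M) \<cdot>\<^sub>m (M * (adj_mat M * S))" by (rule mult_smult_distrib[OF M, of _ n]) (use N S in simp)
  also have "M * (adj_mat M * S) = M * adj_mat M * S" by (rule assoc_mult_mat[symmetric, OF M N(1) S])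
  also have "\<dots> = det M \<cdot>\<^sub>m S" unfolding N(2) using S by (simp add: mult_smult_assoc_mat[of _ n n _ n])
  also have "(1 / det M) \<cdot>\<^sub>m (det M \<cdot>\<^sub>m S) = S" by (rule eq_matI) (use d in auto)
  finally have MY: "M * ?Y = S" .
  have My: "M * (y \<cdot>\<^sub>m 1\<^sub>m n) = y \<cdot>\<^sub>m M"
    using M by (simp add: mult_smult_distrib[OF M, of _ n])
  have "M * (y \<cdot>\<^sub>m 1\<^sub>m n - ?Y) = y \<cdot>\<^sub>m M - S"
    by (subst mult_minus_distrib_mat[OF M _ Y]) (auto simp: My MY)
  then have "S - y \<cdot>\<^sub>m M = (- 1) \<cdot>\<^sub>m (M * (y \<cdot>\<^sub>m 1\<^sub>m n - ?Y))"
    using M S by (auto intro!: eq_matI)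
  then have "det (S - y \<cdot>\<^sub>m M) = (- 1) ^ n * (det M * det (y \<cdot>\<^sub>m 1\<^sub>m n - ?Y))"
    using Y S by (simp add: det_mult[OF M yY])
  also have "det (y \<cdot>\<^sub>m 1\<^sub>m n - Z) = poly (char_poly Z) y" if Z: "Z \<in> carrier_mat n n" for Z
    unfolding poly_char_poly_det[OF Z]
    by (rule arg_cong[of _ _ det], rule eq_matI) (use Z in auto)
  note this[OF Y]
  finally show ?thesis by (simp add: mult.assoc)
qed

section \<open>The entire function Tr exp (A + z B)\<close>

locale hermitian_pair =
  fixes n :: nat and A B :: "complex mat" and b1 bn :: real
  assumes n1: "n \<ge> 1"
    and A: "A \<in> carrier_mat n n" and hA: "hermitian_mat A"
    and B: "B \<in> carrier_mat n n" and hB: "hermitian_mat B"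
    and ev: "\<And>x. eigenvalue B (of_real x) \<Longrightarrow> b1 \<le> x \<and> x \<le> bn" and le: "b1 \<le> bn"
begin

definition X where "X z = A + z \<cdot>\<^sub>m B"
text \<open>The function f of the theorem is recovered as f(t) = \<Phi>(-t). With this sign \<Phi>
  is to be the moment generating function of the measure, and the spectrum of B appears without
  reflection.\<close>

definition \<Phi> where "\<Phi> z = mat_trace (mat_exp (X z))"
definition P where "P s z = poly (char_poly (X z)) s"
definition "\<alpha> = (\<Sum>i<n. \<Sum>j<n. norm (A $$ (i, j)))"

lemma X: "X z \<in> carrier_mat n n" using A B by (simp add: X_def)

lemma X_index: "i < n \<Longrightarrow> j < n \<Longrightarrow> X z $$ (i, j) = A $$ (i, j) + z * B $$ (i, j)"
  using A B by (simp add: X_def)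

lemma P_det: "P s z = det (mat n n (\<lambda>(i, j). (if i = j then s else 0) - (A $$ (i, j) + z * B $$ (i, j))))"
  unfolding P_def poly_char_poly_det[OF X]
  by (rule arg_cong[of _ _ det], rule eq_matI) (auto simp: X_index)

lemma P_roots: "\<exists>ls. length ls = n \<and> (\<forall>s. P s z = (\<Prod>l\<leftarrow>ls. s - l))"
  using char_poly_factorized[OF X, of z] by (auto simp: P_def poly_prod_linear_factors)

lemma \<Phi>_roots:
  assumes "\<forall>s. P s z = (\<Prod>l\<leftarrow>ls. s - l)"
  shows "\<Phi> z = (\<Sum>l\<leftarrow>ls. exp l)"
proof -
  have "poly (char_poly (X z)) = poly (\<Prod>l\<leftarrow>ls. [:- l, 1:])"
    using assms by (auto simp: P_def poly_prod_linear_factors)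
  then have "char_poly (X z) = (\<Prod>l\<leftarrow>ls. [:- l, 1:])" by (simp add: poly_eq_poly_eq_iff)
  then show ?thesis unfolding \<Phi>_def by (rule mat_trace_mat_exp[OF X])
qed

lemma P_zeroE:
  assumes "P s z = 0"
  obtains a b :: real where "\<bar>a\<bar> \<le> \<alpha>" "b1 \<le> b" "b \<le> bn" "s = of_real a + z * of_real b"
proof -
  have "eigenvalue (X z) s" using assms by (simp add: P_def eigenvalue_root_char_poly[OF X])
  then show ?thesis
    using eigenvalue_hermitian_pencil[OF hA A hB B ev le] that unfolding X_def \<alpha>_def by blast
qed

lemma root_listE:
  assumes "\<forall>s. P s z = (\<Prod>l\<leftarrow>ls. s - l)" "l \<in> set ls"
  obtains a b :: real where "\<bar>a\<bar> \<le> \<alpha>" "b1 \<le> b" "b \<le> bn" "l = of_real a + z * of_real b"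
proof -
  have "P l z = 0" using assms by (auto simp: prod_list_zero_iff)
  then show ?thesis using P_zeroE that by blast
qed

text \<open>Each eigenvalue is a + z b with real a and b, so its real part is a + b Re z. This is at
  most \<alpha> plus the larger of the values at b = \<open>b1\<close> and b = \<open>bn\<close>,
  the linear function of b being maximal at an end of the interval.\<close>

lemma norm_\<Phi>_le: "norm (\<Phi> z) \<le> (real n * exp \<alpha>) * exp (max (Re z * b1) (Re z * bn))"
proof -
  obtain ls where ls: "length ls = n" "\<forall>s. P s z = (\<Prod>l\<leftarrow>ls. s - l)" using P_roots by blast
  have "norm (exp l) \<le> exp (\<alpha> + max (Re z * b1) (Re z * bn))" if l: "l \<in> set ls" for l
  proof -
    obtain a b :: real where ab: "\<bar>a\<bar> \<le> \<alpha>" "b1 \<le> b" "b \<le> bn" "l = of_real a + z * of_real b"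
      using root_listE[OF ls(2) l] by blast
    have "Re z * b \<le> max (Re z * b1) (Re z * bn)"
      using ab mult_left_mono[of b bn "Re z"] mult_left_mono_neg[of b1 b "Re z"] by (cases "Re z \<ge> 0") (auto simp: max_def)
    then show ?thesis using ab by (simp add: norm_exp_eq_Re)
  qed
  from norm_sum_list_le[of ls exp, OF this] show ?thesis
    unfolding \<Phi>_roots[OF ls(2)] by (simp add: ls(1) exp_add mult.assoc)
qed

lemma Re_\<Phi>_0_pos: "Re (\<Phi> 0) > 0"
proof -
  obtain ls where ls: "length ls = n" "\<forall>s. P s 0 = (\<Prod>l\<leftarrow>ls. s - l)" using P_roots by blast
  have "Re (exp l) > 0" if l: "l \<in> set ls" for l
  proof -
    obtain a where "l = complex_of_real a" using root_listE[OF ls(2) l] by (metis add.right_neutral mult_zero_left)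
    then show ?thesis by (simp add: Re_exp)
  qed
  then show ?thesis unfolding \<Phi>_roots[OF ls(2)] using ls(1) n1 by (intro Re_sum_list_map_pos) auto
qed

text \<open>For Hermitian A and B, conjugating the entries amounts to transposing, and the
  determinant is invariant under transposition.\<close>

lemma P_cnj: "P (cnj s) (cnj z) = cnj (P s z)"
proof -
  interpret cnj: comm_ring_hom cnj by unfold_locales auto
  let ?W = "\<lambda>s z. mat n n (\<lambda>(i, j). (if i = j then s else 0) - (A $$ (i, j) + z * B $$ (i, j)))"
  have "P (cnj s) (cnj z) = det (transpose_mat (map_mat cnj (?W s z)))"
    unfolding P_det
    by (rule arg_cong[of _ _ det], rule eq_matI)
      (use hermitian_mat_index[OF hA A] hermitian_mat_index[OF hB B] in auto)
  also have "\<dots> = det (map_mat cnj (?W s z))" by (rule det_transpose[of _ n]) simp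
  also have "\<dots> = cnj (P s z)" unfolding P_det by (rule cnj.hom_det)
  finally show ?thesis .
qed

lemma \<Phi>_cnj: "\<Phi> (cnj z) = cnj (\<Phi> z)"
proof -
  obtain ls where ls: "\<forall>s. P s z = (\<Prod>l\<leftarrow>ls. s - l)" using P_roots by blast
  have 1: "cnj (\<Prod>l\<leftarrow>ls. s - l) = (\<Prod>l\<leftarrow>map cnj ls. cnj s - l)" for s and ls :: "complex list"
    by (induction ls) auto
  have 2: "cnj (\<Sum>l\<leftarrow>ls. exp l) = (\<Sum>l\<leftarrow>map cnj ls. exp l)" for ls :: "complex list"
    by (induction ls) (auto simp: exp_cnj)
  have "\<forall>s. P s (cnj z) = (\<Prod>l\<leftarrow>map cnj ls. s - l)"
  proof
    fix s
    have "P s (cnj z) = cnj (P (cnj s) z)" using P_cnj[of "cnj s" z] by simp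
    then show "P s (cnj z) = (\<Prod>l\<leftarrow>map cnj ls. s - l)" using ls 1[where s="cnj s" and ls=ls] by simp
  qed
  from \<Phi>_roots[OF this] show ?thesis unfolding \<Phi>_roots[OF ls] 2 .
qed

lemma X_pow_holomorphic:
  "i < n \<Longrightarrow> j < n \<Longrightarrow> (\<lambda>z. (X z ^\<^sub>m k) $$ (i, j)) holomorphic_on S"
proof (induction k arbitrary: i j)
  case 0
  then show ?case using X by (auto simp: carrier_matD[OF X])
next
  case (Suc k)
  have eq: "(X z ^\<^sub>m Suc k) $$ (i, j) = (\<Sum>l<n. (X z ^\<^sub>m k) $$ (i, l) * (A $$ (l, j) + z * B $$ (l, j)))" for z
  proof -
    have "(X z ^\<^sub>m Suc k) $$ (i, j) = (\<Sum>l<n. (X z ^\<^sub>m k) $$ (i, l) * X z $$ (l, j))"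
      using index_mult_mat_sum[OF pow_carrier_mat[OF X] X Suc(2,3)] by simp
    then show ?thesis using Suc by (simp add: X_index)
  qed
  show ?case unfolding eq by (intro holomorphic_intros Suc.IH) (use Suc in auto)
qed

text \<open>The eigenvalues need not depend holomorphically on z, so the exponential series is used:
  its partial sums are polynomials in the entries and converge uniformly on unit balls by the
  Weierstrass test.\<close>

lemma \<Phi>_holomorphic: "\<Phi> holomorphic_on UNIV"
proof (rule holomorphic_uniform_sequence[where f="\<lambda>N z. \<Sum>k<N. mat_trace (X z ^\<^sub>m k) / fact k"])
  show "(\<lambda>z. \<Sum>k<N. mat_trace (X z ^\<^sub>m k) / fact k) holomorphic_on UNIV" for N
    unfolding mat_trace_def pow_mat_dim carrier_matD[OF X]
    by (intro holomorphic_intros X_pow_holomorphic) auto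
  show "\<exists>d>0. cball x d \<subseteq> UNIV \<and>
      uniform_limit (cball x d) (\<lambda>N z. \<Sum>k<N. mat_trace (X z ^\<^sub>m k) / fact k) \<Phi> sequentially" for x
  proof (intro exI[of _ 1] conjI)
    \<comment> \<open>A common bound for all entries of X z on the ball; the k-th powers then have
      entries at most (n m)^k.\<close>
    define m where "m = (\<Sum>i<n. \<Sum>j<n. norm (A $$ (i, j)) + (norm x + 1) * norm (B $$ (i, j)))"
    have Xm: "norm (X z $$ (i, j)) \<le> m" if z: "z \<in> cball x 1" and ij: "i < n" "j < n" for z i j
    proof -
      have "norm z \<le> norm x + 1" using z norm_triangle_sub[of z x] by (simp add: dist_norm norm_minus_commute)
      then have "norm (X z $$ (i, j)) \<le> norm (A $$ (i, j)) + (norm x + 1) * norm (B $$ (i, j))"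
        unfolding X_index[OF ij] by (intro norm_triangle_le add_left_mono) (simp add: norm_mult mult_right_mono)
      also have "\<dots> \<le> (\<Sum>j<n. norm (A $$ (i, j)) + (norm x + 1) * norm (B $$ (i, j)))"
        by (rule member_le_sum[of j _ "\<lambda>j. norm (A $$ (i, j)) + (norm x + 1) * norm (B $$ (i, j))"]) (use ij in auto)
      also have "\<dots> \<le> m" unfolding m_def
        by (rule member_le_sum[of i _ "\<lambda>i. \<Sum>j<n. norm (A $$ (i, j)) + (norm x + 1) * norm (B $$ (i, j))"])
          (use ij in \<open>auto intro!: sum_nonneg add_nonneg_nonneg mult_nonneg_nonneg\<close>)
      finally show ?thesis .
    qed
    have "uniform_limit (cball x 1) (\<lambda>N z. \<Sum>k<N. mat_trace (X z ^\<^sub>m k) / fact k)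
        (\<lambda>z. \<Sum>k. mat_trace (X z ^\<^sub>m k) / fact k) sequentially"
    proof (rule Weierstrass_m_test)
      show "summable (\<lambda>k. real n * (inverse (fact k) * (real n * m) ^ k))"
        by (intro summable_mult summable_exp)
      fix k z assume z: "z \<in> cball x 1"
      have "norm (mat_trace (X z ^\<^sub>m k)) \<le> (\<Sum>i<n. (real n * m) ^ k)"
        unfolding mat_trace_def pow_mat_dim carrier_matD[OF X]
        by (rule sum_norm_le, rule norm_pow_mat_index_le[OF X Xm[OF z]]) auto
      then show "norm (mat_trace (X z ^\<^sub>m k) / fact k) \<le> real n * (inverse (fact k) * (real n * m) ^ k)"
        by (simp add: norm_divide divide_simps mult.commute)
    qed
    moreover have "(\<Sum>k. mat_trace (X z ^\<^sub>m k) / fact k) = \<Phi> z" for z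
      unfolding \<Phi>_def using sums_unique[OF mat_trace_mat_exp_sums[OF X]] by simp
    ultimately show "uniform_limit (cball x 1) (\<lambda>N z. \<Sum>k<N. mat_trace (X z ^\<^sub>m k) / fact k) \<Phi> sequentially"
      by simp
  qed auto
qed auto

text \<open>The substitution gives D(s,y) = det (s - y v - A + y B), the determinant of s - A - y (v
  - B). It expresses D through the characteristic polynomial of X at -y, whose zeros are already
  located.\<close>

lemma pencil_exists:
  assumes v: "Im v > 0"
  defines "D \<equiv> \<lambda>s y. P (s - y * v) (- y)"
  shows "\<exists>Ds Dy Dss Dsy Dssy. pencil n D Ds Dy Dss Dsy Dssy v \<alpha> (\<bar>b1\<bar> + \<bar>bn\<bar>)"
proof -
  have bp: "bivariate_poly D"
  proof -
    have "bivariate_poly (\<lambda>s y. det (mat n n (\<lambda>(i, j). (if i = j then 1 else 0) * (s - y * v) - (A $$ (i, j) - y * B $$ (i, j)))))"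
      by (intro bivariate_poly_det bivariate_poly_minus bivariate_poly.intros)
    moreover have "D = (\<lambda>s y. det (mat n n (\<lambda>(i, j). (if i = j then 1 else 0) * (s - y * v) - (A $$ (i, j) - y * B $$ (i, j)))))"
      unfolding D_def P_det by (intro ext, rule arg_cong[of _ _ det], rule eq_matI) auto
    ultimately show ?thesis by simp
  qed
  obtain Ds Dy Dsy where 1: "bivariate_poly Ds" "bivariate_poly Dy" "bivariate_poly Dsy"
      "\<And>s y. ((\<lambda>s. D s y) has_field_derivative Ds s y) (at s)"
      "\<And>s y. ((\<lambda>y. D s y) has_field_derivative Dy s y) (at y)"
      "\<And>s y. ((\<lambda>y. Ds s y) has_field_derivative Dsy s y) (at y)"
      "\<And>s y. ((\<lambda>s. Dy s y) has_field_derivative Dsy s y) (at s)"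
    using bivariate_poly_derivatives[OF bp] by metis
  obtain Dss Dsy' Dssy where 2: "bivariate_poly Dss" "bivariate_poly Dsy'" "bivariate_poly Dssy"
      "\<And>s y. ((\<lambda>s. Ds s y) has_field_derivative Dss s y) (at s)"
      "\<And>s y. ((\<lambda>y. Ds s y) has_field_derivative Dsy' s y) (at y)"
      "\<And>s y. ((\<lambda>y. Dss s y) has_field_derivative Dssy s y) (at y)"
      "\<And>s y. ((\<lambda>s. Dsy' s y) has_field_derivative Dssy s y) (at s)"
    using bivariate_poly_derivatives[OF 1(1)] by metis
  \<comment> \<open>The second application of the derivative lemma, now to \<open>Ds\<close>, yields
    its own y-derivative; uniqueness identifies it with the first.\<close>
  have [simp]: "Dsy' = Dsy" by (intro ext) (rule DERIV_unique[OF 2(5) 1(6)])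
  have "pencil n D Ds Dy Dss Dsy Dssy v \<alpha> (\<bar>b1\<bar> + \<bar>bn\<bar>)"
  proof
    fix s y
    show "Im v > 0" by fact
    obtain ls where ls: "length ls = n" "\<forall>s. P s (- y) = (\<Prod>l\<leftarrow>ls. s - l)" using P_roots by blast
    show "\<exists>ls. length ls = n \<and> (\<forall>s. D s y = (\<Prod>l\<leftarrow>ls. s - l))"
      by (rule exI[of _ "map (\<lambda>l. l + y * v) ls"]) (use ls in \<open>simp add: D_def o_def algebra_simps\<close>)
    define M where "M = mat n n (\<lambda>(i, j). (if i = j then v else 0) - B $$ (i, j))"
    define S where "S = mat n n (\<lambda>(i, j). (if i = j then s else 0) - A $$ (i, j))"
    have MS: "M \<in> carrier_mat n n" "S \<in> carrier_mat n n" by (auto simp: M_def S_def)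
    \<comment> \<open>M is v - B, and the non-real v is no eigenvalue of the Hermitian B.\<close>
    have dM: "det M \<noteq> 0"
    proof
      assume "det M = 0"
      then have "eigenvalue B v" by (simp add: eigenvalue_root_char_poly[OF B] poly_char_poly_det[OF B] M_def)
      then have "v \<in> \<real>" by (rule hermitian_eigenvalue_real[OF hB B])
      then show False using v by (auto simp: complex_is_Real_iff)
    qed
    let ?Y = "(1 / det M) \<cdot>\<^sub>m (adj_mat M * S)"
    have DY: "D s y = (- 1) ^ n * det M * poly (char_poly ?Y) y" for y
      unfolding mat_affine_factorization[OF MS dM, symmetric] D_def P_det
      by (rule arg_cong[of _ _ det], rule eq_matI) (auto simp: M_def S_def algebra_simps)
    have "?Y \<in> carrier_mat n n" using adj_mat(1)[OF MS(1)] MS(2) by simp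
    then obtain rs where rs: "char_poly ?Y = (\<Prod>r\<leftarrow>rs. [:- r, 1:])" "length rs = n"
      using char_poly_factorized by blast
    show "\<exists>c ls. c \<noteq> 0 \<and> length ls = n \<and> (\<forall>y. D s y = c * (\<Prod>r\<leftarrow>ls. y - r))"
      by (rule exI[of _ "(- 1) ^ n * det M"], rule exI[of _ rs])
        (use DY rs dM in \<open>simp add: poly_prod_linear_factors\<close>)
    show "\<exists>a b. \<bar>a\<bar> \<le> \<alpha> \<and> \<bar>b\<bar> \<le> \<bar>b1\<bar> + \<bar>bn\<bar> \<and> s = complex_of_real a + y * (v - complex_of_real b)" if zero: "D s y = 0"
    proof -
      obtain a b :: real where "\<bar>a\<bar> \<le> \<alpha>" "b1 \<le> b" "b \<le> bn" "s - y * v = of_real a + (- y) * of_real b"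
        using P_zeroE[OF zero[unfolded D_def]] by blast
      then show ?thesis by (intro exI[of _ a] exI[of _ b]) (auto simp: algebra_simps)
    qed
  qed (use 1 2 bp in \<open>auto intro: bivariate_poly_continuous\<close>)
  then show ?thesis by blast
qed

text \<open>With v = \<theta> + i \<delta> the weight is exp (i r v). The roots of D(.,i r) are the
  eigenvalues of X (-i r) shifted by i r v, so the sum of their exponentials is precisely this
  weight times \<Phi>(-i r).\<close>

lemma \<Phi>_half_line_integral_nonneg:
  assumes \<delta>: "\<delta> > 0"
  shows "0 \<le> Re (LINT r:{0..}|lborel. iexp (r * \<theta>) * of_real (exp (- \<delta> * r)) * \<Phi> (- (\<i> * of_real r)))"
proof -
  define v where "v = Complex \<theta> \<delta>"
  have v: "Im v > 0" using \<delta> by (simp add: v_def)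
  obtain Ds Dy Dss Dsy Dssy where pen: "pencil n (\<lambda>s y. P (s - y * v) (- y)) Ds Dy Dss Dsy Dssy v \<alpha> (\<bar>b1\<bar> + \<bar>bn\<bar>)"
    using pencil_exists[OF v] by blast
  have ev: "iexp (r * \<theta>) * of_real (exp (- \<delta> * r)) = exp (\<i> * of_real r * v)" for r
  proof -
    have "\<i> * of_real r * v = \<i> * of_real (r * \<theta>) + of_real (- \<delta> * r)"
      by (simp add: v_def complex_eq_iff)
    then show ?thesis by (simp only: exp_add exp_of_real)
  qed
  show ?thesis
  proof (rule pencil.Re_integral_exp_roots_nonneg[OF pen])
    fix r :: real and ls
    assume D: "\<forall>s. P (s - \<i> * of_real r * v) (- (\<i> * of_real r)) = (\<Prod>l\<leftarrow>ls. s - l)"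
    \<comment> \<open>Undoing the shift turns the given roots of D into characteristic roots of A -
      i r B.\<close>
    have "\<forall>s. P s (- (\<i> * of_real r)) = (\<Prod>l\<leftarrow>map (\<lambda>l. l - \<i> * of_real r * v) ls. s - l)"
    proof
      fix s
      show "P s (- (\<i> * of_real r)) = (\<Prod>l\<leftarrow>map (\<lambda>l. l - \<i> * of_real r * v) ls. s - l)"
        using D[rule_format, of "s + \<i> * of_real r * v"] by (simp add: o_def algebra_simps)
    qed
    from \<Phi>_roots[OF this]
    have "\<Phi> (- (\<i> * of_real r)) = (\<Sum>l\<leftarrow>ls. exp (l - \<i> * of_real r * v))" by (simp add: o_def)
    also have "\<dots> = (\<Sum>l\<leftarrow>ls. exp (- (\<i> * of_real r * v)) * exp l)"
      by (simp add: exp_add[symmetric])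
    also have "\<dots> = exp (- (\<i> * of_real r * v)) * (\<Sum>l\<leftarrow>ls. exp l)" by (rule sum_list_const_mult)
    finally show "iexp (r * \<theta>) * of_real (exp (- \<delta> * r)) * \<Phi> (- (\<i> * of_real r)) = (\<Sum>l\<leftarrow>ls. exp l)"
      unfolding ev by (simp add: mult.assoc[symmetric] exp_minus_inverse)
  next
    have c\<Phi>: "continuous_on UNIV (\<lambda>r::real. \<Phi> (- (\<i> * of_real r)))"
      by (rule continuous_on_compose2[OF holomorphic_on_imp_continuous_on[OF \<Phi>_holomorphic]]) (auto intro!: continuous_intros)
    show "set_integrable lborel {0..} (\<lambda>r. iexp (r * \<theta>) * of_real (exp (- \<delta> * r)) * \<Phi> (- (\<i> * of_real r)))"
      unfolding set_integrable_def
    proof (rule Bochner_Integration.integrable_bound)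
      show "integrable lborel (\<lambda>r. (real n * exp \<alpha>) * (indicator {0..} r * exp (- \<delta> * r)))"
        by (intro integrable_mult_right integrable_exp_decay \<delta>)
      have "(\<lambda>r. iexp (r * \<theta>) * of_real (exp (- \<delta> * r)) * \<Phi> (- (\<i> * of_real r))) \<in> borel_measurable borel"
        by (rule borel_measurable_continuous_onI) (intro continuous_intros c\<Phi>)
      then show "(\<lambda>r. indicator {0..} r *\<^sub>R (iexp (r * \<theta>) * of_real (exp (- \<delta> * r)) * \<Phi> (- (\<i> * of_real r)))) \<in> borel_measurable lborel"
        by (intro borel_measurable_scaleR) auto
      show "AE r in lborel. norm (indicator {0..} r *\<^sub>R (iexp (r * \<theta>) * of_real (exp (- \<delta> * r)) * \<Phi> (- (\<i> * of_real r))))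
          \<le> norm ((real n * exp \<alpha>) * (indicator {0..} r * exp (- \<delta> * r)))"
      proof (rule AE_I2)
        fix r :: real
        have "norm (\<Phi> (- (\<i> * of_real r))) \<le> real n * exp \<alpha>" using norm_\<Phi>_le[of "- (\<i> * of_real r)"] by simp
        then have "exp (- \<delta> * r) * norm (\<Phi> (- (\<i> * of_real r))) \<le> exp (- \<delta> * r) * (real n * exp \<alpha>)"
          by (intro mult_left_mono) auto
        then show "norm (indicator {0..} r *\<^sub>R (iexp (r * \<theta>) * of_real (exp (- \<delta> * r)) * \<Phi> (- (\<i> * of_real r))))
          \<le> norm ((real n * exp \<alpha>) * (indicator {0..} r * exp (- \<delta> * r)))"
          by (auto simp: norm_mult indicator_def mult_ac)
      qed
    qed
  qed
qed

end

theorem mainTheorem1: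
  fixes A B :: "complex mat" and n :: nat and b1 bn :: real
  assumes "n \<ge> 1"
    and "A \<in> carrier_mat n n" and "hermitian_mat A"
    and "B \<in> carrier_mat n n" and "hermitian_mat B"
    and "b1 = Min {x :: real. eigenvalue B (complex_of_real x)}"
    and "bn = Max {x :: real. eigenvalue B (complex_of_real x)}"
  shows "\<exists>\<mu> :: real measure. sets \<mu> = sets (restrict_space borel {b1..bn}) \<and>
    (\<forall>t :: real. integrable \<mu> (\<lambda>s. exp (- s * t)) \<and>
      mat_trace (mat_exp (A - complex_of_real t \<cdot>\<^sub>m B)) = complex_of_real (\<integral>s. exp (- s * t) \<partial>\<mu>))"
proof -
  note fin = hermitian_real_eigenvalues[OF assms(5,4,1)]
  interpret hermitian_pair n A B b1 bn
  proof
    show "b1 \<le> x \<and> x \<le> bn" if "eigenvalue B (complex_of_real x)" for x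
      using that fin by (simp add: assms(6,7))
    show "b1 \<le> bn" using Min_in[OF fin] Max_ge[OF fin(1)] by (simp add: assms(6,7))
  qed (use assms in auto)
  obtain M where M: "real_distribution M" and supp: "AE x in M. b1 \<le> x \<and> x \<le> bn"
    and rep: "\<And>t. integrable M (\<lambda>x. exp (t * x))"
      "\<And>t. \<Phi> (of_real t) = of_real (Re (\<Phi> 0) * (\<integral>x. exp (t * x) \<partial>M))"
    using exponential_type_representation[OF \<Phi>_holomorphic norm_\<Phi>_le \<Phi>_cnj \<Phi>_half_line_integral_nonneg Re_\<Phi>_0_pos le]
    by blast
  interpret M: real_distribution M by (fact M)
  define c where "c = Re (\<Phi> 0)"
  have c: "c > 0" using Re_\<Phi>_0_pos by (simp add: c_def)
  \<comment> \<open>Scaling by c = Tr exp A restores the mass that was normalized to 1, and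
    restricting to [b1, bn] loses nothing because M is concentrated there.\<close>
  define \<mu> where "\<mu> = restrict_space (density M (\<lambda>_. ennreal c)) {b1..bn}"
  have sets\<mu>: "sets \<mu> = sets (restrict_space borel {b1..bn})"
    unfolding \<mu>_def by (rule sets_restrict_space_cong) simp
  have AEeq: "AE x in M. c *\<^sub>R (indicator {b1..bn} x *\<^sub>R exp (- x * t)) = c * exp (- t * x)" for t
    using supp by eventually_elim (simp add: mult.commute)
  have int: "integrable \<mu> (\<lambda>s. exp (- s * t))" for t
  proof -
    have "integrable M (\<lambda>x. c *\<^sub>R (indicator {b1..bn} x *\<^sub>R exp (- x * t)))"
      by (subst integrable_cong_AE[OF _ _ AEeq]) (use rep(1)[of "- t"] in auto)
    then show ?thesis
      unfolding \<mu>_def using c by (simp add: integrable_restrict_space integrable_density)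
  qed
  have val: "(\<integral>s. exp (- s * t) \<partial>\<mu>) = c * (\<integral>x. exp (- t * x) \<partial>M)" for t
  proof -
    have "(\<integral>s. exp (- s * t) \<partial>\<mu>) = (\<integral>x. c *\<^sub>R (indicator {b1..bn} x *\<^sub>R exp (- x * t)) \<partial>M)"
      unfolding \<mu>_def using c by (simp add: integral_restrict_space integral_density)
    also have "\<dots> = (\<integral>x. c * exp (- t * x) \<partial>M)"
      by (rule integral_cong_AE[OF _ _ AEeq]) auto
    finally show ?thesis by simp
  qed
  \<comment> \<open>The parameter is -t, which matches the factor exp (- s t) of the theorem with
    the moment of M at -t.\<close>
  have "A - complex_of_real t \<cdot>\<^sub>m B = X (of_real (- t))" for t
    unfolding X_def by (rule eq_matI) (use assms(2,4) in auto)
  then have "mat_trace (mat_exp (A - complex_of_real t \<cdot>\<^sub>m B)) = complex_of_real (\<integral>s. exp (- s * t) \<partial>\<mu>)" for t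
    using rep(2)[of "- t"] unfolding val by (simp add: \<Phi>_def c_def)
  then show ?thesis using sets\<mu> int by blast
qed

end
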